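(* For $i,j\in\mathcal{I}$ with $i\ne j$ put $$\gamma_{i,j}(z)=\frac{1}{\alpha_i}\cdot\frac{\xi_i(z)}{\xi_j(z)}\cdot\left(\frac{1}{(1-\xi_j(z))\,G_j\bigl(o_j,o_j|\xi_j(z)\bigr)}-1\right).$$ Then the $\mathbb{P}_o$-almost sure limit $\Lambda=\lim_{k\to\infty}\mathbf{e}_k/k$ (which exists and is constant) is given by $$\Lambda=\sum_{\substack{i,j\in\mathcal{I}\\ i\neq j}}\nu(i)\cdot\alpha_j\cdot\frac{1-\xi_j}{1-\xi_i}\cdot\gamma_{i,j}'(1).$$
   Context: Let $\mathbb{N}=\{1,2,\dots\}$ and $\mathbb{N}_0=\mathbb{N}\cup\{0\}$. Let $\mathcal{I}=\{1,\dots,r\}$ with $r\ge 2$. For each $i\in\mathcal{I}$ let $V_i$ be a finite or countable set (the $V_i$ pairwise disjoint) with a chosen root $o_i\in V_i$ and a transition matrix $P_i=(p_i(x,y))_{x,y\in V_i}$ with $n$-step probabilities $p_i^{(n)}(x,y)$. Assume $p_i(x,x)=0$ for all $x\in V_i$, and that for every $x\in V_i$ there is $n\in\mathbb{N}$ with $p_i^{(n)}(o_i,x)>0$. Put $V_i^\times=V_i\setminus\{o_i\}$. The free product $V=V_1\ast\dots\ast V_r$ is the set of finite words $x_1\dots x_m$ with letters (blocks) in $\bigcup_i V_i^\times$ such that no two consecutive letters come from the same $V_i$, including the empty word $o$. Each $V_i$ is regarded as a subset of $V$ by identifying $o_i$ with $o$. For $x=x_1\dots x_m\neq o$ and $k\in\mathbb{N}$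 the truncation is $x^{(k)}=x_1\dots x_{\min\{k,m\}}$ (and $o^{(k)}=o$). Fix $\alpha_1,\dots,\alpha_r>0$ with $\sum_i\alpha_i=1$. Let $\bar P_i$ be the lift of $P_i$ to $V$: $\bar p_i(zv,zw)=p_i(v,w)$ if $v,w\in V_i$ and $z\in V$ is $o$ or has last letter not in $V_i$; $\bar p_i(x,y)=0$ otherwise. The random walk $(Z_n)_{n\in\mathbb{N}_0}$ on $V$ has transition matrix $P=\sum_i\alpha_i\bar P_i$, with single and $n$-step probabilities $p(x,y)$, $p^{(n)}(x,y)$, and $\mathbb{P}_x$ denotes its law started at $x$. Standing assumption: the power series $G(o,o|z)=\sum_{n\ge0}p^{(n)}(o,o)z^n$ has radius of convergence greater than $1$. Let $S_o=\min\{k>0: Z_k=o\}$, $\bar H_i(z)=\sum_{n\ge2}\mathbb{P}_o[S_o=n, Z_1\notin V_i]z^n$, $\xi_i(z)=\dfrac{\alpha_i z}{1-\bar H_i(z)}$, $\xi_i=\xi_i(1)$ (one has $\xi_i<1$), and $G_i(o_i,o_i|z)=\sum_{n\ge0}p_i^{(n)}(o_i,o_i)z^n$. The exit time with respect to block length $k\in\mathbb{N}$ is $\mathbf{e}_k=\min\{m\in\mathbb{N}: Z_n^{(k)}\text{ is constant for all } n\ge m\}$ (it is $\mathbb{P}_o$-almost surely finite). For $y\in V_j^\times$ let $\mathcal{P}(y)=\{w\in V_j: p_j(w,y)>0\}$, and let $k_i^{(n)}(o,y)=\mathbb{P}_o[Z_m\notin V_i^\times\ \forall m\in\{0,\dots,n\},\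 Z_n=y]$. Put $\hat q(i,i)=0$ and, for $i\neq j$, $$\hat q(i,j)=\frac{1-\xi_j}{1-\xi_i}\sum_{y\in V_j^\times}\sum_{n\ge1}\sum_{s\in\mathcal{P}(y)}k_i^{(n-1)}(o,s)\,p(s,y).$$ This is an irreducible stochastic matrix on $\mathcal{I}$, and $\nu$ denotes its invariant probability measure, i.e. $\sum_{i\in\mathcal{I}}\nu(i)\hat q(i,j)=\nu(j)$ for all $j\in\mathcal{I}$. *)

theory Defs
  imports "HOL-Probability.Probability"
begin

section \<open>Free products of rooted transition matrices\<close>

record 'a free_product_data =
  nfactors :: nat
  factor :: "nat \<Rightarrow> 'a set"
  root :: "nat \<Rightarrow> 'a"
  step :: "nat \<Rightarrow> 'a \<Rightarrow> 'a \<Rightarrow> real"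
  weight :: "nat \<Rightarrow> real"

definition indices :: "'a free_product_data \<Rightarrow> nat set" where
  "indices D = {1..nfactors D}"

definition factor_pos :: "'a free_product_data \<Rightarrow> nat \<Rightarrow> 'a set" where
  "factor_pos D i = factor D i - {root D i}"

text \<open>The factors are pairwise disjoint, so a letter determines the factor it comes from and a word
  is a plain list of letters; the empty word \<^term>\<open>[]\<close> is the root of the free product.\<close>

definition words :: "'a free_product_data \<Rightarrow> 'a list set" where
  "words D = {x. set x \<subseteq> (\<Union>i\<in>indices D. factor_pos D i) \<and>
     successively (\<lambda>a b. \<not> (\<exists>i\<in>indices D. a \<in> factor_pos D i \<and> b \<in> factor_pos D i)) x}"

text \<open>The identification of the \<open>i\<close>-th factor with a set of words sends the root to \<^term>\<open>[]\<close>.\<close>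

definition emb :: "'a free_product_data \<Rightarrow> nat \<Rightarrow> 'a \<Rightarrow> 'a list" where
  "emb D i v = (if v = root D i then [] else [v])"

text \<open>The \<open>n\<close>-step probabilities of a transition matrix \<open>q\<close> on a countable set \<open>S\<close>.\<close>

primrec nstep :: "'s set \<Rightarrow> ('s \<Rightarrow> 's \<Rightarrow> real) \<Rightarrow> nat \<Rightarrow> 's \<Rightarrow> 's \<Rightarrow> real" where
  "nstep S q 0 x y = (if x = y then 1 else 0)"
| "nstep S q (Suc n) x y = (\<Sum>\<^sub>\<infinity>w\<in>S. q x w * nstep S q n w y)"

locale free_product =
  fixes D :: "'a free_product_data"
  assumes nfactors: "nfactors D \<ge> 2"
    and countable_factor: "i \<in> indices D \<Longrightarrow> countable (factor D i)"
    and disjoint_factors: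
      "i \<in> indices D \<Longrightarrow> j \<in> indices D \<Longrightarrow> i \<noteq> j \<Longrightarrow> factor D i \<inter> factor D j = {}"
    and root_in: "i \<in> indices D \<Longrightarrow> root D i \<in> factor D i"
    and step_nonneg:
      "i \<in> indices D \<Longrightarrow> x \<in> factor D i \<Longrightarrow> y \<in> factor D i \<Longrightarrow> step D i x y \<ge> 0"
    and step_stochastic:
      "i \<in> indices D \<Longrightarrow> x \<in> factor D i \<Longrightarrow> (step D i x has_sum 1) (factor D i)"
    and step_no_loop: "i \<in> indices D \<Longrightarrow> x \<in> factor D i \<Longrightarrow> step D i x x = 0"
    and reachable: "i \<in> indices D \<Longrightarrow> x \<in> factor D i \<Longrightarrow>
      \<exists>n\<ge>1. nstep (factor D i) (step D i) n (root D i) x > 0"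
    and weight_pos: "i \<in> indices D \<Longrightarrow> weight D i > 0"
    and weight_sum: "(\<Sum>i\<in>indices D. weight D i) = 1"

text \<open>The lift of the \<open>i\<close>-th matrix. A pair of words has at most one common decomposition
  \<open>(zv, zw)\<close> of the required form, so the sum has at most one term, see \<open>lift_append_emb\<close>;
  it is empty, hence zero, if there is none.\<close>

definition lift :: "'a free_product_data \<Rightarrow> nat \<Rightarrow> 'a list \<Rightarrow> 'a list \<Rightarrow> real" where
  "lift D i x y =
     (\<Sum>(z, v, w) \<in> {(z, v, w). z \<in> words D \<and> (z = [] \<or> last z \<notin> factor D i) \<and>
          v \<in> factor D i \<and> w \<in> factor D i \<and> x = z @ emb D i v \<and> y = z @ emb D i w}.
        step D i v w)"

lemma lift_append_emb:
  assumes z: "z \<in> words D" "z = [] \<or> last z \<notin> factor D i"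
    and vw: "v \<in> factor D i" "w \<in> factor D i"
  shows "lift D i (z @ emb D i v) (z @ emb D i w) = step D i v w"
proof -
  have uniq: "z' = z \<and> v' = u" if "z' @ emb D i v' = z @ emb D i u"
    "z' = [] \<or> last z' \<notin> factor D i" "v' \<in> factor D i" "u \<in> factor D i" for z' v' u
    using that z(2) by (auto simp: emb_def split: if_splits)
  have "{(z', v', w'). z' \<in> words D \<and> (z' = [] \<or> last z' \<notin> factor D i) \<and>
          v' \<in> factor D i \<and> w' \<in> factor D i \<and> z @ emb D i v = z' @ emb D i v' \<and>
          z @ emb D i w = z' @ emb D i w'} = {(z, v, w)}"
    (is "?A = _")
  proof (rule set_eqI)
    fix t :: "'a list \<times> 'a \<times> 'a"
    obtain z' v' w' where t: "t = (z', v', w')" by (cases t)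
    have "t \<in> ?A \<Longrightarrow> z' = z \<and> v' = v \<and> w' = w"
      using uniq[of z' v' v] uniq[of z' w' w] vw by (simp add: t)
    moreover have "(z, v, w) \<in> ?A" using z vw by simp
    ultimately show "t \<in> ?A \<longleftrightarrow> t \<in> {(z, v, w)}" unfolding t by blast
  qed
  then show ?thesis by (simp add: lift_def)
qed

definition trans_prob :: "'a free_product_data \<Rightarrow> 'a list \<Rightarrow> 'a list \<Rightarrow> real" where
  "trans_prob D x y = (\<Sum>i\<in>indices D. weight D i * lift D i x y)"


section \<open>The random walk started at the empty word\<close>

text \<open>\<open>M\<close> plays the role of the law of the walk started at \<^term>\<open>[]\<close>.\<close>

locale free_product_walk = free_product D + prob_space M
  for D :: "'a free_product_data" and M :: "'w measure" +
  fixes Z :: "nat \<Rightarrow> 'w \<Rightarrow> 'a list"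
  assumes Z_measurable: "Z n \<in> M \<rightarrow>\<^sub>M count_space (words D)"
    and Z_law: "measure M {\<omega> \<in> space M. \<forall>k\<le>n. Z k \<omega> = x k} =
      (if x 0 = [] then 1 else 0) * (\<Prod>k<n. trans_prob D (x k) (x (Suc k)))"

definition return_time :: "(nat \<Rightarrow> 'w \<Rightarrow> 'a list) \<Rightarrow> 'w \<Rightarrow> enat" where
  "return_time Z \<omega> = Inf {enat k |k. k > 0 \<and> Z k \<omega> = []}"

text \<open>On the null set where no such \<open>m\<close> exists the value is unspecified.\<close>

definition exit_time :: "(nat \<Rightarrow> 'w \<Rightarrow> 'a list) \<Rightarrow> nat \<Rightarrow> 'w \<Rightarrow> nat" where
  "exit_time Z k \<omega> = (LEAST m. m \<ge> 1 \<and> (\<forall>n\<ge>m. take k (Z n \<omega>) = take k (Z m \<omega>)))"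

definition Hbar ::
  "'a free_product_data \<Rightarrow> 'w measure \<Rightarrow> (nat \<Rightarrow> 'w \<Rightarrow> 'a list) \<Rightarrow> nat \<Rightarrow> real \<Rightarrow> real" where
  "Hbar D M Z i z = (\<Sum>n. measure M {\<omega> \<in> space M.
     return_time Z \<omega> = enat (n + 2) \<and> Z 1 \<omega> \<notin> emb D i ` factor D i} * z ^ (n + 2))"

definition xi ::
  "'a free_product_data \<Rightarrow> 'w measure \<Rightarrow> (nat \<Rightarrow> 'w \<Rightarrow> 'a list) \<Rightarrow> nat \<Rightarrow> real \<Rightarrow> real" where
  "xi D M Z i z = weight D i * z / (1 - Hbar D M Z i z)"

definition factor_green :: "'a free_product_data \<Rightarrow> nat \<Rightarrow> real \<Rightarrow> real" where
  "factor_green D i z =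
     (\<Sum>n. nstep (factor D i) (step D i) n (root D i) (root D i) * z ^ n)"

definition gamma ::
  "'a free_product_data \<Rightarrow> 'w measure \<Rightarrow> (nat \<Rightarrow> 'w \<Rightarrow> 'a list) \<Rightarrow> nat \<Rightarrow> nat \<Rightarrow> real \<Rightarrow> real" where
  "gamma D M Z i j z = 1 / weight D i * (xi D M Z i z / xi D M Z j z) *
     (1 / ((1 - xi D M Z j z) * factor_green D j (xi D M Z j z)) - 1)"


section \<open>The transition matrix of the types of the stabilised letters\<close>

definition predecessors :: "'a free_product_data \<Rightarrow> nat \<Rightarrow> 'a \<Rightarrow> 'a set" where
  "predecessors D j y = {w \<in> factor D j. step D j w y > 0}"

definition avoid_prob ::
  "'a free_product_data \<Rightarrow> 'w measure \<Rightarrow> (nat \<Rightarrow> 'w \<Rightarrow> 'a list) \<Rightarrow> nat \<Rightarrow> nat \<Rightarrow> 'a list \<Rightarrow> real" where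
  "avoid_prob D M Z i n y = measure M {\<omega> \<in> space M.
     (\<forall>m\<le>n. Z m \<omega> \<notin> emb D i ` factor_pos D i) \<and> Z n \<omega> = y}"

definition qhat ::
  "'a free_product_data \<Rightarrow> 'w measure \<Rightarrow> (nat \<Rightarrow> 'w \<Rightarrow> 'a list) \<Rightarrow> nat \<Rightarrow> nat \<Rightarrow> real" where
  "qhat D M Z i j = (if i = j then 0 else
     (1 - xi D M Z j 1) / (1 - xi D M Z i 1) *
     (\<Sum>\<^sub>\<infinity>y\<in>factor_pos D j. \<Sum>\<^sub>\<infinity>n\<in>{1..}. \<Sum>\<^sub>\<infinity>s\<in>predecessors D j y.
        avoid_prob D M Z i (n - 1) (emb D j s) * trans_prob D (emb D j s) (emb D j y)))"

end

theory Submission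
  imports Defs "HOL-Library.Discrete_Functions"
begin

text \<open>
  At the exit time \<open>e k\<close> the walk enters, for good, the cone of a word \<open>x\<close> of length \<open>k\<close>. Inside the cone
  it behaves like a walk from the empty word that never touches \<open>V\<^sub>i\<^sup>\<times>\<close>, where \<open>i\<close> is the type of the
  last letter of \<open>x\<close>. Therefore the types and the increments of the exit times form a Markov renewal
  process over the finite index set: from type \<open>i\<close> the next increment is \<open>n + 1\<close> and the next type is \<open>j\<close>
  with probability \<open>(1 - \<xi>\<^sub>j) / (1 - \<xi>\<^sub>i) * Kn i j n\<close>. Summed over \<open>n\<close> this is \<open>qhat i j\<close>
  (\<open>qhat_eq\<close>). By the law of large numbers the exit times grow at the rate \<open>\<Sum>\<^sub>i \<nu> i * m i\<close>, with \<open>m i\<close>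
  the mean increment from type \<open>i\<close>, and \<open>m i\<close> is obtained by differentiating at \<open>z = 1\<close> the generating
  function \<open>\<Sum>\<^sub>n Kn i j n * z ^ (n + 1) = \<alpha>\<^sub>j * \<gamma>\<^sub>i\<^sub>j(z)\<close> (\<open>gamma_eq\<close>, \<open>deriv_gamma\<close>).

  The generating function is computed from path decompositions. The last visit to the empty word
  separates a part with generating function \<open>Gf i z = \<xi>\<^sub>i(z) / (\<alpha>\<^sub>i * z)\<close> from an excursion into the
  branch \<open>j\<close> (\<open>Kf_eq\<close>). In that excursion, every step of the factor \<open>j\<close> is followed by a loop inside a cone;
  step and loop together have weight \<open>\<xi>\<^sub>j(z)\<close>, so that the excursion is governed by \<open>P\<^sub>j\<close> with parameter
  \<open>\<xi>\<^sub>j(z)\<close> (\<open>lam_balance\<close>), and its total mass is \<open>1 / ((1 - \<xi>\<^sub>j(z)) * G\<^sub>j(\<xi>\<^sub>j(z))) - 1\<close>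
  (\<open>green_identity\<close>). These identities hold in a neighbourhood of \<open>1\<close>, because \<open>\<xi>\<^sub>j < 1\<close> at \<open>1\<close>
  (\<open>xif_less_1\<close>) and the Green function of the walk converges beyond \<open>1\<close> (\<open>eventually_regular\<close>).

  The joint law of the \<open>k\<close>-th exit time and type obeys a one-step recursion (\<open>Phi_step\<close>). Its total mass
  is \<open>1\<close>, by the stochasticity of the renewal kernel (\<open>stochastic\<close>, \<open>Phi_total_mass\<close>); thus the exit times are almost
  surely finite. For the law of large numbers a solution \<open>h\<close> of the Poisson equation
  (\<open>poisson_equation\<close>) turns \<open>e k - k * \<Lambda> + h (\<tau> k)\<close> into a martingale, where \<open>\<tau> k\<close> is the type at time \<open>e k\<close>. Its second moment grows
  linearly (\<open>Phi_second_moment\<close>), so Borel-Cantelli along the squares and monotonicity of the exit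
  times give the almost sure limit (\<open>exit_time_limit\<close>).
\<close>

section \<open>Sums over arbitrary index types\<close>

text \<open>Sums of path weights are taken in the extended nonnegative reals, where they may be exchanged and
  regrouped freely; finiteness is only discussed when the total is converted to a real number.\<close>

definition csum :: "('b \<Rightarrow> ennreal) \<Rightarrow> ennreal" (binder \<open>\<Sum>\<^sup>+\<close> 10) where
  "csum f = (\<integral>\<^sup>+ x. f x \<partial>count_space UNIV)"

lemma csum_swap: "(\<Sum>\<^sup>+x. \<Sum>\<^sup>+y. f x y) = (\<Sum>\<^sup>+y. \<Sum>\<^sup>+x. f x y)"
  using nn_integral_fst_count_space[of "\<lambda>(x, y). f x y"] nn_integral_snd_count_space[of "\<lambda>(x, y). f x y"]
  by (simp add: csum_def)

lemma csum_pair: "(\<Sum>\<^sup>+x. \<Sum>\<^sup>+y. f x y) = (\<Sum>\<^sup>+p. f (fst p) (snd p))"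
  using nn_integral_fst_count_space[of "\<lambda>(x, y). f x y"] by (simp add: csum_def case_prod_unfold)

lemma csum_cong: "(\<And>x. f x = g x) \<Longrightarrow> csum f = csum g"
  by (rule arg_cong[where f = csum]) (rule ext)

lemma csum_zero: "(\<And>x. f x = 0) \<Longrightarrow> csum f = 0"
  by (simp add: csum_def)

lemma csum_cmult: "(\<Sum>\<^sup>+x. c * f x) = c * csum f"
  by (simp add: csum_def nn_integral_cmult)

lemma csum_multc: "(\<Sum>\<^sup>+x. f x * c) = csum f * c"
  by (simp add: csum_def nn_integral_multc)

lemma csum_add: "(\<Sum>\<^sup>+x. f x + g x) = csum f + csum g"
  by (simp add: csum_def nn_integral_add)

lemma csum_sum: "(\<Sum>\<^sup>+x. \<Sum>i\<in>I. f i x) = (\<Sum>i\<in>I. csum (f i))"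
  by (simp add: csum_def nn_integral_sum)

lemma csum_mono: "(\<And>x. f x \<le> g x) \<Longrightarrow> csum f \<le> csum g"
  by (simp add: csum_def nn_integral_mono)

lemma csum_0 [simp]: "(\<Sum>\<^sup>+x. 0) = 0"
  by (simp add: csum_def)

lemma csum_delta: "(\<Sum>\<^sup>+x. if x = a then f x else 0) = f a"
proof -
  have "(\<Sum>\<^sup>+x. if x = a then f x else 0) = (\<integral>\<^sup>+ x. (if x = a then f x else 0) \<partial>count_space {a})"
    unfolding csum_def by (rule nn_integral_count_space_eq) auto
  then show ?thesis by (simp add: nn_integral_count_space_finite)
qed

lemma csum_delta': "(\<Sum>\<^sup>+x. if a = x then f x else 0) = f a"
  using csum_delta[of a f] by (simp add: eq_commute)

lemma csum_single:
  assumes "\<And>x. x \<noteq> a \<Longrightarrow> f x = 0"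
  shows "csum f = f a"
proof -
  have "f = (\<lambda>x. if x = a then f x else 0)" using assms by auto
  then show ?thesis using csum_delta[of a f] by simp
qed

lemma csum_ge: "f a \<le> csum f"
proof -
  have "(\<Sum>\<^sup>+x. if x = a then f x else 0) \<le> csum f" by (rule csum_mono) auto
  then show ?thesis by (simp add: csum_delta)
qed

lemma csum_reindex:
  assumes "inj_on g A" "\<And>x. x \<notin> g ` A \<Longrightarrow> f x = 0"
  shows "csum f = (\<Sum>\<^sup>+x. if x \<in> A then f (g x) else 0)"
proof -
  have "csum f = (\<integral>\<^sup>+ x. f x \<partial>count_space (g ` A))"
    unfolding csum_def by (rule nn_integral_count_space_eq) (use assms in auto)
  also have "\<dots> = (\<integral>\<^sup>+ x. f (g x) \<partial>count_space A)"
    by (rule nn_integral_bij_count_space[symmetric]) (use assms in \<open>auto simp: bij_betw_def\<close>)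
  also have "\<dots> = (\<Sum>\<^sup>+x. if x \<in> A then f (g x) else 0)"
    unfolding csum_def by (subst nn_integral_count_space_indicator) (auto intro!: nn_integral_cong split: split_indicator)
  finally show ?thesis .
qed

lemma csum_nat: "csum f = (\<Sum>n. f n)"
  by (simp add: csum_def nn_integral_count_space_nat)

lemma csum_split: "csum f = (\<Sum>\<^sup>+x. if Q x then f x else 0) + (\<Sum>\<^sup>+x. if Q x then 0 else f x)"
  by (subst csum_add[symmetric]) (auto intro!: csum_cong)

lemma csum_point: "csum f = f a + (\<Sum>\<^sup>+x. if x = a then 0 else f x)"
  using csum_split[of f "\<lambda>x. x = a"] by (simp add: csum_delta)

lemma csum_nat_Suc: "csum f = f 0 + (\<Sum>\<^sup>+n. f (Suc n))"
proof -
  have "(\<Sum>\<^sup>+n. if n = 0 then 0 else f n) = (\<Sum>\<^sup>+n. if n \<in> UNIV then f (Suc n) else 0)"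
    by (subst csum_reindex[where g = Suc and A = UNIV]) (auto simp: image_iff gr0_conv_Suc)
  then show ?thesis by (subst csum_point[of _ 0]) simp
qed

text \<open>The substitution \<open>k = n - m\<close>; all convolutions in time are resolved by it.\<close>

lemma csum_conv:
  fixes F :: "nat \<Rightarrow> nat \<Rightarrow> ennreal"
  shows "(\<Sum>\<^sup>+n. \<Sum>m\<le>n. F m (n - m)) = (\<Sum>\<^sup>+m. \<Sum>\<^sup>+k. F m k)"
proof -
  have "(\<Sum>\<^sup>+n. \<Sum>m\<le>n. F m (n - m)) = (\<Sum>\<^sup>+n. \<Sum>\<^sup>+m. if m \<le> n then F m (n - m) else 0)"
  proof (rule csum_cong)
    fix n
    show "(\<Sum>m\<le>n. F m (n - m)) = (\<Sum>\<^sup>+m. if m \<le> n then F m (n - m) else 0)"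
      unfolding csum_def by (subst nn_integral_count_space'[where A = "{..n}"]) auto
  qed
  also have "\<dots> = (\<Sum>\<^sup>+m. \<Sum>\<^sup>+n. if m \<le> n then F m (n - m) else 0)" by (rule csum_swap)
  also have "\<dots> = (\<Sum>\<^sup>+m. \<Sum>\<^sup>+k. F m k)"
  proof (rule csum_cong)
    fix m :: nat
    have "n \<in> range (\<lambda>k. m + k)" if "m \<le> n" for n using that by (auto simp: le_iff_add)
    then show "(\<Sum>\<^sup>+n. if m \<le> n then F m (n - m) else 0) = (\<Sum>\<^sup>+k. F m k)"
      by (subst csum_reindex[where g = "\<lambda>k. m + k" and A = UNIV]) (auto simp: inj_on_def)
  qed
  finally show ?thesis .
qed

lemma sum_le_csum: "finite A \<Longrightarrow> sum f A \<le> csum f"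
proof -
  assume "finite A"
  have "sum f A = (\<Sum>i\<in>A. \<Sum>\<^sup>+x. if x = i then f x else 0)" by (simp add: csum_delta)
  also have "\<dots> = (\<Sum>\<^sup>+x. \<Sum>i\<in>A. if x = i then f x else 0)" by (simp add: csum_sum)
  also have "\<dots> \<le> csum f" using \<open>finite A\<close> by (intro csum_mono) simp
  finally show ?thesis .
qed

lemma csum_nat_SUP: "csum (f :: nat \<Rightarrow> ennreal) = (SUP N. \<Sum>n<N. f n)"
  by (simp add: csum_nat suminf_eq_SUP)

section \<open>Tabooed path weights\<close>

text \<open>Weight of the paths of length \<open>n\<close> from \<open>x\<close> to \<open>y\<close> that spend the times \<open>1, \<dots>, n\<close> in \<open>A\<close>. The
  starting point is exempt: excursions from a point are then paths that start outside the set in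
  which they live.\<close>

primrec taboo :: "('s \<Rightarrow> 's \<Rightarrow> ennreal) \<Rightarrow> 's set \<Rightarrow> nat \<Rightarrow> 's \<Rightarrow> 's \<Rightarrow> ennreal" where
  "taboo q A 0 x y = (if x = y then 1 else 0)"
| "taboo q A (Suc n) x y = (if y \<in> A then (\<Sum>\<^sup>+w. taboo q A n x w * q w y) else 0)"

lemma taboo_outside: "y \<notin> A \<Longrightarrow> y \<noteq> x \<Longrightarrow> taboo q A n x y = 0"
  by (cases n) auto

lemma taboo_Suc_outside: "y \<notin> A \<Longrightarrow> 0 < n \<Longrightarrow> taboo q A n x y = 0"
  by (cases n) auto

text \<open>The definition splits off the last step. Splitting off the first one instead gives the same weight,
  by Fubini; this is the form in which the recursion of \<^const>\<open>nstep\<close> is stated.\<close>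

lemma taboo_Suc_left:
  "taboo q A (Suc n) x y = (\<Sum>\<^sup>+w. if w \<in> A then q x w * taboo q A n w y else 0)"
proof (induction n arbitrary: y)
  case 0
  have 1: "(\<Sum>\<^sup>+w. if w \<in> A then q x w * (if w = y then 1 else 0) else 0) = (if y \<in> A then q x y else 0)"
    by (subst csum_single[of y]) auto
  have 2: "(\<Sum>\<^sup>+w. (if x = w then 1 else 0) * q w y) = q x y"
    by (subst csum_single[of x]) auto
  show ?case by (simp add: 1 2 cong: if_cong)
next
  case (Suc n)
  have "taboo q A (Suc (Suc n)) x y =
      (if y \<in> A then \<Sum>\<^sup>+w. taboo q A (Suc n) x w * q w y else 0)" by simp
  also have "\<dots> = (if y \<in> A then \<Sum>\<^sup>+w. \<Sum>\<^sup>+u. (if u \<in> A then q x u * taboo q A n u w else 0) * q w y else 0)"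
    unfolding Suc.IH by (simp add: csum_multc)
  also have "\<dots> = (if y \<in> A then \<Sum>\<^sup>+u. \<Sum>\<^sup>+w. (if u \<in> A then q x u * taboo q A n u w else 0) * q w y else 0)"
    by (subst csum_swap) simp
  also have "\<dots> = (\<Sum>\<^sup>+u. if u \<in> A then q x u * taboo q A (Suc n) u y else 0)"
  proof (cases "y \<in> A")
    case True
    then show ?thesis by (simp, intro csum_cong) (simp add: csum_cmult[symmetric] mult.assoc)
  next
    case False
    then show ?thesis by simp (rule csum_zero, simp)
  qed
  finally show ?case .
qed

lemma taboo_mono: "A \<subseteq> B \<Longrightarrow> taboo q A n x y \<le> taboo q B n x y"
  by (induction n arbitrary: y) (auto intro!: csum_mono mult_right_mono)

lemma taboo_closed:
  assumes "x0 \<in> B" "B \<subseteq> A" "\<And>w y. w \<in> B \<Longrightarrow> y \<in> A \<Longrightarrow> y \<notin> B \<Longrightarrow> q w y = 0"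
  shows "taboo q A n x0 y = taboo q B n x0 y"
proof (induction n arbitrary: y)
  case (Suc n)
  have "(\<Sum>\<^sup>+w. taboo q B n x0 w * q w y) = 0" if "y \<in> A" "y \<notin> B"
  proof -
    have "taboo q B n x0 w * q w y = 0" for w
      using assms(3)[OF _ that, of w] taboo_outside[of w B x0 q n] assms(1) by (cases "w \<in> B") auto
    then show ?thesis by (rule csum_zero)
  qed
  then show ?case using assms(2) by (auto simp: Suc.IH)
qed simp

lemma taboo_mass_le_1:
  assumes "\<And>x. csum (q x) \<le> 1"
  shows "csum (taboo q A n x) \<le> 1"
proof (induction n)
  case (Suc n)
  have "csum (taboo q A (Suc n) x) \<le> (\<Sum>\<^sup>+y. \<Sum>\<^sup>+w. taboo q A n x w * q w y)" by (rule csum_mono) auto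
  also have "\<dots> = (\<Sum>\<^sup>+w. taboo q A n x w * csum (q w))" by (subst csum_swap) (simp add: csum_cmult)
  also have "\<dots> \<le> (\<Sum>\<^sup>+w. taboo q A n x w * 1)" by (intro csum_mono mult_left_mono assms) auto
  also have "\<dots> \<le> 1" using Suc by simp
  finally show ?case .
qed (simp add: csum_delta')

text \<open>A path that ends in \<open>C\<close> but starts outside enters \<open>C\<close> for a last time. Before that step it is an
  arbitrary path in \<open>A\<close>, after it a path in \<open>C\<close>.\<close>

lemma last_entrance:
  assumes C: "C \<subseteq> A" "x0 \<notin> C" and y: "y \<in> C"
  shows "taboo q A n x0 y =
    (\<Sum>m<n. \<Sum>\<^sup>+x. if x \<in> C then (\<Sum>\<^sup>+w. if w \<in> C then 0 else taboo q A m x0 w * q w x) * taboo q C (n - 1 - m) x y else 0)"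
  using y
proof (induction n arbitrary: y)
  case 0
  then show ?case using C by auto
next
  case (Suc n)
  define e where "e m x = (\<Sum>\<^sup>+w. if w \<in> C then 0 else taboo q A m x0 w * q w x)" for m x
  have "taboo q A (Suc n) x0 y = (\<Sum>\<^sup>+w. if w \<in> C then taboo q A n x0 w * q w y else 0) + e n y"
    using Suc.prems C by (subst taboo.simps, subst csum_split[of _ "\<lambda>w. w \<in> C"]) (auto simp: e_def)
  also have "(\<Sum>\<^sup>+w. if w \<in> C then taboo q A n x0 w * q w y else 0)
     = (\<Sum>\<^sup>+w. if w \<in> C then (\<Sum>m<n. \<Sum>\<^sup>+x. if x \<in> C then e m x * taboo q C (n - 1 - m) x w else 0) * q w y else 0)"
    by (rule csum_cong) (simp add: Suc.IH e_def cong: if_cong)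
  also have "\<dots> = (\<Sum>\<^sup>+w. \<Sum>m<n. \<Sum>\<^sup>+x. if x \<in> C then e m x * (taboo q C (n - 1 - m) x w * q w y) else 0)"
  proof (rule csum_cong)
    fix w
    have "taboo q C k x w = 0" if "w \<notin> C" "x \<in> C" for k x using that by (intro taboo_outside) auto
    then show "(if w \<in> C then (\<Sum>m<n. \<Sum>\<^sup>+x. if x \<in> C then e m x * taboo q C (n - 1 - m) x w else 0) * q w y else 0)
       = (\<Sum>m<n. \<Sum>\<^sup>+x. if x \<in> C then e m x * (taboo q C (n - 1 - m) x w * q w y) else 0)"
      by (cases "w \<in> C") (auto simp: sum_distrib_right csum_multc[symmetric] mult.assoc
          intro!: sum.cong csum_cong sum.neutral[symmetric] csum_zero)
  qed
  also have "\<dots> = (\<Sum>m<n. \<Sum>\<^sup>+x. \<Sum>\<^sup>+w. if x \<in> C then e m x * (taboo q C (n - 1 - m) x w * q w y) else 0)"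
    by (subst csum_sum, subst csum_swap) simp
  also have "\<dots> = (\<Sum>m<n. \<Sum>\<^sup>+x. if x \<in> C then e m x * taboo q C (Suc n - 1 - m) x y else 0)"
  proof (intro sum.cong refl csum_cong)
    fix m x assume "m \<in> {..<n}"
    then have "Suc n - 1 - m = Suc (n - 1 - m)" by auto
    then show "(\<Sum>\<^sup>+w. if x \<in> C then e m x * (taboo q C (n - 1 - m) x w * q w y) else 0)
       = (if x \<in> C then e m x * taboo q C (Suc n - 1 - m) x y else 0)"
      using Suc.prems by (simp add: csum_cmult)
  qed
  also have "e n y = (\<Sum>\<^sup>+x. if x \<in> C then e n x * taboo q C 0 x y else 0)"
    using Suc.prems by (subst csum_single[of y]) auto
  finally show ?case by (simp only: sum.lessThan_Suc e_def diff_Suc_1 diff_self_eq_0)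
qed

text \<open>In the tree-like free product a cone can only be entered through its root \<open>c\<close>, and then the sum over
  entrance points collapses.\<close>

lemma last_entrance_point:
  assumes C: "C \<subseteq> A" "x0 \<notin> C" and y: "y \<in> C" and c: "c \<in> C"
    and entry: "\<And>w x. w \<notin> C \<Longrightarrow> x \<in> C \<Longrightarrow> x \<noteq> c \<Longrightarrow> q w x = 0"
  shows "taboo q A n x0 y =
    (\<Sum>m<n. (\<Sum>\<^sup>+w. if w \<in> C then 0 else taboo q A m x0 w * q w c) * taboo q C (n - 1 - m) c y)"
proof -
  have "(\<Sum>\<^sup>+w. if w \<in> C then 0 else taboo q A m x0 w * q w x) = 0" if "x \<in> C" "x \<noteq> c" for x m
  proof -
    have "(if w \<in> C then 0 else taboo q A m x0 w * q w x) = 0" for w using entry[OF _ that] by auto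
    then show ?thesis by (subst csum_single[of c]) auto
  qed
  then show ?thesis using c
    by (subst last_entrance[OF C y]) (auto intro!: sum.cong simp: csum_single[of c])
qed

text \<open>Dually, if \<open>C\<close> can only be entered from \<open>x0\<close>, the last entrance into \<open>C\<close> follows the last visit
  to \<open>x0\<close>.\<close>

lemma last_exit_point:
  assumes C: "C \<subseteq> A" "x0 \<notin> C" and y: "y \<in> C"
    and exit: "\<And>w x. w \<in> A \<Longrightarrow> w \<notin> C \<Longrightarrow> x \<in> C \<Longrightarrow> w \<noteq> x0 \<Longrightarrow> q w x = 0"
  shows "taboo q A n x0 y = (\<Sum>m<n. taboo q A m x0 x0 * taboo q C (n - m) x0 y)"
proof -
  have e: "(\<Sum>\<^sup>+w. if w \<in> C then 0 else taboo q A m x0 w * q w x) = taboo q A m x0 x0 * q x0 x" if "x \<in> C" for x m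
  proof -
    have "(if w \<in> C then 0 else taboo q A m x0 w * q w x) = 0" if "w \<noteq> x0" for w
      using exit[of w x] taboo_outside[of w A x0 q m] \<open>x \<in> C\<close> that by (cases "w \<in> A") auto
    then show ?thesis using C by (subst csum_single[of x0]) auto
  qed
  have "taboo q A n x0 y = (\<Sum>m<n. \<Sum>\<^sup>+x. if x \<in> C then taboo q A m x0 x0 * q x0 x * taboo q C (n - 1 - m) x y else 0)"
    by (subst last_entrance[OF C y]) (auto intro!: sum.cong csum_cong simp: e)
  also have "\<dots> = (\<Sum>m<n. taboo q A m x0 x0 * taboo q C (Suc (n - 1 - m)) x0 y)"
    by (subst taboo_Suc_left) (auto intro!: sum.cong csum_cong simp: csum_cmult[symmetric] mult.assoc)
  also have "\<dots> = (\<Sum>m<n. taboo q A m x0 x0 * taboo q C (n - m) x0 y)"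
    by (intro sum.cong refl) (auto simp: Suc_diff_Suc)
  finally show ?thesis .
qed


lemma csum_eq_infsum_summable:
  assumes "\<And>x. x \<in> A \<Longrightarrow> f x \<ge> 0" "f summable_on A"
  shows "(\<Sum>\<^sup>+x. if x \<in> A then ennreal (f x) else 0) = ennreal (infsum f A)"
proof -
  have "Infinite_Set_Sum.abs_summable_on f A"
    using assms(2) summable_on_iff_abs_summable_on_real abs_summable_equivalent by blast
  then have "(\<integral>\<^sup>+x. ennreal (f x) \<partial>count_space A) = ennreal (infsetsum f A)"
    using assms by (intro nn_integral_conv_infsetsum) auto
  moreover have "infsetsum f A = infsum f A"
    using \<open>Infinite_Set_Sum.abs_summable_on f A\<close> by (simp add: infsetsum_infsum)
  moreover have "(\<integral>\<^sup>+x. ennreal (f x) \<partial>count_space A) = (\<Sum>\<^sup>+x. if x \<in> A then ennreal (f x) else 0)"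
    unfolding csum_def by (subst nn_integral_count_space_indicator) (auto intro!: nn_integral_cong split: split_indicator)
  ultimately show ?thesis by simp
qed

lemma csum_eq_infsum:
  assumes "\<And>x. x \<in> A \<Longrightarrow> f x \<ge> 0" "(\<Sum>\<^sup>+x. if x \<in> A then ennreal (f x) else 0) < \<top>"
  shows "f summable_on A" "(\<Sum>\<^sup>+x. if x \<in> A then ennreal (f x) else 0) = ennreal (infsum f A)"
proof -
  show s: "f summable_on A"
  proof (rule nonneg_bounded_partial_sums_imp_summable_on[where C = "enn2real (\<Sum>\<^sup>+x. if x \<in> A then ennreal (f x) else 0)"])
    show "\<forall>\<^sub>F F in finite_subsets_at_top A. sum f F \<le> enn2real (\<Sum>\<^sup>+x. if x \<in> A then ennreal (f x) else 0)"
    proof (rule eventually_finite_subsets_at_top_weakI)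
      fix F assume F: "finite F" "F \<subseteq> A"
      have "ennreal (sum f F) = (\<Sum>x\<in>F. if x \<in> A then ennreal (f x) else 0)"
        using F assms(1) by (subst sum_ennreal[symmetric]) (auto intro!: sum.cong)
      also have "\<dots> \<le> (\<Sum>\<^sup>+x. if x \<in> A then ennreal (f x) else 0)" by (rule sum_le_csum) fact
      finally show "sum f F \<le> enn2real (\<Sum>\<^sup>+x. if x \<in> A then ennreal (f x) else 0)"
        using assms(2) F assms(1) enn2real_mono[of "ennreal (sum f F)"] by (simp add: sum_nonneg subset_iff)
    qed
  qed (use assms in auto)
  show "(\<Sum>\<^sup>+x. if x \<in> A then ennreal (f x) else 0) = ennreal (infsum f A)"
    by (rule csum_eq_infsum_summable) (use assms s in auto)
qed

lemma nstep_taboo: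
  assumes nn: "\<And>x y. x \<in> S \<Longrightarrow> y \<in> S \<Longrightarrow> p x y \<ge> 0"
    and q: "\<And>x y. x \<in> S \<Longrightarrow> y \<in> S \<Longrightarrow> q x y = ennreal (p x y)"
    and sub: "\<And>x. csum (q x) \<le> 1"
    and x: "x \<in> S"
  shows "nstep S p n x y \<ge> 0" "ennreal (nstep S p n x y) = taboo q S n x y"
  using x
proof (induction n arbitrary: x)
  case (Suc n)
  {
    case 1
    then show ?case using Suc.IH nn by (simp add: infsum_nonneg)
  next
    case 2
    have eq: "taboo q S (Suc n) x y = (\<Sum>\<^sup>+w. if w \<in> S then ennreal (p x w * nstep S p n w y) else 0)"
      using 2 nn q by (subst taboo_Suc_left, intro csum_cong) (simp add: ennreal_mult Suc.IH)
    have "taboo q S (Suc n) x y \<le> 1"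
      using csum_ge[of "taboo q S (Suc n) x" y] taboo_mass_le_1[of q S "Suc n" x] sub order_trans by blast
    then have "(\<Sum>\<^sup>+w. if w \<in> S then ennreal (p x w * nstep S p n w y) else 0) < \<top>"
      unfolding eq[symmetric] using le_less_trans ennreal_one_less_top by blast
    with csum_eq_infsum(2)[of S "\<lambda>w. p x w * nstep S p n w y"] show ?case
      unfolding eq using Suc.IH 2 nn by simp
  }
qed auto


section \<open>Geometry of the free product\<close>

context free_product
begin

text \<open>The sets \<open>V\<^sub>i\<^sup>\<times>\<close>, extended by the empty set for \<open>i = 0\<close>. The index \<open>0\<close> serves as the type of the
  empty word: a walk started there has no forbidden letters. This makes the first exit time an
  instance of the general increment.\<close>

definition Vx :: "nat \<Rightarrow> 'a set" where
  "Vx i = (if i \<in> indices D then factor_pos D i else {})"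

definition wt :: "nat \<Rightarrow> ennreal" where
  "wt i = (if i \<in> indices D then ennreal (weight D i) else 0)"

definition P :: "'a list \<Rightarrow> 'a list \<Rightarrow> ennreal" where
  "P x y = ennreal (trans_prob D x y)"

definition pf :: "nat \<Rightarrow> 'a \<Rightarrow> 'a \<Rightarrow> ennreal" where
  "pf i v w = (if v \<in> factor D i \<and> w \<in> factor D i then ennreal (step D i v w) else 0)"

text \<open>For each \<open>i\<close> a word is uniquely \<open>stem i x @ emb D i (tip i x)\<close>, with a stem that does not end in
  \<open>V\<^sub>i\<close>; the lift of the \<open>i\<close>-th matrix moves the tip.\<close>

definition stem :: "nat \<Rightarrow> 'a list \<Rightarrow> 'a list" where
  "stem i x = (if x \<noteq> [] \<and> last x \<in> factor D i then butlast x else x)"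

definition tip :: "nat \<Rightarrow> 'a list \<Rightarrow> 'a" where
  "tip i x = (if x \<noteq> [] \<and> last x \<in> factor D i then last x else root D i)"

text \<open>A walk from the empty word that avoids \<open>V\<^sub>i\<^sup>\<times>\<close> stays in \<open>Avoid i\<close>, because the other words are
  reached only through single letters of \<open>V\<^sub>i\<^sup>\<times>\<close>.\<close>

definition Avoid :: "nat \<Rightarrow> 'a list set" where
  "Avoid i = {u \<in> words D. u = [] \<or> hd u \<notin> Vx i}"

definition Branch :: "nat \<Rightarrow> 'a list set" where
  "Branch i = {u \<in> words D. u \<noteq> [] \<and> hd u \<in> Vx i}"

definition Cone :: "'a list \<Rightarrow> 'a list set" where
  "Cone x = {y \<in> words D. \<exists>u. y = x @ u}"

text \<open>The index \<open>0\<close> of the empty word is not in \<^term>\<open>indices D\<close>.\<close>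

definition ltype :: "'a list \<Rightarrow> nat" where
  "ltype x = (if x = [] then 0 else (THE i. i \<in> indices D \<and> last x \<in> factor_pos D i))"

lemma zero_notin_indices [simp]: "0 \<notin> indices D"
  by (simp add: indices_def)

lemma finite_indices [simp]: "finite (indices D)"
  by (simp add: indices_def)

lemma Vx_0 [simp]: "Vx 0 = {}"
  by (simp add: Vx_def)

lemma wt_0 [simp]: "wt 0 = 0"
  by (simp add: wt_def)

lemma Vx_eq: "i \<in> indices D \<Longrightarrow> Vx i = factor D i - {root D i}"
  by (simp add: Vx_def factor_pos_def)

lemma Vx_disjoint: "a \<in> Vx i \<Longrightarrow> j \<in> indices D \<Longrightarrow> a \<in> factor D j \<Longrightarrow> i = j"
  using disjoint_factors[of i j] by (auto simp: Vx_def factor_pos_def split: if_splits)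

lemma in_VxD: "a \<in> Vx i \<Longrightarrow> i \<in> indices D \<and> a \<in> factor D i \<and> a \<noteq> root D i"
  by (auto simp: Vx_def factor_pos_def split: if_splits)

lemma Vx_unique: "a \<in> Vx i \<Longrightarrow> a \<in> Vx j \<Longrightarrow> i = j"
  using Vx_disjoint in_VxD by blast

lemma words_iff: "x \<in> words D \<longleftrightarrow> (\<forall>a\<in>set x. \<exists>i. a \<in> Vx i) \<and>
    successively (\<lambda>a b. \<not> (\<exists>i. a \<in> Vx i \<and> b \<in> Vx i)) x"
proof -
  have "(\<exists>i\<in>indices D. a \<in> factor_pos D i \<and> b \<in> factor_pos D i) \<longleftrightarrow> (\<exists>i. a \<in> Vx i \<and> b \<in> Vx i)" for a b
    by (auto simp: Vx_def)
  then show ?thesis by (auto simp: words_def Vx_def)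
qed

lemma Nil_in_words [simp]: "[] \<in> words D"
  by (simp add: words_def)

lemma words_append_iff: "x @ u \<in> words D \<longleftrightarrow> x \<in> words D \<and> u \<in> words D \<and>
    (x = [] \<or> u = [] \<or> \<not> (\<exists>i. last x \<in> Vx i \<and> hd u \<in> Vx i))"
  unfolding words_iff by (auto simp: successively_append_iff)

lemma singleton_words: "[a] \<in> words D \<longleftrightarrow> (\<exists>i. a \<in> Vx i)"
  by (simp add: words_iff)

lemma ltype_eq: "x \<noteq> [] \<Longrightarrow> last x \<in> Vx i \<Longrightarrow> ltype x = i"
proof -
  assume x: "x \<noteq> []" "last x \<in> Vx i"
  have "(THE i. i \<in> indices D \<and> last x \<in> factor_pos D i) = i"
  proof (rule the_equality)
    show "i \<in> indices D \<and> last x \<in> factor_pos D i"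
      using in_VxD[OF x(2)] by (simp add: factor_pos_def)
  next
    fix k assume "k \<in> indices D \<and> last x \<in> factor_pos D k"
    then show "k = i" using Vx_unique[OF _ x(2), of k] by (simp add: Vx_def)
  qed
  then show ?thesis using x by (simp add: ltype_def)
qed

lemma ltype_Nil [simp]: "ltype [] = 0"
  by (simp add: ltype_def)

lemma ltype_snoc: "y \<in> Vx i \<Longrightarrow> ltype (x @ [y]) = i"
  by (intro ltype_eq) auto

lemma last_in_Vx: "x \<in> words D \<Longrightarrow> x \<noteq> [] \<Longrightarrow> last x \<in> Vx (ltype x)"
  using ltype_eq by (metis last_in_set words_iff)

lemma ltype_in: "x \<in> words D \<Longrightarrow> x \<noteq> [] \<Longrightarrow> ltype x \<in> indices D"
  using last_in_Vx in_VxD by blast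

lemma append_word_iff: "x \<in> words D \<Longrightarrow> x @ u \<in> words D \<longleftrightarrow> u \<in> Avoid (ltype x)"
  using last_in_Vx[of x] Vx_unique unfolding words_append_iff Avoid_def
  by (cases "x = []") auto

lemma Cone_append: "x \<in> words D \<Longrightarrow> x @ u \<in> Cone x \<longleftrightarrow> u \<in> Avoid (ltype x)"
  by (simp add: Cone_def append_word_iff)

lemma Cone_Nil: "Cone [] = words D"
  by (simp add: Cone_def)

lemma Avoid_0: "Avoid 0 = words D"
  by (auto simp: Avoid_def)

lemma Nil_in_Avoid [simp]: "[] \<in> Avoid i"
  by (simp add: Avoid_def)

lemma Nil_notin_Branch [simp]: "[] \<notin> Branch i"
  by (simp add: Branch_def)

lemma Avoid_subset: "Avoid i \<subseteq> words D" and Branch_subset: "Branch i \<subseteq> words D" and Cone_subset: "Cone x \<subseteq> words D"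
  by (auto simp: Avoid_def Branch_def Cone_def)

lemma Branch_subset_Avoid: "i \<noteq> j \<Longrightarrow> Branch j \<subseteq> Avoid i"
  using Vx_unique by (auto simp: Avoid_def Branch_def)

lemma in_Avoid_cases: "w \<in> Avoid i \<Longrightarrow> w = [] \<or> (\<exists>l\<in>indices D - {i}. w \<in> Branch l)"
proof -
  assume w: "w \<in> Avoid i"
  show ?thesis
  proof (cases "w = []")
    case False
    then have "hd w \<in> set w" by simp
    then obtain l where l: "hd w \<in> Vx l" using w by (auto simp: Avoid_def words_iff)
    then have "l \<noteq> i" "w \<in> Branch l" using w False by (auto simp: Avoid_def Branch_def)
    then show ?thesis using in_VxD[OF l] by blast
  qed simp
qed

lemma Branch_disjoint: "w \<in> Branch l \<Longrightarrow> w \<in> Branch k \<Longrightarrow> l = k"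
  using Vx_unique by (auto simp: Branch_def)

lemma singleton_Branch: "v \<in> Vx j \<Longrightarrow> [v] \<in> Branch j"
  by (auto simp: Branch_def singleton_words)

lemma stem_tip:
  assumes "x \<in> words D" "i \<in> indices D"
  shows "x = stem i x @ emb D i (tip i x)" "stem i x \<in> words D"
    "stem i x = [] \<or> last (stem i x) \<notin> factor D i" "tip i x \<in> factor D i"
proof -
  have ne: "last x \<noteq> root D i" if "x \<noteq> []" "last x \<in> factor D i"
    using Vx_disjoint[OF last_in_Vx[OF assms(1) that(1)] assms(2) that(2)] last_in_Vx[OF assms(1) that(1)] in_VxD by blast
  show "x = stem i x @ emb D i (tip i x)" using ne by (auto simp: stem_def tip_def emb_def)
  show "stem i x \<in> words D"
  proof (cases "x = []")
    case False
    then have "butlast x @ [last x] \<in> words D" using assms by simp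
    then have "butlast x \<in> words D" unfolding words_append_iff by blast
    then show ?thesis using assms by (simp add: stem_def)
  qed (simp add: stem_def)
  show "tip i x \<in> factor D i" using root_in assms by (auto simp: tip_def)
  show "stem i x = [] \<or> last (stem i x) \<notin> factor D i"
  proof (cases "x \<noteq> [] \<and> last x \<in> factor D i \<and> butlast x \<noteq> []")
    case True
    then have "butlast x @ [last x] \<in> words D" using assms by simp
    then have w: "butlast x \<in> words D" "\<not> (\<exists>i. last (butlast x) \<in> Vx i \<and> last x \<in> Vx i)"
      using True unfolding words_append_iff by auto
    have "last x \<in> Vx i" using True ne assms by (auto simp: Vx_eq)
    then have "last (butlast x) \<notin> Vx i" using w by blast
    moreover have "butlast x \<in> words D" using w by blast
    ultimately show ?thesis using last_in_Vx[of "butlast x"] True Vx_disjoint assms by (metis stem_def)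
  qed (auto simp: stem_def)
qed

lemma emb_inj: "emb D i v = emb D i w \<Longrightarrow> v = w"
  by (auto simp: emb_def split: if_splits)

lemma decomp_unique:
  assumes "z @ emb D i v = z' @ emb D i v'" "z = [] \<or> last z \<notin> factor D i" "z' = [] \<or> last z' \<notin> factor D i"
    "v \<in> factor D i" "v' \<in> factor D i"
  shows "z = z' \<and> v = v'"
  using assms by (auto simp: emb_def split: if_splits)

lemma decomp_word:
  assumes "i \<in> indices D" "z \<in> words D" "z = [] \<or> last z \<notin> factor D i" "v \<in> factor D i"
  shows "z @ emb D i v \<in> words D"
proof (cases "v = root D i")
  case False
  then have v: "v \<in> Vx i" using assms by (simp add: Vx_eq)
  have "\<not> (\<exists>k. last z \<in> Vx k \<and> v \<in> Vx k)" if "z \<noteq> []"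
    using that assms(3) Vx_unique[OF v] in_VxD by blast
  then show ?thesis using assms(2) v False by (auto simp: emb_def words_append_iff singleton_words)
qed (use assms in \<open>simp add: emb_def\<close>)

lemma lift_nonzero:
  assumes "lift D i x y \<noteq> 0"
  obtains z v w where "z \<in> words D" "z = [] \<or> last z \<notin> factor D i" "v \<in> factor D i" "w \<in> factor D i"
    "x = z @ emb D i v" "y = z @ emb D i w" "lift D i x y = step D i v w"
proof -
  obtain z v w where *: "z \<in> words D" "z = [] \<or> last z \<notin> factor D i" "v \<in> factor D i" "w \<in> factor D i"
    "x = z @ emb D i v" "y = z @ emb D i w"
    using assms unfolding lift_def by (fastforce elim: sum.not_neutral_contains_not_neutral)
  then show ?thesis using lift_append_emb[of z D i v w] that by blast
qed

lemma lift_nonneg: "i \<in> indices D \<Longrightarrow> lift D i x y \<ge> 0"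
  by (cases "lift D i x y = 0") (auto elim!: lift_nonzero simp: step_nonneg)

lemma trans_prob_nonneg: "trans_prob D u v \<ge> 0"
  unfolding trans_prob_def by (intro sum_nonneg mult_nonneg_nonneg) (auto simp: lift_nonneg weight_pos less_imp_le)

lemma P_eq: "P x y = (\<Sum>i\<in>indices D. wt i * ennreal (lift D i x y))"
proof -
  have "P x y = (\<Sum>i\<in>indices D. ennreal (weight D i * lift D i x y))"
    unfolding P_def trans_prob_def
    by (rule sum_ennreal[symmetric]) (simp add: lift_nonneg weight_pos less_imp_le)
  also have "\<dots> = (\<Sum>i\<in>indices D. wt i * ennreal (lift D i x y))"
    by (rule sum.cong) (auto simp: wt_def ennreal_mult weight_pos less_imp_le lift_nonneg)
  finally show ?thesis .
qed

lemma P_nonzero: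
  assumes "P x y \<noteq> 0"
  obtains i z v w where "i \<in> indices D" "z \<in> words D" "z = [] \<or> last z \<notin> factor D i" "v \<in> factor D i" "w \<in> factor D i"
    "v \<noteq> w" "x = z @ emb D i v" "y = z @ emb D i w"
proof -
  obtain i where i: "i \<in> indices D" "lift D i x y \<noteq> 0"
    using assms unfolding P_eq by (force elim: sum.not_neutral_contains_not_neutral)
  from i(2) obtain z v w where *: "z \<in> words D" "z = [] \<or> last z \<notin> factor D i" "v \<in> factor D i"
      "w \<in> factor D i" "x = z @ emb D i v" "y = z @ emb D i w" "lift D i x y = step D i v w"
    by (rule lift_nonzero)
  have "v \<noteq> w" using * step_no_loop[OF i(1)] i(2) by auto
  then show ?thesis using that[OF i(1) *(1-4)] * by blast
qed

lemma P_words: "P x y \<noteq> 0 \<Longrightarrow> x \<in> words D \<and> y \<in> words D"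
  by (elim P_nonzero) (auto simp: decomp_word)

text \<open>For a fixed source the lift is the image of a row of the factor matrix under \<open>w \<mapsto> stem @ emb w\<close>;
  outside the image it vanishes. \<open>lift_col\<close> is the same for a fixed target.\<close>

lemma lift_row:
  assumes x: "x \<in> words D" and i: "i \<in> indices D"
  shows "ennreal (lift D i x y) = (\<Sum>\<^sup>+w. if y = stem i x @ emb D i w then pf i (tip i x) w else 0)"
proof (cases "\<exists>w\<in>factor D i. y = stem i x @ emb D i w")
  case True
  then obtain w where w: "w \<in> factor D i" "y = stem i x @ emb D i w" by blast
  have "lift D i x y = step D i (tip i x) w"
    using lift_append_emb[OF stem_tip(2,3,4)[OF x i] w(1)] w(2) stem_tip(1)[OF x i] by simp
  moreover have "(\<Sum>\<^sup>+w. if y = stem i x @ emb D i w then pf i (tip i x) w else 0) = pf i (tip i x) w"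
    using w emb_inj[of i w] by (subst csum_single[of w]) auto
  ultimately show ?thesis using w stem_tip(4)[OF x i] by (simp add: pf_def)
next
  case False
  have "lift D i x y = 0"
  proof (rule ccontr)
    assume "lift D i x y \<noteq> 0"
    then obtain z v w where *: "z = [] \<or> last z \<notin> factor D i" "v \<in> factor D i" "w \<in> factor D i"
      "x = z @ emb D i v" "y = z @ emb D i w" by (rule lift_nonzero)
    then have "z = stem i x" using decomp_unique[of z i v "stem i x" "tip i x"] stem_tip[OF x i] by metis
    then show False using False * by blast
  qed
  moreover have "(\<Sum>\<^sup>+w. if y = stem i x @ emb D i w then pf i (tip i x) w else 0) = 0"
    using False by (intro csum_zero) (auto simp: pf_def)
  ultimately show ?thesis by simp
qed

lemma lift_col:
  assumes y: "y \<in> words D" and i: "i \<in> indices D"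
  shows "ennreal (lift D i x y) = (\<Sum>\<^sup>+v. if x = stem i y @ emb D i v then pf i v (tip i y) else 0)"
proof (cases "\<exists>v\<in>factor D i. x = stem i y @ emb D i v")
  case True
  then obtain v where v: "v \<in> factor D i" "x = stem i y @ emb D i v" by blast
  have "lift D i x y = step D i v (tip i y)"
    using lift_append_emb[OF stem_tip(2,3)[OF y i] v(1) stem_tip(4)[OF y i]] v(2) stem_tip(1)[OF y i] by simp
  moreover have "(\<Sum>\<^sup>+v. if x = stem i y @ emb D i v then pf i v (tip i y) else 0) = pf i v (tip i y)"
    using v emb_inj[of i v] by (subst csum_single[of v]) auto
  ultimately show ?thesis using v stem_tip(4)[OF y i] by (simp add: pf_def)
next
  case False
  have "lift D i x y = 0"
  proof (rule ccontr)
    assume "lift D i x y \<noteq> 0"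
    then obtain z v w where *: "z = [] \<or> last z \<notin> factor D i" "v \<in> factor D i" "w \<in> factor D i"
      "x = z @ emb D i v" "y = z @ emb D i w" by (rule lift_nonzero)
    then have "z = stem i y" using decomp_unique[of z i w "stem i y" "tip i y"] stem_tip[OF y i] by metis
    then show False using False * by blast
  qed
  moreover have "(\<Sum>\<^sup>+v. if x = stem i y @ emb D i v then pf i v (tip i y) else 0) = 0"
    using False by (intro csum_zero) (auto simp: pf_def)
  ultimately show ?thesis by simp
qed

text \<open>The whole geometry enters through this formula and its transpose \<open>sum_over_predecessors\<close>: summation
  over neighbours in the free product is, factor by factor, summation over neighbours of the tip.\<close>

lemma sum_over_successors:
  assumes x: "x \<in> words D"
  shows "(\<Sum>\<^sup>+y. P x y * f y) = (\<Sum>i\<in>indices D. wt i * (\<Sum>\<^sup>+w. pf i (tip i x) w * f (stem i x @ emb D i w)))"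
proof -
  have "(\<Sum>\<^sup>+y. P x y * f y) = (\<Sum>\<^sup>+y. \<Sum>i\<in>indices D. wt i *
      (\<Sum>\<^sup>+w. if y = stem i x @ emb D i w then pf i (tip i x) w * f y else 0))"
    unfolding P_eq sum_distrib_right
    by (intro csum_cong sum.cong refl) (simp add: lift_row[OF x] mult.assoc csum_multc[symmetric] if_distrib[of "\<lambda>a. a * _"] cong: if_cong)
  also have "\<dots> = (\<Sum>i\<in>indices D. wt i * (\<Sum>\<^sup>+y. \<Sum>\<^sup>+w. if y = stem i x @ emb D i w then pf i (tip i x) w * f y else 0))"
    by (simp add: csum_sum csum_cmult)
  also have "\<dots> = (\<Sum>i\<in>indices D. wt i * (\<Sum>\<^sup>+w. pf i (tip i x) w * f (stem i x @ emb D i w)))"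
    by (subst csum_swap) (simp add: csum_delta)
  finally show ?thesis .
qed

lemma sum_over_predecessors:
  assumes y: "y \<in> words D"
  shows "(\<Sum>\<^sup>+x. f x * P x y) = (\<Sum>i\<in>indices D. wt i * (\<Sum>\<^sup>+v. f (stem i y @ emb D i v) * pf i v (tip i y)))"
proof -
  have "(\<Sum>\<^sup>+x. f x * P x y) = (\<Sum>\<^sup>+x. \<Sum>i\<in>indices D. wt i *
      (\<Sum>\<^sup>+v. if x = stem i y @ emb D i v then f x * pf i v (tip i y) else 0))"
    unfolding P_eq sum_distrib_left
    by (intro csum_cong sum.cong refl)
       (simp add: lift_col[OF y] mult.left_commute csum_cmult[symmetric] if_distrib[of "\<lambda>a. _ * a"] cong: if_cong)
  also have "\<dots> = (\<Sum>i\<in>indices D. wt i * (\<Sum>\<^sup>+x. \<Sum>\<^sup>+v. if x = stem i y @ emb D i v then f x * pf i v (tip i y) else 0))"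
    by (simp add: csum_sum csum_cmult)
  also have "\<dots> = (\<Sum>i\<in>indices D. wt i * (\<Sum>\<^sup>+v. f (stem i y @ emb D i v) * pf i v (tip i y)))"
    by (subst csum_swap) (simp add: csum_delta)
  finally show ?thesis .
qed

lemma pf_row_sum: "i \<in> indices D \<Longrightarrow> v \<in> factor D i \<Longrightarrow> csum (pf i v) = 1"
proof -
  assume i: "i \<in> indices D" and v: "v \<in> factor D i"
  have "csum (pf i v) = (\<Sum>\<^sup>+w. if w \<in> factor D i then ennreal (step D i v w) else 0)"
    using v by (intro csum_cong) (simp add: pf_def)
  also have "\<dots> = ennreal (infsum (step D i v) (factor D i))"
    using step_stochastic[OF i v] step_nonneg[OF i v]
    by (intro csum_eq_infsum_summable) (auto simp: summable_on_def)
  also have "\<dots> = 1" using step_stochastic[OF i v] by (simp add: infsumI)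
  finally show ?thesis .
qed

lemma pf_outside: "v \<notin> factor D i \<or> w \<notin> factor D i \<Longrightarrow> pf i v w = 0"
  by (auto simp: pf_def)

lemma pf_loop [simp]: "i \<in> indices D \<Longrightarrow> pf i v v = 0"
  by (simp add: pf_def step_no_loop)

lemma pf_row_le: "i \<in> indices D \<Longrightarrow> csum (pf i v) \<le> 1"
proof -
  assume i: "i \<in> indices D"
  show ?thesis
  proof (cases "v \<in> factor D i")
    case False
    then have "csum (pf i v) = 0" by (intro csum_zero) (simp add: pf_def)
    then show ?thesis by simp
  qed (simp add: i pf_row_sum)
qed

lemma sum_wt: "sum wt (indices D) = 1"
proof -
  have "sum wt (indices D) = (\<Sum>i\<in>indices D. ennreal (weight D i))"
    by (rule sum.cong) (auto simp: wt_def)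
  also have "\<dots> = ennreal (\<Sum>i\<in>indices D. weight D i)"
    by (rule sum_ennreal) (simp add: weight_pos less_imp_le)
  finally show ?thesis by (simp add: weight_sum)
qed

lemma P_row_sum: "x \<in> words D \<Longrightarrow> csum (P x) = 1"
  using sum_over_successors[of x "\<lambda>_. 1"] by (simp add: pf_row_sum stem_tip sum_wt cong: sum.cong)

lemma P_row_le: "csum (P x) \<le> 1"
proof (cases "x \<in> words D")
  case False
  then have "csum (P x) = 0" using P_words by (intro csum_zero) blast
  then show ?thesis by simp
qed (simp add: P_row_sum)

text \<open>The type of the first letter can only change at the empty word.\<close>

lemma hd_type:
  assumes "P w y \<noteq> 0" "w \<noteq> []" "y \<noteq> []"
  shows "hd w \<in> Vx i \<longleftrightarrow> hd y \<in> Vx i"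
proof -
  obtain k z u v where *: "k \<in> indices D" "u \<in> factor D k" "v \<in> factor D k" "w = z @ emb D k u" "y = z @ emb D k v"
    using assms(1) by (rule P_nonzero)
  show ?thesis
  proof (cases "z = []")
    case True
    then have "w = [u]" "u \<in> Vx k" "y = [v]" "v \<in> Vx k"
      using * assms by (auto simp: emb_def Vx_eq split: if_splits)
    then show ?thesis using Vx_unique by auto
  qed (use * in auto)
qed

lemma Avoid_exit: "w \<in> Avoid i \<Longrightarrow> w \<noteq> [] \<Longrightarrow> y \<notin> Avoid i \<Longrightarrow> P w y = 0"
  using hd_type[of w y i] P_words[of w y] by (auto simp: Avoid_def)

lemma Branch_exit: "w \<in> Branch l \<Longrightarrow> y \<notin> Branch l \<Longrightarrow> y \<noteq> [] \<Longrightarrow> P w y = 0"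
  using hd_type[of w y l] P_words[of w y] by (auto simp: Branch_def)

lemma Branch_enter: "w \<notin> Branch l \<Longrightarrow> y \<in> Branch l \<Longrightarrow> w \<noteq> [] \<Longrightarrow> P w y = 0"
  using hd_type[of w y l] P_words[of w y] by (auto simp: Branch_def)

text \<open>One step changes at most one letter, the last one, so a step into the cone must produce its root.\<close>

lemma Cone_enter: "w \<notin> Cone x \<Longrightarrow> y \<in> Cone x \<Longrightarrow> y \<noteq> x \<Longrightarrow> P w y = 0"
proof (rule ccontr)
  assume w: "w \<notin> Cone x" and y: "y \<in> Cone x" "y \<noteq> x" and "P w y \<noteq> 0"
  then obtain i z u v where *: "w = z @ emb D i u" "y = z @ emb D i v" by (elim P_nonzero)
  obtain t where t: "y = x @ t" "t \<noteq> []" using y by (auto simp: Cone_def)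
  have "length y \<le> Suc (length z)" using *(2) by (simp add: emb_def)
  then have "length x \<le> length z" using t by (cases t) auto
  then have "take (length x) z = x" using *(2) t by (metis append_eq_append_conv_if append_take_drop_id)
  then have "\<exists>u. w = x @ u" using *(1) by (metis append.assoc append_take_drop_id)
  then show False using w P_words \<open>P w y \<noteq> 0\<close> by (auto simp: Cone_def)
qed

lemma Nil_not_loop: "P [] [] = 0"
proof (rule ccontr)
  assume "P [] [] \<noteq> 0"
  then show False by (rule P_nonzero) (auto simp: emb_def split: if_splits)
qed

lemma wt_pos: "i \<in> indices D \<Longrightarrow> wt i > 0"
  by (simp add: wt_def weight_pos)

lemma wt_finite: "wt i < \<top>"
  by (simp add: wt_def)

lemma exit_root: "(\<Sum>\<^sup>+y. if y \<in> Avoid i then 0 else P [] y) = wt i"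
proof -
  have 1: "(\<Sum>\<^sup>+w. pf l (root D l) w * (if emb D l w \<in> Avoid i then 0 else 1)) = (if l = i then 1 else 0)"
    if l: "l \<in> indices D" for l
  proof (cases "l = i")
    case True
    have "(\<Sum>\<^sup>+w. pf l (root D l) w * (if emb D l w \<in> Avoid i then 0 else 1)) = csum (pf l (root D l))"
      using l True by (intro csum_cong) (auto simp: emb_def Avoid_def Vx_eq pf_outside singleton_words)
    then show ?thesis using l root_in True by (simp add: pf_row_sum)
  next
    case False
    have "emb D l w \<in> Avoid i" if "w \<in> factor D l" for w
      using singleton_Branch[of w l] Branch_subset_Avoid[of i l] False that l by (auto simp: emb_def Vx_eq)
    then have "(\<Sum>\<^sup>+w. pf l (root D l) w * (if emb D l w \<in> Avoid i then 0 else 1)) = 0"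
      by (intro csum_zero) (auto simp: pf_def)
    then show ?thesis using False by simp
  qed
  have "(\<Sum>\<^sup>+y. if y \<in> Avoid i then 0 else P [] y) = (\<Sum>\<^sup>+y. P [] y * (if y \<in> Avoid i then 0 else 1))"
    by (intro csum_cong) auto
  also have "\<dots> = (\<Sum>l\<in>indices D. wt l * (if l = i then 1 else 0))"
    by (subst sum_over_successors) (simp_all add: stem_def tip_def 1 cong: sum.cong)
  also have "\<dots> = wt i"
    by (subst sum.mono_neutral_cong_right[where S = "indices D \<inter> {i}"]) (auto simp: wt_def)
  finally show ?thesis .
qed

lemma enter_Branch: "(\<Sum>\<^sup>+y. if y \<in> Branch i then P [] y else 0) = wt i"
  unfolding exit_root[symmetric, of i]
  using P_words[of "[]"] by (intro csum_cong) (auto simp: Avoid_def Branch_def)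

text \<open>The cone of \<open>x\<close> looks like the set of words that do not start with the type of the last letter of
  \<open>x\<close>. The predecessors that differ are those that modify this last letter; on both sides they lie
  outside the set under consideration.\<close>

lemma Cone_shift:
  assumes x: "x \<in> words D"
  shows "taboo P (Cone x) n x (x @ u) = taboo P (Avoid (ltype x)) n [] u"
proof (induction n arbitrary: u)
  case (Suc n)
  let ?i = "ltype x"
  let ?f = "taboo P (Cone x) n x" and ?g = "taboo P (Avoid ?i) n []"
  have xc: "x \<in> Cone x" using x by (auto simp: Cone_def)
  show ?case
  proof (cases "u \<in> Avoid ?i")
    case True
    then have xu: "x @ u \<in> words D" "u \<in> words D" using x by (auto simp: append_word_iff Avoid_def)
    have *: "(\<Sum>\<^sup>+v. ?f (stem l (x @ u) @ emb D l v) * pf l v (tip l (x @ u))) =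
        (\<Sum>\<^sup>+v. ?g (stem l u @ emb D l v) * pf l v (tip l u))" if l: "l \<in> indices D" for l
    proof (cases "u = [] \<and> x \<noteq> [] \<and> l = ?i")
      case True
      then have lx: "last x \<in> Vx l" using last_in_Vx x by auto
      then have st: "stem l x = butlast x" "tip l x = last x" using True in_VxD by (auto simp: stem_def tip_def)
      have "?f (butlast x @ emb D l v) * pf l v (last x) = 0" for v
      proof (cases "butlast x @ emb D l v \<in> Cone x")
        case True
        then obtain t where t: "butlast x @ emb D l v = x @ t" by (auto simp: Cone_def)
        have "x = butlast x @ [last x]" using \<open>u = [] \<and> x \<noteq> [] \<and> l = ?i\<close> by simp
        then have "butlast x @ emb D l v = butlast x @ [last x] @ t" using t by (metis append.assoc)
        then have "v = last x" by (simp add: emb_def split: if_splits)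
        then show ?thesis using l by simp
      next
        case False
        then have "butlast x @ emb D l v \<noteq> x" using xc by metis
          then show ?thesis using False by (simp add: taboo_outside)
      qed
      moreover have "?g (emb D l v) * pf l v (root D l) = 0" for v
      proof (cases "v \<in> Vx l")
        case True
        then have "emb D l v \<notin> Avoid ?i" "emb D l v \<noteq> []"
          using \<open>u = [] \<and> x \<noteq> [] \<and> l = ?i\<close> in_VxD by (auto simp: emb_def Avoid_def)
        then show ?thesis by (simp add: taboo_outside)
      next
        case False
        then have "v = root D l \<or> v \<notin> factor D l" using l by (auto simp: Vx_eq)
        then show ?thesis using l by (auto simp: pf_outside)
      qed
      ultimately show ?thesis using True st by (simp add: stem_def[of _ "[]"] tip_def[of _ "[]"] csum_zero)
    next
      case False
      have nl: "last x \<notin> factor D l" if "u = []" "x \<noteq> []"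
        using Vx_disjoint[OF last_in_Vx[OF x that(2)] l] False that by auto
      have "stem l (x @ u) = x @ stem l u" "tip l (x @ u) = tip l u"
        using nl by (cases "u = []"; auto simp: stem_def tip_def butlast_append)+
      then show ?thesis using Suc.IH by simp
    qed
    show ?thesis
      using True xu(1) x by (simp add: Cone_append sum_over_predecessors[OF xu(1)] sum_over_predecessors[OF xu(2)] * cong: sum.cong)
  next
    case False
    then show ?thesis using x by (simp add: Cone_append)
  qed
qed (simp add: eq_commute)

lemma Cone_shift_mass:
  assumes x: "x \<in> words D"
  shows "csum (taboo P (Cone x) n x) = csum (taboo P (Avoid (ltype x)) n [])"
proof -
  have "csum (taboo P (Cone x) n x) = (\<Sum>\<^sup>+u. if u \<in> UNIV then taboo P (Cone x) n x (x @ u) else 0)"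
  proof (rule csum_reindex)
    fix y assume "y \<notin> range ((@) x)"
    then have "y \<notin> Cone x" "y \<noteq> x" by (auto simp: Cone_def image_iff)
    then show "taboo P (Cone x) n x y = 0" by (rule taboo_outside)
  qed (simp add: inj_on_def)
  then show ?thesis by (simp add: Cone_shift[OF x])
qed

text \<open>Entering the cone of \<open>x @ [y]\<close> is a step of the factor \<open>j\<close> to \<open>y\<close> in the copy of \<open>V\<^sub>j\<close> at \<open>x\<close>. Steps
  of the other factors into \<open>x @ [y]\<close> come from within the cone.\<close>

lemma entry_sum:
  assumes x: "x @ [y] \<in> words D" and y: "y \<in> Vx j"
  shows "(\<Sum>\<^sup>+w. if w \<in> Cone (x @ [y]) then 0 else f w * P w (x @ [y])) =
    wt j * (\<Sum>\<^sup>+v. f (x @ emb D j v) * pf j v y)"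
proof -
  let ?F = "\<lambda>w. if w \<in> Cone (x @ [y]) then 0 else f w"
  have j: "j \<in> indices D" using in_VxD y by blast
  have fl: "(y \<in> factor D l) = (l = j)" if "l \<in> indices D" for l
    using Vx_disjoint[OF y that] in_VxD[OF y] by blast
  have "(\<Sum>\<^sup>+w. if w \<in> Cone (x @ [y]) then 0 else f w * P w (x @ [y])) = (\<Sum>\<^sup>+w. ?F w * P w (x @ [y]))"
    by (intro csum_cong) simp
  also have "\<dots> = (\<Sum>l\<in>indices D. wt l * (\<Sum>\<^sup>+v. ?F (stem l (x @ [y]) @ emb D l v) * pf l v (tip l (x @ [y]))))"
    by (rule sum_over_predecessors[OF x])
  also have "\<dots> = (\<Sum>l\<in>indices D. if l = j then wt j * (\<Sum>\<^sup>+v. f (x @ emb D j v) * pf j v y) else 0)"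
  proof (intro sum.cong refl)
    fix l assume l: "l \<in> indices D"
    show "wt l * (\<Sum>\<^sup>+v. ?F (stem l (x @ [y]) @ emb D l v) * pf l v (tip l (x @ [y]))) =
      (if l = j then wt j * (\<Sum>\<^sup>+v. f (x @ emb D j v) * pf j v y) else 0)"
    proof (cases "l = j")
      case True
      have "x @ emb D j v \<notin> Cone (x @ [y])" if "v \<noteq> y" for v
        using that by (auto simp: Cone_def emb_def)
      then have "?F (x @ emb D j v) * pf j v y = f (x @ emb D j v) * pf j v y" for v
        using j by (cases "v = y") auto
      moreover have "stem l (x @ [y]) = x" "tip l (x @ [y]) = y" using True fl[OF l] by (simp_all add: stem_def tip_def)
      ultimately show ?thesis unfolding True by (simp cong: if_cong)
    next
      case False
      have "?F ((x @ [y]) @ emb D l v) * pf l v (root D l) = 0" for v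
      proof (cases "v \<in> factor D l")
        case True
        then have "(x @ [y]) @ emb D l v \<in> Cone (x @ [y])"
          using decomp_word[OF l x _ True] fl[OF l] False by (auto simp: Cone_def)
        then show ?thesis by simp
      qed (simp add: pf_outside)
      then have "(\<Sum>\<^sup>+v. ?F ((x @ [y]) @ emb D l v) * pf l v (root D l)) = 0" by (rule csum_zero)
      moreover have "stem l (x @ [y]) = x @ [y]" "tip l (x @ [y]) = root D l"
        using False fl[OF l] by (simp_all add: stem_def tip_def)
      ultimately show ?thesis using False by (simp only: if_False mult_zero_right)
    qed
  qed
  finally show ?thesis using j by simp
qed

lemma return_sum:
  assumes l: "l \<in> indices D" and f: "\<And>w. w \<noteq> [] \<Longrightarrow> w \<notin> Branch l \<Longrightarrow> f w = 0"
  shows "(\<Sum>\<^sup>+w. f w * P w []) = wt l * (\<Sum>\<^sup>+v. f (emb D l v) * pf l v (root D l))"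
proof -
  have "(\<Sum>\<^sup>+w. f w * P w []) = (\<Sum>k\<in>indices D. wt k * (\<Sum>\<^sup>+v. f (emb D k v) * pf k v (root D k)))"
    by (subst sum_over_predecessors) (simp_all add: stem_def tip_def)
  also have "\<dots> = (\<Sum>k\<in>indices D. if k = l then wt l * (\<Sum>\<^sup>+v. f (emb D l v) * pf l v (root D l)) else 0)"
  proof (intro sum.cong refl)
    fix k assume k: "k \<in> indices D"
    have "f (emb D k v) * pf k v (root D k) = 0" if "k \<noteq> l" for v
    proof (cases "v \<in> Vx k")
      case True
      then have "emb D k v \<notin> Branch l" "emb D k v \<noteq> []" using Vx_unique[OF True, of l] in_VxD that by (auto simp: emb_def Branch_def)
      then show ?thesis by (simp add: f)
    next
      case False
      then have "v = root D k \<or> v \<notin> factor D k" using k by (auto simp: Vx_eq)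
      then show ?thesis using k by (auto simp: pf_outside)
    qed
    then show "wt k * (\<Sum>\<^sup>+v. f (emb D k v) * pf k v (root D k)) =
       (if k = l then wt l * (\<Sum>\<^sup>+v. f (emb D l v) * pf l v (root D l)) else 0)"
      by (simp add: csum_zero)
  qed
  finally show ?thesis using l by simp
qed

end


section \<open>Excursions and their generating functions\<close>

context free_product
begin

text \<open>Returns to the empty word without using \<open>V\<^sub>i\<^sup>\<times>\<close>: these are also the returns to \<open>x\<close> inside its
  cone, when \<open>x\<close> has type \<open>i\<close>.\<close>

definition gn :: "nat \<Rightarrow> nat \<Rightarrow> ennreal" where
  "gn i n = taboo P (Avoid i) n [] []"

text \<open>First returns to the empty word through the branch \<open>l\<close>; the return happens at time \<open>n + 1\<close>.\<close>

definition hn :: "nat \<Rightarrow> nat \<Rightarrow> ennreal" where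
  "hn l n = (\<Sum>\<^sup>+w. taboo P (Branch l) n [] w * P w [])"

text \<open>Paths from the empty word whose last step, at time \<open>n + 1\<close>, is a step of the factor \<open>j\<close> to some letter
  of \<open>V\<^sub>j\<^sup>\<times>\<close>, and which stay in the branch \<open>j\<close> after time \<open>0\<close>.\<close>

definition cn :: "nat \<Rightarrow> nat \<Rightarrow> ennreal" where
  "cn j n = (\<Sum>\<^sup>+y. if y \<in> Vx j then wt j * (\<Sum>\<^sup>+v. taboo P (Branch j) n [] (emb D j v) * pf j v y) else 0)"

text \<open>The same without the restriction to one branch, but avoiding \<open>V\<^sub>i\<^sup>\<times>\<close>. Up to the factor
  \<open>(1 - \<xi>\<^sub>j) / (1 - \<xi>\<^sub>i)\<close> this is the probability that the next exit time is \<open>n + 1\<close> steps later and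
  exits into a letter of type \<open>j\<close>, if the current type is \<open>i\<close>.\<close>

definition Kn :: "nat \<Rightarrow> nat \<Rightarrow> nat \<Rightarrow> ennreal" where
  "Kn i j n = (\<Sum>\<^sup>+y. if y \<in> Vx j then wt j * (\<Sum>\<^sup>+v. taboo P (Avoid i) n [] (emb D j v) * pf j v y) else 0)"

definition Gf :: "nat \<Rightarrow> ennreal \<Rightarrow> ennreal" where
  "Gf i z = (\<Sum>\<^sup>+n. gn i n * z ^ n)"

definition Hf :: "nat \<Rightarrow> ennreal \<Rightarrow> ennreal" where
  "Hf l z = (\<Sum>\<^sup>+n. hn l n * z ^ Suc n)"

definition Cf :: "nat \<Rightarrow> ennreal \<Rightarrow> ennreal" where
  "Cf j z = (\<Sum>\<^sup>+n. cn j n * z ^ Suc n)"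

definition Kf :: "nat \<Rightarrow> nat \<Rightarrow> ennreal \<Rightarrow> ennreal" where
  "Kf i j z = (\<Sum>\<^sup>+n. Kn i j n * z ^ Suc n)"

text \<open>This is \<open>\<xi>\<^sub>j(z)\<close>, since \<open>Gf j z = 1 / (1 - H\<^sub>j(z))\<close> for the generating function \<open>H\<^sub>j\<close> of the first
  returns that do not start in \<open>V\<^sub>j\<close>.\<close>

definition xif :: "nat \<Rightarrow> ennreal \<Rightarrow> ennreal" where
  "xif j z = wt j * z * Gf j z"

text \<open>The generating function of the visits to the points of \<open>V\<^sub>j\<close> during a single excursion into branch
  \<open>j\<close>, its start included, extended by zero.\<close>

definition lam :: "nat \<Rightarrow> ennreal \<Rightarrow> 'a \<Rightarrow> ennreal" where
  "lam j z v = (if v \<in> factor D j then (\<Sum>\<^sup>+n. taboo P (Branch j) n [] (emb D j v) * z ^ n) else 0)"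

definition Tf :: "nat \<Rightarrow> ennreal \<Rightarrow> ennreal" where
  "Tf j z = (\<Sum>\<^sup>+s. if s \<in> Vx j then lam j z s else 0)"

lemma hn_0 [simp]: "hn l 0 = 0"
  unfolding hn_def using Nil_not_loop by (intro csum_zero) simp

lemma gn_0 [simp]: "gn i 0 = 1"
  by (simp add: gn_def)

lemma last_root_decomp:
  assumes "w \<in> Branch l" "l \<noteq> i"
  shows "taboo P (Avoid i) n [] w = (\<Sum>m<n. gn i m * taboo P (Branch l) (n - m) [] w)"
  unfolding gn_def
  by (rule last_exit_point) (use assms Branch_subset_Avoid Branch_enter in auto)

text \<open>A return at time \<open>n + 1\<close> is decomposed at the previous visit to the empty word, and the excursion
  between the two visits lies in one branch.\<close>

lemma gn_renewal: "gn i (Suc n) = (\<Sum>m\<le>n. gn i m * (\<Sum>l\<in>indices D - {i}. hn l (n - m)))"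
proof -
  let ?I = "indices D - {i}"
  have "gn i (Suc n) = (\<Sum>\<^sup>+w. taboo P (Avoid i) n [] w * P w [])" by (simp add: gn_def)
  also have "\<dots> = (\<Sum>\<^sup>+w. \<Sum>l\<in>?I. if w \<in> Branch l then taboo P (Avoid i) n [] w * P w [] else 0)"
  proof (rule csum_cong)
    fix w
    show "taboo P (Avoid i) n [] w * P w [] = (\<Sum>l\<in>?I. if w \<in> Branch l then taboo P (Avoid i) n [] w * P w [] else 0)"
    proof (cases "w \<in> Avoid i \<and> w \<noteq> []")
      case True
      then obtain l where l: "l \<in> ?I" "w \<in> Branch l" using in_Avoid_cases by blast
      then have "w \<in> Branch k \<longleftrightarrow> k = l" for k using Branch_disjoint by blast
      then show ?thesis using l by simp
    next
      case False
      then have "taboo P (Avoid i) n [] w * P w [] = 0" using Nil_not_loop by (cases "w = []") (auto simp: taboo_outside)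
      then show ?thesis by (simp only: if_cancel sum.neutral_const)
    qed
  qed
  also have "\<dots> = (\<Sum>l\<in>?I. \<Sum>\<^sup>+w. if w \<in> Branch l then taboo P (Avoid i) n [] w * P w [] else 0)"
    by (rule csum_sum)
  also have "\<dots> = (\<Sum>l\<in>?I. \<Sum>m<n. gn i m * hn l (n - m))"
  proof (intro sum.cong refl)
    fix l assume l: "l \<in> ?I"
    have "(\<Sum>\<^sup>+w. if w \<in> Branch l then taboo P (Avoid i) n [] w * P w [] else 0) =
        (\<Sum>\<^sup>+w. \<Sum>m<n. gn i m * (taboo P (Branch l) (n - m) [] w * P w []))"
    proof (rule csum_cong)
      fix w
      show "(if w \<in> Branch l then taboo P (Avoid i) n [] w * P w [] else 0) =
        (\<Sum>m<n. gn i m * (taboo P (Branch l) (n - m) [] w * P w []))"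
      proof (cases "w \<in> Branch l")
        case True
        then show ?thesis using l by (simp add: last_root_decomp[of w l i n] sum_distrib_right mult.assoc)
      next
        case False
        then show ?thesis by (simp add: taboo_Suc_outside)
      qed
    qed
    also have "\<dots> = (\<Sum>m<n. gn i m * hn l (n - m))"
      by (simp add: csum_sum csum_cmult hn_def)
    finally show "(\<Sum>\<^sup>+w. if w \<in> Branch l then taboo P (Avoid i) n [] w * P w [] else 0) = (\<Sum>m<n. gn i m * hn l (n - m))" .
  qed
  also have "\<dots> = (\<Sum>l\<in>?I. \<Sum>m\<le>n. gn i m * hn l (n - m))"
    by (simp add: lessThan_Suc_atMost[symmetric])
  also have "\<dots> = (\<Sum>m\<le>n. gn i m * (\<Sum>l\<in>?I. hn l (n - m)))"
    by (subst sum.swap) (simp add: sum_distrib_left)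
  finally show ?thesis .
qed

lemma gf_conv: "(\<Sum>\<^sup>+n. (\<Sum>m\<le>n. a m * b (n - m)) * z ^ n) = (\<Sum>\<^sup>+n. a n * z ^ n) * (\<Sum>\<^sup>+n. b n * (z :: ennreal) ^ n)"
proof -
  have "(\<Sum>\<^sup>+n. (\<Sum>m\<le>n. a m * b (n - m)) * z ^ n) = (\<Sum>\<^sup>+n. \<Sum>m\<le>n. (a m * z ^ m) * (b (n - m) * z ^ (n - m)))"
  proof (rule csum_cong)
    fix n
    have "a m * b (n - m) * z ^ n = (a m * z ^ m) * (b (n - m) * z ^ (n - m))" if "m \<le> n" for m
    proof -
      have "z ^ n = z ^ m * z ^ (n - m)" using that by (simp add: power_add[symmetric])
      then show ?thesis by (simp add: ac_simps)
    qed
    then show "(\<Sum>m\<le>n. a m * b (n - m)) * z ^ n = (\<Sum>m\<le>n. (a m * z ^ m) * (b (n - m) * z ^ (n - m)))"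
      by (simp add: sum_distrib_right)
  qed
  also have "\<dots> = (\<Sum>\<^sup>+m. \<Sum>\<^sup>+k. (a m * z ^ m) * (b k * z ^ k))" by (rule csum_conv)
  finally show ?thesis by (simp add: csum_cmult csum_multc)
qed

lemma gf_Suc: "(\<Sum>\<^sup>+n. a n * z ^ Suc n) = z * (\<Sum>\<^sup>+n. a n * (z :: ennreal) ^ n)"
  by (simp add: csum_cmult[symmetric] mult.left_commute simp_thms)

lemma Gf_renewal: "Gf i z = 1 + Gf i z * (\<Sum>l\<in>indices D - {i}. Hf l z)"
proof -
  have "Gf i z = 1 + (\<Sum>\<^sup>+n. (\<Sum>m\<le>n. gn i m * (\<Sum>l\<in>indices D - {i}. hn l (n - m))) * z ^ Suc n)"
    unfolding Gf_def by (subst csum_nat_Suc) (simp only: gn_renewal gn_0 power_0 mult_1)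
  also have "\<dots> = 1 + z * (Gf i z * (\<Sum>\<^sup>+n. (\<Sum>l\<in>indices D - {i}. hn l n) * z ^ n))"
    unfolding gf_Suc gf_conv[of "gn i" "\<lambda>n. \<Sum>l\<in>indices D - {i}. hn l n"] Gf_def ..
  also have "(\<Sum>\<^sup>+n. (\<Sum>l\<in>indices D - {i}. hn l n) * z ^ n) = (\<Sum>l\<in>indices D - {i}. \<Sum>\<^sup>+n. hn l n * z ^ n)"
    by (simp add: sum_distrib_right csum_sum)
  also have "z * (Gf i z * \<dots>) = Gf i z * (\<Sum>l\<in>indices D - {i}. Hf l z)"
    unfolding Hf_def gf_Suc by (simp add: sum_distrib_left ac_simps)
  finally show ?thesis .
qed

lemma lam_root: "j \<in> indices D \<Longrightarrow> lam j z (root D j) = 1"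
proof -
  assume j: "j \<in> indices D"
  have "(\<Sum>\<^sup>+n. taboo P (Branch j) n [] [] * z ^ n) = 1"
    by (subst csum_single[of 0]) (auto simp: taboo_Suc_outside)
  then show ?thesis using root_in[OF j] by (simp add: lam_def emb_def)
qed

lemma Cone_subset_Branch: "s \<in> Vx j \<Longrightarrow> Cone [s] \<subseteq> Branch j"
  by (auto simp: Cone_def Branch_def)

text \<open>The walk visits \<open>s\<close> after a last step of the factor \<open>j\<close> to \<open>s\<close>, followed by a loop at \<open>s\<close> inside the
  cone of \<open>s\<close>.\<close>

lemma taboo_branch:
  assumes s: "s \<in> Vx j"
  shows "taboo P (Branch j) (Suc k) [] [s] =
    (\<Sum>m\<le>k. (wt j * (\<Sum>\<^sup>+v. taboo P (Branch j) m [] (emb D j v) * pf j v s)) * gn j (k - m))"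
proof -
  have w: "[s] \<in> words D" using s by (auto simp: singleton_words)
  have e: "(\<Sum>\<^sup>+w. if w \<in> Cone [s] then 0 else f w * P w [s]) = wt j * (\<Sum>\<^sup>+v. f (emb D j v) * pf j v s)" for f
    using entry_sum[of "[]" s j f] w s by (simp only: append_Nil)
  have gg: "taboo P (Cone [s]) n [s] [s] = gn j n" for n
    using Cone_shift[OF w, of n "[]"] ltype_snoc[OF s, of "[]"] by (simp add: gn_def)
  have cn: "[s] \<in> Cone [s]" "[] \<notin> Cone [s]" using w by (auto simp: Cone_def)
  have "taboo P (Branch j) (Suc k) [] [s] = (\<Sum>m<Suc k. (\<Sum>\<^sup>+w. if w \<in> Cone [s] then 0 else taboo P (Branch j) m [] w * P w [s]) *
      taboo P (Cone [s]) (Suc k - 1 - m) [s] [s])"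
    by (rule last_entrance_point[OF Cone_subset_Branch[OF s] cn(2) cn(1) cn(1) Cone_enter])
  then show ?thesis by (simp only: e gg lessThan_Suc_atMost diff_Suc_1)
qed

text \<open>Each step of the factor \<open>j\<close>, together with the loop that follows it, carries the weight
  \<open>\<xi>\<^sub>j(z) = \<alpha>\<^sub>j z Gf j z\<close>. Hence \<^const>\<open>lam\<close> is the Green function of \<open>P\<^sub>j\<close> at \<open>\<xi>\<^sub>j(z)\<close>, killed at the
  return to the root.\<close>

lemma lam_balance:
  assumes s: "s \<in> Vx j"
  shows "lam j z s = xif j z * (\<Sum>\<^sup>+v. lam j z v * pf j v s)"
proof -
  let ?B = "\<lambda>m. wt j * (\<Sum>\<^sup>+v. taboo P (Branch j) m [] (emb D j v) * pf j v s)"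
  have B: "(\<Sum>\<^sup>+m. ?B m * z ^ m) = wt j * (\<Sum>\<^sup>+v. lam j z v * pf j v s)"
  proof -
    have "(\<Sum>\<^sup>+m. ?B m * z ^ m) = wt j * (\<Sum>\<^sup>+m. \<Sum>\<^sup>+v. taboo P (Branch j) m [] (emb D j v) * z ^ m * pf j v s)"
      by (simp add: csum_cmult[symmetric] csum_multc[symmetric] ac_simps)
    also have "\<dots> = wt j * (\<Sum>\<^sup>+v. (\<Sum>\<^sup>+m. taboo P (Branch j) m [] (emb D j v) * z ^ m) * pf j v s)"
      by (subst csum_swap) (simp add: csum_multc)
    also have "\<dots> = wt j * (\<Sum>\<^sup>+v. lam j z v * pf j v s)"
      by (intro arg_cong[where f = "\<lambda>x. wt j * x"] csum_cong) (auto simp: lam_def pf_outside)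
    finally show ?thesis .
  qed
  have "lam j z s = (\<Sum>\<^sup>+n. taboo P (Branch j) n [] [s] * z ^ n)"
    using in_VxD[OF s] by (simp add: lam_def emb_def)
  also have "\<dots> = (\<Sum>\<^sup>+n. taboo P (Branch j) (Suc n) [] [s] * z ^ Suc n)"
    by (subst csum_nat_Suc) simp
  also have "\<dots> = z * ((\<Sum>\<^sup>+m. ?B m * z ^ m) * Gf j z)"
    unfolding taboo_branch[OF s] gf_Suc gf_conv[of ?B "gn j"] Gf_def ..
  finally show ?thesis unfolding B by (simp add: xif_def ac_simps)
qed

lemma lam_total: "j \<in> indices D \<Longrightarrow> csum (lam j z) = 1 + Tf j z"
proof -
  assume j: "j \<in> indices D"
  have "csum (lam j z) = lam j z (root D j) + (\<Sum>\<^sup>+v. if v = root D j then 0 else lam j z v)"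
    by (rule csum_point)
  also have "(\<Sum>\<^sup>+v. if v = root D j then 0 else lam j z v) = Tf j z"
    unfolding Tf_def using j by (intro csum_cong) (auto simp: Vx_eq lam_def)
  finally show ?thesis using j by (simp add: lam_root)
qed

lemma lam_step_total: "j \<in> indices D \<Longrightarrow> (\<Sum>\<^sup>+y. \<Sum>\<^sup>+v. lam j z v * pf j v y) = 1 + Tf j z"
proof -
  assume j: "j \<in> indices D"
  have "(\<Sum>\<^sup>+y. \<Sum>\<^sup>+v. lam j z v * pf j v y) = (\<Sum>\<^sup>+v. lam j z v * csum (pf j v))"
    by (subst csum_swap) (simp add: csum_cmult)
  also have "\<dots> = csum (lam j z)"
    using j by (intro csum_cong) (auto simp: lam_def pf_row_sum)
  finally show ?thesis using j by (simp add: lam_total)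
qed

lemma Cf_eq: "Cf j z = wt j * z * (\<Sum>\<^sup>+y. if y \<in> Vx j then (\<Sum>\<^sup>+v. lam j z v * pf j v y) else 0)"
proof -
  have "Cf j z = z * (\<Sum>\<^sup>+n. \<Sum>\<^sup>+y. if y \<in> Vx j then wt j * (\<Sum>\<^sup>+v. taboo P (Branch j) n [] (emb D j v) * z ^ n * pf j v y) else 0)"
    unfolding Cf_def gf_Suc cn_def
    by (intro arg_cong[where f = "\<lambda>x. z * x"] csum_cong, subst csum_multc[symmetric], intro csum_cong)
       (auto simp: csum_cmult[symmetric] csum_multc[symmetric] ac_simps)
  also have "\<dots> = z * (\<Sum>\<^sup>+y. if y \<in> Vx j then wt j * (\<Sum>\<^sup>+v. lam j z v * pf j v y) else 0)"
  proof (subst csum_swap, intro arg_cong[where f = "\<lambda>x. z * x"] csum_cong)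
    fix y
    have "(\<Sum>\<^sup>+n. wt j * (\<Sum>\<^sup>+v. taboo P (Branch j) n [] (emb D j v) * z ^ n * pf j v y)) =
      wt j * (\<Sum>\<^sup>+v. lam j z v * pf j v y)"
      unfolding csum_cmult
    proof (subst csum_swap, intro arg_cong[where f = "\<lambda>x. wt j * x"] csum_cong)
      fix v
      show "(\<Sum>\<^sup>+n. taboo P (Branch j) n [] (emb D j v) * z ^ n * pf j v y) = lam j z v * pf j v y"
        by (auto simp: csum_multc lam_def pf_outside)
    qed
    then show "(\<Sum>\<^sup>+n. if y \<in> Vx j then wt j * (\<Sum>\<^sup>+v. taboo P (Branch j) n [] (emb D j v) * z ^ n * pf j v y) else 0) =
       (if y \<in> Vx j then wt j * (\<Sum>\<^sup>+v. lam j z v * pf j v y) else 0)"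
      by simp
  qed
  also have "\<dots> = wt j * z * (\<Sum>\<^sup>+y. if y \<in> Vx j then (\<Sum>\<^sup>+v. lam j z v * pf j v y) else 0)"
    by (simp add: csum_cmult[symmetric] if_distrib[of "\<lambda>x. _ * x"] ac_simps cong: if_cong)
  finally show ?thesis .
qed

lemma Tf_eq: "Tf j z = Gf j z * Cf j z"
proof -
  have "Tf j z = (\<Sum>\<^sup>+s. xif j z * (if s \<in> Vx j then (\<Sum>\<^sup>+v. lam j z v * pf j v s) else 0))"
    unfolding Tf_def by (intro csum_cong) (simp add: lam_balance)
  then show ?thesis unfolding Cf_eq by (simp add: csum_cmult xif_def ac_simps)
qed

lemma Hf_eq:
  assumes j: "j \<in> indices D"
  shows "Hf j z = wt j * z * (\<Sum>\<^sup>+v. lam j z v * pf j v (root D j))"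
proof -
  have hn: "hn j n = wt j * (\<Sum>\<^sup>+v. taboo P (Branch j) n [] (emb D j v) * pf j v (root D j))" for n
    unfolding hn_def by (rule return_sum[OF j]) (simp add: taboo_outside)
  have "Hf j z = wt j * z * (\<Sum>\<^sup>+n. \<Sum>\<^sup>+v. taboo P (Branch j) n [] (emb D j v) * z ^ n * pf j v (root D j))"
    unfolding Hf_def gf_Suc hn
    by (simp add: csum_cmult[symmetric] csum_multc[symmetric] ac_simps)
  also have "\<dots> = wt j * z * (\<Sum>\<^sup>+v. lam j z v * pf j v (root D j))"
  proof (subst csum_swap, intro arg_cong[where f = "\<lambda>x. wt j * z * x"] csum_cong)
    fix v
    show "(\<Sum>\<^sup>+n. taboo P (Branch j) n [] (emb D j v) * z ^ n * pf j v (root D j)) = lam j z v * pf j v (root D j)"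
      by (auto simp: csum_multc lam_def pf_outside)
  qed
  finally show ?thesis .
qed

lemma lam_step_split:
  assumes j: "j \<in> indices D"
  shows "1 + Tf j z = (\<Sum>\<^sup>+v. lam j z v * pf j v (root D j)) +
    (\<Sum>\<^sup>+y. if y \<in> Vx j then (\<Sum>\<^sup>+v. lam j z v * pf j v y) else 0)"
proof -
  let ?q = "\<lambda>y. \<Sum>\<^sup>+v. lam j z v * pf j v y"
  have "1 + Tf j z = ?q (root D j) + (\<Sum>\<^sup>+y. if y = root D j then 0 else ?q y)"
    using csum_point[of ?q "root D j"] lam_step_total[OF j, of z] by simp
  also have "(\<Sum>\<^sup>+y. if y = root D j then 0 else ?q y) = (\<Sum>\<^sup>+y. if y \<in> Vx j then ?q y else 0)"
  proof (rule csum_cong)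
    fix y
    have "?q y = 0" if "y \<notin> factor D j" using that by (intro csum_zero) (simp add: pf_outside)
    then show "(if y = root D j then 0 else ?q y) = (if y \<in> Vx j then ?q y else 0)"
      using j by (auto simp: Vx_eq)
  qed
  finally show ?thesis .
qed

text \<open>The next step of the factor \<open>j\<close> leads either back to the root or to another letter.\<close>

lemma crossing_plus_return:
  assumes j: "j \<in> indices D"
  shows "Cf j z + Hf j z = wt j * z * (1 + Tf j z)"
  unfolding Cf_eq Hf_eq[OF j] lam_step_split[OF j] by (simp add: distrib_left add.commute)

text \<open>The last visit to the empty word separates the part that may use all branches but the \<open>i\<close>-th from the
  final excursion into branch \<open>j\<close>.\<close>

lemma Kn_conv:
  assumes "i \<noteq> j" "j \<in> indices D"
  shows "Kn i j n = (\<Sum>m\<le>n. gn i m * cn j (n - m))"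
proof -
  have t: "taboo P (Avoid i) n [] (emb D j v) = (\<Sum>m\<le>n. gn i m * taboo P (Branch j) (n - m) [] (emb D j v))" if "v \<in> factor D j" for v
  proof (cases "v = root D j")
    case True
    have "(\<Sum>m\<le>n. gn i m * taboo P (Branch j) (n - m) [] []) = (\<Sum>m\<le>n. if m = n then gn i m else 0)"
      by (intro sum.cong refl) (auto simp: taboo_Suc_outside)
    then show ?thesis using True by (simp add: emb_def gn_def)
  next
    case False
    then have "v \<in> Vx j" using that assms by (simp add: Vx_eq)
    then have "taboo P (Avoid i) n [] [v] = (\<Sum>m<n. gn i m * taboo P (Branch j) (n - m) [] [v])"
      using assms by (intro last_root_decomp) (auto simp: singleton_Branch)
    then show ?thesis using False by (simp add: emb_def lessThan_Suc_atMost[symmetric])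
  qed
  have "Kn i j n = (\<Sum>\<^sup>+y. \<Sum>m\<le>n. gn i m * (if y \<in> Vx j then wt j * (\<Sum>\<^sup>+v. taboo P (Branch j) (n - m) [] (emb D j v) * pf j v y) else 0))"
    unfolding Kn_def
  proof (rule csum_cong)
    fix y
    have "(\<Sum>\<^sup>+v. taboo P (Avoid i) n [] (emb D j v) * pf j v y) =
      (\<Sum>\<^sup>+v. \<Sum>m\<le>n. gn i m * (taboo P (Branch j) (n - m) [] (emb D j v) * pf j v y))"
    proof (rule csum_cong)
      fix v
      show "taboo P (Avoid i) n [] (emb D j v) * pf j v y = (\<Sum>m\<le>n. gn i m * (taboo P (Branch j) (n - m) [] (emb D j v) * pf j v y))"
        by (cases "v \<in> factor D j") (simp_all add: t pf_outside sum_distrib_right mult.assoc)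
    qed
    also have "\<dots> = (\<Sum>m\<le>n. gn i m * (\<Sum>\<^sup>+v. taboo P (Branch j) (n - m) [] (emb D j v) * pf j v y))"
      by (simp add: csum_sum csum_cmult)
    finally show "(if y \<in> Vx j then wt j * (\<Sum>\<^sup>+v. taboo P (Avoid i) n [] (emb D j v) * pf j v y) else 0) =
      (\<Sum>m\<le>n. gn i m * (if y \<in> Vx j then wt j * (\<Sum>\<^sup>+v. taboo P (Branch j) (n - m) [] (emb D j v) * pf j v y) else 0))"
      by (simp add: sum_distrib_left ac_simps)
  qed
  also have "\<dots> = (\<Sum>m\<le>n. gn i m * cn j (n - m))"
    by (simp add: csum_sum csum_cmult cn_def)
  finally show ?thesis .
qed

lemma Kf_eq: "i \<noteq> j \<Longrightarrow> j \<in> indices D \<Longrightarrow> Kf i j z = Gf i z * Cf j z"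
  unfolding Kf_def Cf_def gf_Suc Gf_def by (simp only: Kn_conv gf_conv[of "gn i" "cn j"] mult.left_commute simp_thms)

lemma gn_mono: "gn i n \<le> gn 0 n"
  unfolding gn_def by (rule taboo_mono) (simp add: Avoid_0 Avoid_subset)

lemma Gf_mono: "Gf i z \<le> Gf 0 z"
  unfolding Gf_def by (intro csum_mono mult_right_mono gn_mono) auto

lemma csum_taboo_Suc: "csum (taboo q A (Suc n) x) = (\<Sum>\<^sup>+y. if y \<in> A then \<Sum>\<^sup>+w. taboo q A n x w * q w y else 0)"
  by (intro csum_cong) simp

text \<open>\<open>Avoid i\<close> can only be left from the empty word, and then with probability \<open>wt i\<close>.\<close>

lemma Avoid_mass: "csum (taboo P (Avoid i) n []) = csum (taboo P (Avoid i) (Suc n) []) + wt i * gn i n"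
proof -
  have "csum (taboo P (Avoid i) n []) = (\<Sum>\<^sup>+w. taboo P (Avoid i) n [] w * csum (P w))"
  proof (rule csum_cong)
    fix w show "taboo P (Avoid i) n [] w = taboo P (Avoid i) n [] w * csum (P w)"
    proof (cases "w \<in> Avoid i")
      case True
      then have "csum (P w) = 1" using Avoid_subset P_row_sum by blast
      then show ?thesis by (simp del: taboo.simps)
    next
      case False
      then have "w \<noteq> []" using Nil_in_Avoid by metis
      then show ?thesis using False by (simp add: taboo_outside)
    qed
  qed
  also have "\<dots> = (\<Sum>\<^sup>+y. \<Sum>\<^sup>+w. taboo P (Avoid i) n [] w * P w y)"
    by (subst csum_swap) (simp add: csum_cmult)
  also have "\<dots> = (\<Sum>\<^sup>+y. if y \<in> Avoid i then \<Sum>\<^sup>+w. taboo P (Avoid i) n [] w * P w y else 0) +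
      (\<Sum>\<^sup>+y. if y \<in> Avoid i then 0 else \<Sum>\<^sup>+w. taboo P (Avoid i) n [] w * P w y)"
    by (rule csum_split)
  also have "(\<Sum>\<^sup>+y. if y \<in> Avoid i then 0 else \<Sum>\<^sup>+w. taboo P (Avoid i) n [] w * P w y) =
    (\<Sum>\<^sup>+y. gn i n * (if y \<in> Avoid i then 0 else P [] y))"
  proof (rule csum_cong)
    fix y
    have "(\<Sum>\<^sup>+w. taboo P (Avoid i) n [] w * P w y) = gn i n * P [] y" if "y \<notin> Avoid i"
    proof -
      have "taboo P (Avoid i) n [] w * P w y = 0" if "w \<noteq> []" for w
        using Avoid_exit[OF _ that \<open>y \<notin> Avoid i\<close>] that by (cases "w \<in> Avoid i") (auto simp: taboo_outside)
      then show ?thesis by (subst csum_single[of "[]"]) (auto simp: gn_def)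
    qed
    then show "(if y \<in> Avoid i then 0 else \<Sum>\<^sup>+w. taboo P (Avoid i) n [] w * P w y) = gn i n * (if y \<in> Avoid i then 0 else P [] y)"
      by simp
  qed
  also have "(\<Sum>\<^sup>+y. gn i n * (if y \<in> Avoid i then 0 else P [] y)) = wt i * gn i n"
    unfolding csum_cmult exit_root by (rule mult.commute)
  finally show ?thesis by (simp only: csum_taboo_Suc)
qed

lemma Avoid_mass_sum: "csum (taboo P (Avoid i) N []) + wt i * (\<Sum>n<N. gn i n) = 1"
proof (induction N)
  case (Suc N)
  have "csum (taboo P (Avoid i) (Suc N) []) + wt i * (\<Sum>n<Suc N. gn i n) =
    csum (taboo P (Avoid i) N []) + wt i * (\<Sum>n<N. gn i n)"
    unfolding Avoid_mass[of i N] by (simp add: distrib_left ac_simps del: taboo.simps)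
  then show ?case using Suc by (simp del: taboo.simps)
qed (simp add: csum_delta')

lemma Branch_mass: "csum (taboo P (Branch l) (Suc n) []) = csum (taboo P (Branch l) (Suc (Suc n)) []) + hn l (Suc n)"
proof -
  let ?t = "taboo P (Branch l) (Suc n) []"
  have "csum ?t = (\<Sum>\<^sup>+w. ?t w * csum (P w))"
  proof (rule csum_cong)
    fix w show "?t w = ?t w * csum (P w)"
      using P_row_sum[of w] subsetD[OF Branch_subset, of w l] taboo_Suc_outside[of w "Branch l" "Suc n" P "[]"] by (cases "w \<in> Branch l") (auto simp del: taboo.simps)
  qed
  also have "\<dots> = (\<Sum>\<^sup>+y. \<Sum>\<^sup>+w. ?t w * P w y)"
    by (subst csum_swap) (simp add: csum_cmult)
  also have "\<dots> = (\<Sum>\<^sup>+y. if y \<in> Branch l then \<Sum>\<^sup>+w. ?t w * P w y else 0) +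
      (\<Sum>\<^sup>+y. if y \<in> Branch l then 0 else \<Sum>\<^sup>+w. ?t w * P w y)"
    by (rule csum_split)
  also have "(\<Sum>\<^sup>+y. if y \<in> Branch l then 0 else \<Sum>\<^sup>+w. ?t w * P w y) = hn l (Suc n)"
  proof (subst csum_single[of "[]"])
    fix y assume "y \<noteq> ([] :: 'a list)"
    have "?t w * P w y = 0" if "y \<notin> Branch l" for w
      using Branch_exit[of w l y] that \<open>y \<noteq> []\<close> taboo_Suc_outside[of w "Branch l" "Suc n" P "[]"] by (cases "w \<in> Branch l") auto
    then show "(if y \<in> Branch l then 0 else \<Sum>\<^sup>+w. ?t w * P w y) = 0" by (simp add: csum_zero del: taboo.simps)
  qed (simp add: hn_def del: taboo.simps)
  finally show ?thesis by (simp only: csum_taboo_Suc[symmetric])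
qed

lemma Branch_mass_sum: "csum (taboo P (Branch l) (Suc N) []) + (\<Sum>n\<le>N. hn l n) = wt l"
proof (induction N)
  case 0
  have "csum (taboo P (Branch l) (Suc 0) []) = (\<Sum>\<^sup>+y. if y \<in> Branch l then P [] y else 0)"
    by (intro csum_cong) (simp add: csum_single[of "[]"])
  then show ?case using enter_Branch[of l] by (simp del: taboo.simps)
next
  case (Suc N)
  then show ?case unfolding Branch_mass[of l N] by (simp add: ac_simps del: taboo.simps)
qed

lemma Hf_le: "Hf l 1 \<le> wt l"
proof -
  have "Hf l 1 = (SUP N. \<Sum>n<N. hn l n)" unfolding Hf_def by (simp add: csum_nat_SUP)
  also have "\<dots> \<le> wt l"
  proof (rule SUP_least)
    fix N
    have "(\<Sum>n<N. hn l n) \<le> (\<Sum>n\<le>N. hn l n)" by (intro sum_mono2) auto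
    also have "\<dots> \<le> csum (taboo P (Branch l) (Suc N) []) + (\<Sum>n\<le>N. hn l n)" by (simp add: add_increasing)
    finally show "(\<Sum>n<N. hn l n) \<le> wt l" unfolding Branch_mass_sum .
  qed
  finally show ?thesis .
qed

text \<open>\<open>xif i 1\<close> is the probability that the walk started at the empty word ever leaves \<open>Avoid i\<close>.\<close>

lemma xif_le_1: "xif i 1 \<le> 1"
proof -
  have "xif i 1 = (SUP N. wt i * (\<Sum>n<N. gn i n))"
    by (simp add: xif_def Gf_def csum_nat_SUP SUP_mult_left_ennreal)
  also have "\<dots> \<le> 1"
  proof (rule SUP_least)
    fix N
    show "wt i * (\<Sum>n<N. gn i n) \<le> 1" using Avoid_mass_sum[of i N] by (metis add_increasing order_refl zero_le)
  qed
  finally show ?thesis .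
qed

end


section \<open>Total mass of a branch and the Green function of a factor\<close>

lemma taboo_le_1:
  assumes "\<And>x. csum (q x) \<le> 1"
  shows "taboo q A n x y \<le> 1"
  using csum_ge[of "taboo q A n x" y] taboo_mass_le_1[of q A n x] assms order_trans by blast

text \<open>The premise on finiteness is essential: the bound follows from the self-bounding inequality only by
  subtracting \<open>x * t\<close>. It is used for truncated sums.\<close>

lemma ennreal_affine_bound:
  fixes t x :: ennreal
  assumes "t \<le> x * (1 + t)" "t < \<top>" "x < 1"
  shows "t \<le> ennreal (enn2real x / (1 - enn2real x))"
proof -
  obtain s where s: "t = ennreal s" "s \<ge> 0" using assms(2) by (cases t) auto
  have "x < \<top>" using assms(3) by (metis ennreal_one_less_top order.strict_trans)
  then obtain y where y: "x = ennreal y" "y \<ge> 0" by (cases x) auto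
  have y1: "y < 1" using assms(3) y by (simp add: ennreal_less_iff ennreal_1[symmetric] del: ennreal_1)
  have "ennreal s \<le> ennreal (y * (1 + s))"
    using assms(1) s y by (simp add: ennreal_mult ennreal_plus[symmetric] ennreal_1[symmetric] del: ennreal_1 ennreal_plus)
  then have "s \<le> y * (1 + s)" using s y by (simp add: ennreal_le_iff)
  then have "s \<le> y / (1 - y)" using y1 by (simp add: field_simps)
  then show ?thesis using s y by (simp add: ennreal_leI)
qed

context free_product
begin

text \<open>Summing the balance equation over all letters gives \<open>T \<le> \<xi>\<^sub>j (1 + T)\<close>, which bounds \<open>T\<close> only if it is
  known to be finite. For arguments beyond \<open>1\<close> there is no probabilistic reason for that, so the
  argument is run for the sums over the times before \<open>N\<close>, with a bound that does not depend on \<open>N\<close>.\<close>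

lemma Tf_partial_bound:
  assumes j: "j \<in> indices D" and z: "z < \<top>" and x: "xif j z < 1"
  shows "(\<Sum>n<N. (\<Sum>\<^sup>+s. if s \<in> Vx j then taboo P (Branch j) n [] [s] else 0) * z ^ n)
    \<le> ennreal (enn2real (xif j z) / (1 - enn2real (xif j z)))"
    (is "?T \<le> _")
proof (rule ennreal_affine_bound)
  \<comment> \<open>truncation in time, extended by zero so that convolutions can be taken over all times\<close>
  define b where "b m v = (if m < N then taboo P (Branch j) m [] (emb D j v) else 0)" for m v
  define L where "L v = (if v \<in> factor D j then \<Sum>\<^sup>+m. b m v * z ^ m else 0)" for v
  \<comment> \<open>equality up to truncation: a path in the branch never revisits the root\<close>
  have root: "L (root D j) \<le> 1"
  proof -
    have "(\<Sum>\<^sup>+m. b m (root D j) * z ^ m) \<le> (\<Sum>\<^sup>+m. taboo P (Branch j) m [] [] * z ^ m)"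
      by (intro csum_mono mult_right_mono) (auto simp: b_def emb_def)
    also have "\<dots> = 1" by (subst csum_single[of 0]) (auto simp: taboo_Suc_outside)
    finally show ?thesis by (simp add: L_def)
  qed
  have b_sum: "(\<Sum>\<^sup>+m. b m v * z ^ m) = (\<Sum>m<N. taboo P (Branch j) m [] (emb D j v) * z ^ m)" for v
  proof -
    have "(\<Sum>\<^sup>+m. b m v * z ^ m) = (\<integral>\<^sup>+m. b m v * z ^ m \<partial>count_space {..<N})"
      unfolding csum_def by (rule nn_integral_count_space_eq) (auto simp: b_def)
    also have "\<dots> = (\<Sum>m<N. taboo P (Branch j) m [] (emb D j v) * z ^ m)"
      by (subst nn_integral_count_space_finite) (auto simp: b_def)
    finally show ?thesis .
  qed
  have T_L: "?T = (\<Sum>\<^sup>+s. if s \<in> Vx j then L s else 0)"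
  proof -
    have "?T = (\<Sum>\<^sup>+s. \<Sum>n<N. (if s \<in> Vx j then taboo P (Branch j) n [] [s] else 0) * z ^ n)"
      by (simp add: csum_sum csum_multc)
    also have "\<dots> = (\<Sum>\<^sup>+s. if s \<in> Vx j then L s else 0)"
    proof (rule csum_cong)
      fix s
      show "(\<Sum>n<N. (if s \<in> Vx j then taboo P (Branch j) n [] [s] else 0) * z ^ n) = (if s \<in> Vx j then L s else 0)"
        using in_VxD[of s j] by (auto simp: L_def b_sum emb_def)
    qed
    finally show ?thesis .
  qed
  have L_total: "csum L \<le> 1 + ?T"
  proof -
    have "csum L = L (root D j) + (\<Sum>\<^sup>+v. if v = root D j then 0 else L v)" by (rule csum_point)
    also have "(\<Sum>\<^sup>+v. if v = root D j then 0 else L v) = ?T"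
      unfolding T_L using j by (intro csum_cong) (auto simp: Vx_eq L_def)
    finally show ?thesis using root by (simp add: add_right_mono)
  qed
  have L_s: "L s \<le> xif j z * (\<Sum>\<^sup>+v. L v * pf j v s)" if s: "s \<in> Vx j" for s
  proof -
    let ?B = "\<lambda>m. wt j * (\<Sum>\<^sup>+v. b m v * pf j v s)"
    have *: "b (Suc k) s \<le> (\<Sum>m\<le>k. ?B m * gn j (k - m))" for k
    proof (cases "Suc k < N")
      case True
      have "b (Suc k) s = taboo P (Branch j) (Suc k) [] [s]" using True in_VxD[OF s] by (simp add: b_def emb_def)
      also have "\<dots> = (\<Sum>m\<le>k. ?B m * gn j (k - m))"
        unfolding taboo_branch[OF s] using True by (intro sum.cong refl) (simp add: b_def)
      finally show ?thesis by simp
    qed (simp add: b_def)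
    have "L s = (\<Sum>\<^sup>+m. b m s * z ^ m)" using in_VxD[OF s] by (simp add: L_def)
    also have "\<dots> = (\<Sum>\<^sup>+k. b (Suc k) s * z ^ Suc k)"
      using in_VxD[OF s] by (subst csum_nat_Suc) (simp add: b_def emb_def)
    also have "\<dots> \<le> (\<Sum>\<^sup>+k. (\<Sum>m\<le>k. ?B m * gn j (k - m)) * z ^ Suc k)"
      by (intro csum_mono mult_right_mono *) auto
    also have "\<dots> = z * ((\<Sum>\<^sup>+m. ?B m * z ^ m) * Gf j z)"
      unfolding gf_Suc gf_conv[of ?B "gn j"] Gf_def ..
    also have "(\<Sum>\<^sup>+m. ?B m * z ^ m) = wt j * (\<Sum>\<^sup>+m. \<Sum>\<^sup>+v. b m v * z ^ m * pf j v s)"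
      by (simp add: csum_cmult[symmetric] csum_multc[symmetric] ac_simps)
    also have "\<dots> = wt j * (\<Sum>\<^sup>+v. (\<Sum>\<^sup>+m. b m v * z ^ m) * pf j v s)"
      by (subst csum_swap) (simp add: csum_multc)
    also have "\<dots> = wt j * (\<Sum>\<^sup>+v. L v * pf j v s)"
      by (intro arg_cong[where f = "\<lambda>x. wt j * x"] csum_cong) (auto simp: L_def pf_outside)
    finally show ?thesis by (simp add: xif_def ac_simps)
  qed
  show "?T \<le> xif j z * (1 + ?T)"
  proof -
    have "?T \<le> (\<Sum>\<^sup>+s. xif j z * (\<Sum>\<^sup>+v. L v * pf j v s))"
      unfolding T_L by (intro csum_mono) (auto simp: L_s)
    also have "\<dots> = xif j z * (\<Sum>\<^sup>+v. L v * csum (pf j v))"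
      unfolding csum_cmult by (subst csum_swap) (simp add: csum_cmult)
    also have "\<dots> \<le> xif j z * (\<Sum>\<^sup>+v. L v * 1)"
      by (intro mult_left_mono csum_mono pf_row_le j) auto
    also have "\<dots> \<le> xif j z * (1 + ?T)"
      using L_total by (intro mult_left_mono) auto
    finally show ?thesis .
  qed
  show "?T < \<top>"
  proof -
    have "?T \<le> (\<Sum>n<N. 1 * z ^ n)"
    proof (intro sum_mono mult_right_mono)
      fix n
      have "(\<Sum>\<^sup>+s. if s \<in> Vx j then taboo P (Branch j) n [] [s] else 0) =
          (\<Sum>\<^sup>+w. if w \<in> (\<lambda>s. [s]) ` Vx j then taboo P (Branch j) n [] w else 0)"
        by (subst csum_reindex[where g = "\<lambda>s. [s]" and A = "Vx j" and
            f = "\<lambda>w. if w \<in> (\<lambda>s. [s]) ` Vx j then taboo P (Branch j) n [] w else 0"])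
           (auto simp: inj_on_def intro!: csum_cong)
      also have "\<dots> \<le> csum (taboo P (Branch j) n [])" by (rule csum_mono) auto
      also have "\<dots> \<le> 1" by (rule taboo_mass_le_1) (rule P_row_le)
      finally show "(\<Sum>\<^sup>+s. if s \<in> Vx j then taboo P (Branch j) n [] [s] else 0) \<le> 1" .
    qed auto
    also have "\<dots> < \<top>" using z by (simp add: power_less_top_ennreal)
    finally show ?thesis .
  qed
qed (rule x)

lemma Tf_finite:
  assumes j: "j \<in> indices D" and z: "z < \<top>" and x: "xif j z < 1"
  shows "Tf j z < \<top>"
proof -
  have "Tf j z = (\<Sum>\<^sup>+s. \<Sum>\<^sup>+n. (if s \<in> Vx j then taboo P (Branch j) n [] [s] else 0) * z ^ n)"
    unfolding Tf_def
  proof (rule csum_cong)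
    fix s
    show "(if s \<in> Vx j then lam j z s else 0) = (\<Sum>\<^sup>+n. (if s \<in> Vx j then taboo P (Branch j) n [] [s] else 0) * z ^ n)"
      using in_VxD[of s j] by (auto simp: lam_def emb_def)
  qed
  also have "\<dots> = (\<Sum>\<^sup>+n. (\<Sum>\<^sup>+s. if s \<in> Vx j then taboo P (Branch j) n [] [s] else 0) * z ^ n)"
    by (subst csum_swap) (simp add: csum_multc)
  also have "\<dots> \<le> ennreal (enn2real (xif j z) / (1 - enn2real (xif j z)))"
    unfolding csum_nat_SUP by (intro SUP_least Tf_partial_bound assms)
  also have "\<dots> < \<top>" by simp
  finally show ?thesis .
qed

text \<open>Put \<open>\<xi> = \<xi>\<^sub>j(z)\<close> and let \<open>R\<close> be the total weight of the steps back to the root. The row vector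
  \<open>\<lambda> = lam j z\<close> satisfies \<open>\<lambda> (1 - \<xi> P\<^sub>j) = (1 - R) \<delta>\<close> with \<open>\<delta>\<close> the unit vector of the root, hence
  \<open>\<lambda> = (1 - R) \<Sum>\<^sub>m \<xi>\<^sup>m P\<^sub>j\<^sup>m(root, \<cdot>)\<close>. At the root this reads \<open>1 = (1 - R) G\<^sub>j(\<xi>)\<close>, and summation over
  all points gives \<open>(1 + T) (1 - \<xi>) = 1 - R\<close>. Eliminating \<open>R\<close> yields the claim, which is the source of
  the bracket in the definition of \<open>\<gamma>\<close>.\<close>

lemma green_identity:
  assumes j: "j \<in> indices D" and z: "z < \<top>" and x: "xif j z < 1"
  shows "(1 + enn2real (Tf j z)) * (1 - enn2real (xif j z)) * factor_green D j (enn2real (xif j z)) = 1"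
proof -
  let ?o = "root D j" and ?F = "factor D j"
  define R where "R = xif j z * (\<Sum>\<^sup>+v. lam j z v * pf j v ?o)"
  define t where "t m = taboo (pf j) ?F m ?o ?o" for m
  define \<mu> where "\<mu> m = (\<Sum>\<^sup>+u. lam j z u * taboo (pf j) ?F m u ?o)" for m
  have T: "Tf j z < \<top>" by (rule Tf_finite[OF assms])
  have RT: "xif j z * (1 + Tf j z) = R + Tf j z" 
  proof -
    have "(\<Sum>\<^sup>+y. xif j z * (if y \<in> Vx j then (\<Sum>\<^sup>+v. lam j z v * pf j v y) else 0)) = Tf j z"
      unfolding Tf_def by (intro csum_cong) (simp add: lam_balance)
    then show ?thesis unfolding R_def lam_step_split[OF j, of z] by (simp add: distrib_left csum_cmult)
  qed
  have x_fin: "xif j z < \<top>" using x by (metis ennreal_one_less_top order.strict_trans)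
  have R_fin: "R < \<top>"
  proof -
    have "R \<le> xif j z * (1 + Tf j z)" unfolding RT by simp
    also have "\<dots> < \<top>" using x_fin T by (simp add: ennreal_mult_less_top)
    finally show ?thesis .
  qed
  have pointwise: "lam j z u + (if u = ?o then R else 0) = (if u = ?o then 1 else 0) + xif j z * (\<Sum>\<^sup>+v. lam j z v * pf j v u)" for u
  proof -
    consider "u = ?o" | "u \<in> Vx j" "u \<noteq> ?o" | "u \<notin> ?F" "u \<noteq> ?o" using j by (auto simp: Vx_eq)
    then show ?thesis
    proof cases
      case 1
      then show ?thesis using j by (simp add: lam_root R_def)
    next
      case 2
      then show ?thesis using lam_balance[OF 2(1), of z] by simp
    next
      case 3
      then have "(\<Sum>\<^sup>+v. lam j z v * pf j v u) = 0" by (intro csum_zero) (simp add: pf_outside)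
      then show ?thesis using 3 by (simp add: lam_def)
    qed
  qed
  \<comment> \<open>the balance equation applied to the transition weights of length \<open>m\<close> into the root\<close>
  have step: "\<mu> m + R * t m = t m + xif j z * \<mu> (Suc m)" for m
  proof -
    have tsuc: "taboo (pf j) ?F (Suc m) v ?o = (\<Sum>\<^sup>+u. pf j v u * taboo (pf j) ?F m u ?o)" for v
      by (subst taboo_Suc_left) (auto intro!: csum_cong simp: pf_outside)
    have "\<mu> m + R * t m = (\<Sum>\<^sup>+u. (lam j z u + (if u = ?o then R else 0)) * taboo (pf j) ?F m u ?o)"
    proof -
      have "(\<Sum>\<^sup>+u. (if u = ?o then R else 0) * taboo (pf j) ?F m u ?o) = R * t m"
        by (subst csum_single[of ?o]) (auto simp: t_def)
      then show ?thesis by (simp add: distrib_right csum_add \<mu>_def)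
    qed
    also have "\<dots> = (\<Sum>\<^sup>+u. (if u = ?o then 1 else 0) * taboo (pf j) ?F m u ?o) +
        xif j z * (\<Sum>\<^sup>+u. \<Sum>\<^sup>+v. lam j z v * (pf j v u * taboo (pf j) ?F m u ?o))"
      unfolding pointwise distrib_right csum_add
      by (simp add: csum_cmult[symmetric] csum_multc[symmetric] mult.assoc)
    also have "(\<Sum>\<^sup>+u. (if u = ?o then 1 else 0) * taboo (pf j) ?F m u ?o) = t m"
      by (subst csum_single[of ?o]) (auto simp: t_def)
    also have "(\<Sum>\<^sup>+u. \<Sum>\<^sup>+v. lam j z v * (pf j v u * taboo (pf j) ?F m u ?o)) = \<mu> (Suc m)"
      unfolding \<mu>_def tsuc by (subst csum_swap) (simp add: csum_cmult)
    finally show ?thesis .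
  qed
  have "csum (pf j v) \<le> 1" for v by (rule pf_row_le[OF j])
  note tb1 = taboo_le_1[of "pf j", OF this]
  have \<mu>_le: "\<mu> m \<le> 1 + Tf j z" for m
  proof -
    have "\<mu> m \<le> (\<Sum>\<^sup>+u. lam j z u * 1)" unfolding \<mu>_def by (intro csum_mono mult_left_mono tb1) auto
    then show ?thesis using lam_total[OF j, of z] by simp
  qed
  have T1: "1 + Tf j z < \<top>" using T by simp
  have \<mu>_fin: "\<mu> m < \<top>" for m using order.strict_trans1[OF \<mu>_le T1] .
  have t1: "t m \<le> 1" for m unfolding t_def by (rule tb1)
  have t_fin: "t m < \<top>" for m using t1[of m] by (metis ennreal_one_less_top order.strict_trans1)
  define xir where "xir = enn2real (xif j z)"
  define Rr where "Rr = enn2real R"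
  define Tr where "Tr = enn2real (Tf j z)"
  define tr where "tr m = enn2real (t m)" for m
  define mr where "mr m = enn2real (\<mu> m)" for m
  have e: "xif j z = ennreal xir" "R = ennreal Rr" "Tf j z = ennreal Tr" "t m = ennreal (tr m)" "\<mu> m = ennreal (mr m)" for m
    using x_fin R_fin T t_fin[of m] \<mu>_fin[of m] by (simp_all add: xir_def Rr_def Tr_def tr_def mr_def)
  have nn: "0 \<le> xir" "0 \<le> Rr" "0 \<le> Tr" "0 \<le> tr m" "0 \<le> mr m" for m
    by (simp_all add: xir_def Rr_def Tr_def tr_def mr_def)
  have xr1: "xir < 1" using x unfolding e by (simp add: ennreal_less_iff nn ennreal_1[symmetric] del: ennreal_1)
  have tr1: "tr m \<le> 1" for m using t1[of m] unfolding e by simp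
  have mr1: "mr m \<le> 1 + Tr" for m
    using \<mu>_le[of m] nn unfolding e by (simp add: ennreal_plus[symmetric] ennreal_1[symmetric] del: ennreal_plus ennreal_1)
  have RTr: "xir * (1 + Tr) = Rr + Tr"
    using RT nn unfolding e
    by (simp add: ennreal_mult[symmetric] ennreal_plus[symmetric] ennreal_1[symmetric] del: ennreal_plus ennreal_1)
  have stepr: "mr m + Rr * tr m = tr m + xir * mr (Suc m)" for m
    using step[of m] nn unfolding e
    by (simp add: ennreal_mult[symmetric] ennreal_plus[symmetric] del: ennreal_plus)
  have mr0: "mr 0 = 1"
  proof -
    have "\<mu> 0 = 1" unfolding \<mu>_def by (subst csum_single[of ?o]) (auto simp: lam_root j)
    then show ?thesis by (simp add: mr_def)
  qed
  have tele: "1 + Rr * (\<Sum>m<M. tr m * xir ^ m) = (\<Sum>m<M. tr m * xir ^ m) + xir ^ M * mr M" for M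
  proof (induction M)
    case (Suc M)
    have "xir ^ M * (mr M + Rr * tr M) = xir ^ M * (tr M + xir * mr (Suc M))" by (simp add: stepr)
    then show ?case using Suc by (simp add: algebra_simps)
  qed (simp add: mr0)
  have summ: "summable (\<lambda>m. tr m * xir ^ m)"
  proof (rule summable_comparison_test')
    show "summable (\<lambda>m. xir ^ m)" using xr1 nn by (simp add: summable_geometric)
    show "norm (tr n * xir ^ n) \<le> xir ^ n" for n using tr1[of n] nn by (simp add: mult_left_le_one_le)
  qed
  have "(\<lambda>M. \<Sum>m<M. tr m * xir ^ m) \<longlonglongrightarrow> suminf (\<lambda>m. tr m * xir ^ m)"
    using summable_LIMSEQ[OF summ] .
  moreover have fg: "suminf (\<lambda>m. tr m * xir ^ m) = factor_green D j xir"
  proof -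
    have "nstep ?F (step D j) m ?o ?o = tr m" for m
    proof -
      have "ennreal (nstep ?F (step D j) m ?o ?o) = t m" "nstep ?F (step D j) m ?o ?o \<ge> 0"
        using nstep_taboo[of ?F "step D j" "pf j" ?o m ?o] step_nonneg[OF j] root_in[OF j] pf_row_le[OF j]
        by (simp_all add: t_def pf_def[abs_def])
      then show ?thesis by (simp add: tr_def enn2real_ennreal[symmetric] del: enn2real_ennreal) (metis enn2real_ennreal)
    qed
    then show ?thesis by (simp add: factor_green_def)
  qed
  ultimately have lim: "(\<lambda>M. \<Sum>m<M. tr m * xir ^ m) \<longlonglongrightarrow> factor_green D j xir" by simp
  have "(\<lambda>M. xir ^ M * mr M) \<longlonglongrightarrow> 0"
  proof (rule tendsto_sandwich[where f = "\<lambda>_. 0" and h = "\<lambda>M. xir ^ M * (1 + Tr)"])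
    show "(\<lambda>M. xir ^ M * (1 + Tr)) \<longlonglongrightarrow> 0"
      using tendsto_mult_right[OF LIMSEQ_realpow_zero[OF nn(1) xr1], of "1 + Tr"] by simp
    show "\<forall>\<^sub>F M in sequentially. xir ^ M * mr M \<le> xir ^ M * (1 + Tr)"
      using mr1 nn by (intro always_eventually allI mult_left_mono) auto
  qed (use nn in auto)
  then have "(\<lambda>M. (\<Sum>m<M. tr m * xir ^ m) + xir ^ M * mr M) \<longlonglongrightarrow> factor_green D j xir + 0"
    by (intro tendsto_add lim)
  moreover have "(\<lambda>M. (\<Sum>m<M. tr m * xir ^ m) + xir ^ M * mr M) \<longlonglongrightarrow> 1 + Rr * factor_green D j xir"
    unfolding tele[symmetric] by (intro tendsto_intros lim)
  ultimately have "1 + Rr * factor_green D j xir = factor_green D j xir + 0"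
    using LIMSEQ_unique by blast
  then have "(1 - Rr) * factor_green D j xir = 1" by (simp add: algebra_simps)
  moreover have "1 - Rr = (1 + Tr) * (1 - xir)" using RTr by (simp add: algebra_simps)
  ultimately show ?thesis by (simp add: xir_def Tr_def)
qed

lemma cn_0: "j \<in> indices D \<Longrightarrow> cn j 0 = wt j"
proof -
  assume j: "j \<in> indices D"
  have 1: "(\<Sum>\<^sup>+v. taboo P (Branch j) 0 [] (emb D j v) * pf j v y) = pf j (root D j) y" for y
    by (subst csum_single[of "root D j"]) (auto simp: emb_def)
  have "cn j 0 = (\<Sum>\<^sup>+y. wt j * pf j (root D j) y)"
    unfolding cn_def 1 using j by (intro csum_cong) (auto simp: Vx_eq pf_outside)
  then show ?thesis using j root_in by (simp add: csum_cmult pf_row_sum)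
qed

lemma Gf_ge_1: "Gf i z \<ge> 1"
  unfolding Gf_def using csum_ge[of "\<lambda>n. gn i n * z ^ n" 0] by simp

text \<open>If the walk avoids the branch \<open>j\<close> forever with positive probability, then, by the same property of the
  cones inside it, an excursion into this branch may last forever. Indeed
  \<open>Cf j 1 * (1 - \<xi>\<^sub>j) = \<alpha>\<^sub>j - Hf j 1\<close>, and the left side is positive.\<close>

lemma return_less_weight:
  assumes j: "j \<in> indices D" and x: "xif j 1 < 1"
  shows "Hf j 1 < wt j"
proof (rule ccontr)
  assume "\<not> Hf j 1 < wt j"
  then have H: "Hf j 1 = wt j" using Hf_le[of j] by (simp add: not_less antisym)
  have T: "Tf j 1 < \<top>" by (rule Tf_finite[OF j _ x]) simp
  have C: "Cf j 1 \<le> Tf j 1" unfolding Tf_eq using mult_right_mono[OF Gf_ge_1[of j 1], of "Cf j 1"] by simp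
  then have C_fin: "Cf j 1 < \<top>" using T by (rule order.strict_trans1)
  have "Cf j 1 + wt j = wt j + wt j * Tf j 1" using crossing_plus_return[OF j, of 1] H by (simp add: distrib_left)
  then have "Cf j 1 + wt j = wt j * Tf j 1 + wt j" by (simp add: add.commute)
  then have "Cf j 1 = wt j * Tf j 1" using wt_finite[of j] by auto
  then have *: "Cf j 1 = xif j 1 * Cf j 1" by (simp add: Tf_eq xif_def mult.assoc)
  have "cn j 0 \<le> Cf j 1" unfolding Cf_def using csum_ge[of "\<lambda>n. cn j n * 1 ^ Suc n" 0] by simp
  then have pos: "Cf j 1 > 0" using cn_0[OF j] wt_pos[OF j] by simp
  have "xif j 1 * Cf j 1 < 1 * Cf j 1"
    using x pos C_fin by (intro ennreal_mult_strict_right_mono) auto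
  then show False using * by simp
qed

text \<open>If the walk enters the branch \<open>j\<close> almost surely, then all excursions into other branches come
  back.\<close>

lemma no_escape_elsewhere:
  assumes j: "j \<in> indices D" and x: "xif j 1 = 1" and G: "Gf j 1 < \<top>" and l: "l \<in> indices D - {j}"
  shows "Hf l 1 = wt l"
proof (rule ccontr)
  assume "Hf l 1 \<noteq> wt l"
  then have "Hf l 1 < wt l" using Hf_le[of l] by simp
  have fin: "Hf k 1 < \<top>" for k using Hf_le[of k] wt_finite[of k] by (rule order.strict_trans1)
  have hr: "enn2real (Hf k 1) \<le> enn2real (wt k)" for k using Hf_le[of k] wt_finite[of k] by (intro enn2real_mono) auto
  have hl: "enn2real (Hf l 1) < enn2real (wt l)"
    using \<open>Hf l 1 < wt l\<close> wt_finite[of l] fin[of l] by (simp add: enn2real_less_iff)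
  have "(\<Sum>k\<in>indices D - {j}. enn2real (Hf k 1)) < (\<Sum>k\<in>indices D - {j}. enn2real (wt k))"
    using l hl hr by (intro sum_strict_mono_ex1) auto
  also have "\<dots> = 1 - weight D j"
  proof -
    have "(\<Sum>k\<in>indices D - {j}. enn2real (wt k)) = (\<Sum>k\<in>indices D - {j}. weight D k)"
      by (intro sum.cong) (auto simp: wt_def weight_pos less_imp_le)
    then show ?thesis using weight_sum j by (simp add: sum_diff1)
  qed
  finally have lt: "(\<Sum>k\<in>indices D - {j}. enn2real (Hf k 1)) < 1 - weight D j" .
  define G' where "G' = enn2real (Gf j 1)"
  have Ge: "Gf j 1 = ennreal G'" using G by (simp add: G'_def)
  have G0: "G' \<ge> 0" by (simp add: G'_def)
  have "(\<Sum>k\<in>indices D - {j}. Hf k 1) = ennreal (\<Sum>k\<in>indices D - {j}. enn2real (Hf k 1))"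
    using fin by (subst sum_ennreal[symmetric]) (auto intro!: sum.cong)
  then have "ennreal G' = ennreal (1 + G' * (\<Sum>k\<in>indices D - {j}. enn2real (Hf k 1)))"
    using Gf_renewal[of j 1] G0 unfolding Ge
    by (simp add: ennreal_mult ennreal_plus sum_nonneg)
  then have G'_eq: "G' = 1 + G' * (\<Sum>k\<in>indices D - {j}. enn2real (Hf k 1))"
    using G0 by (subst (asm) ennreal_inj) (auto simp: sum_nonneg)
  have "ennreal (weight D j * G') = 1" using x j G0 weight_pos[OF j] by (simp add: xif_def wt_def Ge ennreal_mult)
  then have wG: "weight D j * G' = 1" using G0 weight_pos[OF j] by (simp add: ennreal_eq_1)
  then have "G' > 0" using G0 by (cases "G' = 0") auto
  then have "G' * (\<Sum>k\<in>indices D - {j}. enn2real (Hf k 1)) < G' * (1 - weight D j)"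
    using lt by simp
  then show False using G'_eq wG by (simp add: algebra_simps)
qed

text \<open>If one \<open>\<xi>\<^sub>j\<close> were \<open>1\<close>, the two previous lemmas would force \<open>\<xi>\<^sub>l = 1\<close> for another index \<open>l\<close>, and then all
  excursions into every branch would come back: the walk would be recurrent.\<close>

lemma xif_less_1:
  assumes G: "Gf 0 1 < \<top>" and j: "j \<in> indices D"
  shows "xif j 1 < 1"
proof (rule ccontr)
  assume "\<not> xif j 1 < 1"
  then have xj: "xif j 1 = 1" using xif_le_1[of j] by simp
  have fin: "Gf i 1 < \<top>" for i using Gf_mono G by (rule order.strict_trans1)
  have "(if j = 1 then 2 else 1) \<in> indices D - {j}" using nfactors by (auto simp: indices_def)
  then obtain l where l: "l \<in> indices D - {j}" by blast
  have Hl: "Hf k 1 = wt k" if "k \<in> indices D - {j}" for k using no_escape_elsewhere[OF j xj fin that] .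
  then have "\<not> xif l 1 < 1" using return_less_weight[of l] l by auto
  then have "xif l 1 = 1" using xif_le_1[of l] by simp
  then have "Hf j 1 = wt j" using no_escape_elsewhere[of l j] l j fin by auto
  then have "(\<Sum>k\<in>indices D - {0}. Hf k 1) = (\<Sum>k\<in>indices D. wt k)"
    using Hl by (intro sum.cong) auto
  then have "Gf 0 1 = 1 + Gf 0 1" using Gf_renewal[of 0 1] sum_wt by simp
  then show False using G by (cases "Gf 0 1") (auto simp: ennreal_plus[symmetric] ennreal_1[symmetric] simp del: ennreal_plus ennreal_1)
qed

end


section \<open>Entrances into cones\<close>

context free_product
begin

lemma countable_words: "countable (words D)"
proof (rule countable_subset)
  show "words D \<subseteq> lists (\<Union>i\<in>indices D. factor D i)"
    by (auto simp: words_def factor_pos_def)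
  show "countable (lists (\<Union>i\<in>indices D. factor D i))"
    by (intro countable_lists countable_UN countable_finite finite_indices countable_factor)
qed

text \<open>Probability that the walk is at \<open>x\<close> at time \<open>t\<close> and has just entered the cone of \<open>x\<close>. At time \<open>0\<close> the
  walk counts as having entered the cone of the empty word.\<close>

definition ent :: "'a list \<Rightarrow> nat \<Rightarrow> ennreal" where
  "ent x t = (case t of 0 \<Rightarrow> if x = [] then 1 else 0
     | Suc n \<Rightarrow> (\<Sum>\<^sup>+w. if w \<in> Cone x then 0 else taboo P (words D) n [] w * P w x))"

lemma ent_0: "ent x 0 = (if x = [] then 1 else 0)" and
  ent_Suc: "ent x (Suc n) = (\<Sum>\<^sup>+w. if w \<in> Cone x then 0 else taboo P (words D) n [] w * P w x)"
  by (simp_all add: ent_def)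

lemma ent_Nil: "ent [] t = (if t = 0 then 1 else 0)"
proof (cases t)
  case (Suc n)
  have "(if w \<in> words D then 0 else taboo P (words D) n [] w * P w []) = 0" for w
    using P_words[of w "[]"] by auto
  then have "ent [] (Suc n) = 0" unfolding ent_Suc Cone_Nil by (rule csum_zero)
  then show ?thesis using Suc by simp
qed (simp add: ent_0)

lemma last_cone_entrance:
  assumes x: "x \<in> words D" and u: "u \<in> Avoid (ltype x)"
  shows "taboo P (words D) n [] (x @ u) = (\<Sum>t\<le>n. ent x t * taboo P (Avoid (ltype x)) (n - t) [] u)"
proof (cases "x = []")
  case True
  have "(\<Sum>t\<le>n. ent x t * taboo P (Avoid (ltype x)) (n - t) [] u) = (\<Sum>t\<le>n. if t = 0 then taboo P (words D) n [] u else 0)"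
    using True by (intro sum.cong refl) (auto simp: Avoid_0 ent_Nil)
  then show ?thesis using True by simp
next
  case False
  have "taboo P (words D) n [] (x @ u) = (\<Sum>m<n. ent x (Suc m) * taboo P (Cone x) (n - 1 - m) x (x @ u))"
    unfolding ent_Suc
    by (rule last_entrance_point) (use False x u in \<open>auto simp: Cone_append Cone_subset Cone_enter\<close>, auto simp: Cone_def)
  also have "\<dots> = (\<Sum>t\<le>n. ent x t * taboo P (Avoid (ltype x)) (n - t) [] u)"
    using False by (simp add: sum.atMost_shift ent_0 Cone_shift[OF x])
  finally show ?thesis .
qed

text \<open>Decomposition of an entrance into the cone of \<open>x @ [y]\<close> at the last preceding entrance into the cone of
  \<open>x\<close>. Only the type of \<open>x\<close> matters for what happens in between.\<close>

lemma ent_renewal: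
  assumes x: "x \<in> words D" and j: "j \<in> indices D - {ltype x}"
  shows "(\<Sum>\<^sup>+y. if y \<in> Vx j then ent (x @ [y]) (Suc n) else 0) = (\<Sum>t\<le>n. ent x t * Kn (ltype x) j (n - t))"
proof -
  let ?i = "ltype x"
  have emb: "emb D j v \<in> Avoid ?i" if "v \<in> factor D j" for v
    using that j singleton_Branch[of v j] Branch_subset_Avoid[of ?i j] by (auto simp: emb_def Vx_eq)
  have "(\<Sum>\<^sup>+y. if y \<in> Vx j then ent (x @ [y]) (Suc n) else 0) =
    (\<Sum>\<^sup>+y. \<Sum>t\<le>n. ent x t * (if y \<in> Vx j then wt j * (\<Sum>\<^sup>+v. taboo P (Avoid ?i) (n - t) [] (emb D j v) * pf j v y) else 0))"
  proof (rule csum_cong)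
    fix y
    show "(if y \<in> Vx j then ent (x @ [y]) (Suc n) else 0) =
      (\<Sum>t\<le>n. ent x t * (if y \<in> Vx j then wt j * (\<Sum>\<^sup>+v. taboo P (Avoid ?i) (n - t) [] (emb D j v) * pf j v y) else 0))"
    proof (cases "y \<in> Vx j")
      case True
      have xy: "x @ [y] \<in> words D"
        using x emb[of y] in_VxD[OF True] by (simp add: append_word_iff emb_def)
      have "ent (x @ [y]) (Suc n) = wt j * (\<Sum>\<^sup>+v. taboo P (words D) n [] (x @ emb D j v) * pf j v y)"
        unfolding ent_Suc by (rule entry_sum[OF xy True])
      also have "\<dots> = wt j * (\<Sum>\<^sup>+v. \<Sum>t\<le>n. ent x t * (taboo P (Avoid ?i) (n - t) [] (emb D j v) * pf j v y))"
      proof (intro arg_cong[where f = "\<lambda>x. wt j * x"] csum_cong)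
        fix v
        show "taboo P (words D) n [] (x @ emb D j v) * pf j v y =
          (\<Sum>t\<le>n. ent x t * (taboo P (Avoid ?i) (n - t) [] (emb D j v) * pf j v y))"
          using last_cone_entrance[OF x emb]
          by (cases "v \<in> factor D j") (simp_all add: pf_outside sum_distrib_right mult.assoc)
      qed
      also have "\<dots> = (\<Sum>t\<le>n. ent x t * (wt j * (\<Sum>\<^sup>+v. taboo P (Avoid ?i) (n - t) [] (emb D j v) * pf j v y)))"
        by (simp add: csum_sum csum_cmult sum_distrib_left ac_simps)
      finally show ?thesis using True by simp
    qed simp
  qed
  also have "\<dots> = (\<Sum>t\<le>n. ent x t * Kn ?i j (n - t))"
    by (simp add: csum_sum csum_cmult Kn_def)
  finally show ?thesis .
qed

end

section \<open>The law of the walk\<close>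

context free_product_walk
begin

declare [[simproc del: measurable]]

text \<open>The law of the walk restricted to prescribed sets of positions up to time \<open>n\<close>. The sets may depend on
  time, so that the same recursion serves taboo probabilities, first returns and exit events.\<close>

definition path_prob :: "(nat \<Rightarrow> 'a list set) \<Rightarrow> nat \<Rightarrow> 'a list \<Rightarrow> ennreal" where
  "path_prob A n y = emeasure M {\<omega> \<in> space M. (\<forall>k\<le>n. Z k \<omega> \<in> A k) \<and> Z n \<omega> = y}"

lemma Z_words: "\<omega> \<in> space M \<Longrightarrow> Z n \<omega> \<in> words D"
  using measurable_space[OF Z_measurable] by simp

lemma sets_Z: "{\<omega> \<in> space M. Q (Z n \<omega>)} \<in> sets M"
proof -
  have "{\<omega> \<in> space M. Q (Z n \<omega>)} = Z n -` {z \<in> words D. Q z} \<inter> space M"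
    using Z_words by auto
  then show ?thesis using measurable_sets[OF Z_measurable, of "{z \<in> words D. Q z}" n] by simp
qed

lemma sets_Z_le: "{\<omega> \<in> space M. \<forall>k\<le>(n::nat). Q k (Z k \<omega>)} \<in> sets M"
proof -
  have "{\<omega> \<in> space M. \<forall>k\<in>{..n}. Q k (Z k \<omega>)} \<in> sets M"
  proof (rule sets.sets_Collect_finite_All')
    show "{\<omega> \<in> space M. Q i (Z i \<omega>)} \<in> sets M" for i by (rule sets_Z[of "Q i" i])
  qed simp_all
  then show ?thesis by (simp only: Ball_def atMost_iff)
qed

lemma cylinder:
  "emeasure M {\<omega> \<in> space M. \<forall>k\<le>n. Z k \<omega> = x k} = ennreal ((if x 0 = [] then 1 else 0) * (\<Prod>k<n. trans_prob D (x k) (x (Suc k))))"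
  by (simp only: emeasure_eq_measure Z_law)

text \<open>The law of the walk is given only on cylinders that fix every position. The Markov property for
  prescribed sets follows by summing over the countably many trajectories.\<close>

lemma markov:
  "emeasure M {\<omega> \<in> space M. (\<forall>k\<le>n. Z k \<omega> \<in> A k) \<and> Z n \<omega> = w \<and> Z (Suc n) \<omega> = y} = path_prob A n w * P w y"
proof -
  define X where "X = {xs \<in> lists (words D). length xs = Suc n \<and> (\<forall>k\<le>n. xs ! k \<in> A k) \<and> xs ! n = w}"
  define E where "E xs = {\<omega> \<in> space M. \<forall>k\<le>n. Z k \<omega> = xs ! k}" for xs
  define E' where "E' xs = {\<omega> \<in> space M. \<forall>k\<le>Suc n. Z k \<omega> = (xs @ [y]) ! k}" for xs
  have cX: "countable X" unfolding X_def
    by (rule countable_subset[OF _ countable_lists[OF countable_words]]) auto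
  have nthX: "(xs @ [y]) ! k = (if k \<le> n then xs ! k else y)" if "xs \<in> X" "k \<le> Suc n" for xs k
    using that by (auto simp: X_def nth_append)
  have sE: "E xs \<in> sets M" and sE': "E' xs \<in> sets M" for xs
    unfolding E_def E'_def by (rule sets_Z_le)+
  have disj: "disjoint_family_on E X"
    unfolding disjoint_family_on_def
  proof (intro ballI impI)
    fix xs ys assume "xs \<in> X" "ys \<in> X" "xs \<noteq> ys"
    moreover from this have "length xs = Suc n" "length ys = Suc n" by (auto simp: X_def)
    ultimately obtain k where "k \<le> n" "xs ! k \<noteq> ys ! k"
      using nth_equalityI[of xs ys] less_Suc_eq_le by auto
    then show "E xs \<inter> E ys = {}" unfolding E_def by force
  qed
  have E'_sub: "E' xs \<subseteq> E xs" if "xs \<in> X" for xs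
    unfolding E_def E'_def using nthX[OF that] by auto
  have disj': "disjoint_family_on E' X"
    using disj E'_sub unfolding disjoint_family_on_def by blast
  have mem: "map (\<lambda>k. Z k \<omega>) [0..<Suc n] \<in> X"
    if "\<omega> \<in> space M" "\<forall>k\<le>n. Z k \<omega> \<in> A k" "Z n \<omega> = w" for \<omega>
    using that Z_words by (auto simp: X_def simp del: upt_Suc)
  have nmap: "map (\<lambda>k. Z k \<omega>) [0..<Suc n] ! k = Z k \<omega>" if "k \<le> n" for k \<omega>
    using that by (simp del: upt_Suc)
  have U: "{\<omega> \<in> space M. (\<forall>k\<le>n. Z k \<omega> \<in> A k) \<and> Z n \<omega> = w} = \<Union> (E ` X)"
  proof (intro set_eqI iffI)
    fix \<omega> assume *: "\<omega> \<in> {\<omega> \<in> space M. (\<forall>k\<le>n. Z k \<omega> \<in> A k) \<and> Z n \<omega> = w}"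
    then have "\<omega> \<in> E (map (\<lambda>k. Z k \<omega>) [0..<Suc n])" unfolding E_def using nmap by auto
    then show "\<omega> \<in> \<Union> (E ` X)" using mem * by blast
  qed (auto simp: E_def X_def)
  have U': "{\<omega> \<in> space M. (\<forall>k\<le>n. Z k \<omega> \<in> A k) \<and> Z n \<omega> = w \<and> Z (Suc n) \<omega> = y} = \<Union> (E' ` X)"
  proof (intro set_eqI iffI)
    fix \<omega> assume *: "\<omega> \<in> {\<omega> \<in> space M. (\<forall>k\<le>n. Z k \<omega> \<in> A k) \<and> Z n \<omega> = w \<and> Z (Suc n) \<omega> = y}"
    then have m: "map (\<lambda>k. Z k \<omega>) [0..<Suc n] \<in> X" using mem by blast
    have "\<omega> \<in> E' (map (\<lambda>k. Z k \<omega>) [0..<Suc n])" unfolding E'_def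
      using * nthX[OF m] nmap[of _ \<omega>] by (auto simp: le_Suc_eq)
    then show "\<omega> \<in> \<Union> (E' ` X)" using m by blast
  next
    fix \<omega> assume "\<omega> \<in> \<Union> (E' ` X)"
    then obtain xs where xs: "xs \<in> X" "\<omega> \<in> E' xs" by blast
    have "\<omega> \<in> E xs" using E'_sub[OF xs(1)] xs(2) by blast
    moreover have "Z (Suc n) \<omega> = (xs @ [y]) ! Suc n" using xs(2) unfolding E'_def by blast
    then have "Z (Suc n) \<omega> = y" using nthX[OF xs(1), of "Suc n"] by simp
    ultimately    show "\<omega> \<in> {\<omega> \<in> space M. (\<forall>k\<le>n. Z k \<omega> \<in> A k) \<and> Z n \<omega> = w \<and> Z (Suc n) \<omega> = y}"
      using U xs(1) by blast
  qed
  have EE': "emeasure M (E' xs) = emeasure M (E xs) * P w y" if xs: "xs \<in> X" for xs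
  proof -
    let ?x = "\<lambda>k. (xs @ [y]) ! k"
    have "emeasure M (E' xs) = ennreal ((if ?x 0 = [] then 1 else 0) * (\<Prod>k<Suc n. trans_prob D (?x k) (?x (Suc k))))"
      unfolding E'_def by (rule cylinder)
    also have "(\<Prod>k<Suc n. trans_prob D (?x k) (?x (Suc k))) = (\<Prod>k<n. trans_prob D (xs ! k) (xs ! Suc k)) * trans_prob D w y"
      using nthX[OF xs] xs by (simp add: X_def)
    also have "?x 0 = xs ! 0" using nthX[OF xs] by simp
    also have "ennreal ((if xs ! 0 = [] then 1 else 0) * ((\<Prod>k<n. trans_prob D (xs ! k) (xs ! Suc k)) * trans_prob D w y)) =
        ennreal ((if xs ! 0 = [] then 1 else 0) * (\<Prod>k<n. trans_prob D (xs ! k) (xs ! Suc k))) * P w y"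
    proof -
      show ?thesis unfolding P_def mult.assoc[symmetric]
        by (subst ennreal_mult) (auto intro!: mult_nonneg_nonneg prod_nonneg trans_prob_nonneg)
    qed
    finally show ?thesis unfolding E_def cylinder .
  qed
  have "emeasure M (\<Union> (E' ` X)) = (\<integral>\<^sup>+xs. emeasure M (E' xs) \<partial>count_space X)"
    by (rule emeasure_UN_countable[OF sE' cX disj'])
  also have "\<dots> = (\<integral>\<^sup>+xs. emeasure M (E xs) * P w y \<partial>count_space X)"
    by (rule nn_integral_cong) (simp add: EE')
  also have "\<dots> = (\<integral>\<^sup>+xs. emeasure M (E xs) \<partial>count_space X) * P w y"
    by (rule nn_integral_multc) simp
  also have "(\<integral>\<^sup>+xs. emeasure M (E xs) \<partial>count_space X) = emeasure M (\<Union> (E ` X))"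
    by (rule emeasure_UN_countable[OF sE cX disj, symmetric])
  finally show ?thesis unfolding U' path_prob_def U .
qed

lemma sets_mu: "{\<omega> \<in> space M. (\<forall>k\<le>n. Z k \<omega> \<in> A k) \<and> Z n \<omega> = y} \<in> sets M"
proof -
  have "{\<omega> \<in> space M. (\<forall>k\<le>n. Z k \<omega> \<in> A k) \<and> Z n \<omega> = y} =
    {\<omega> \<in> space M. \<forall>k\<le>n. Z k \<omega> \<in> A k} \<inter> {\<omega> \<in> space M. Z n \<omega> = y}" by blast
  then show ?thesis using sets_Z_le[of n "\<lambda>k z. z \<in> A k"] sets_Z[of "\<lambda>z. z = y" n] by (simp add: sets.Int)
qed

lemma emeasure_split_Z:
  assumes "\<And>w. {\<omega> \<in> space M. Q \<omega> \<and> Z n \<omega> = w} \<in> sets M"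
  shows "emeasure M {\<omega> \<in> space M. Q \<omega>} = (\<Sum>\<^sup>+w. emeasure M {\<omega> \<in> space M. Q \<omega> \<and> Z n \<omega> = w})"
proof -
  let ?E = "\<lambda>w. {\<omega> \<in> space M. Q \<omega> \<and> Z n \<omega> = w}"
  have "{\<omega> \<in> space M. Q \<omega>} = \<Union> (?E ` words D)" using Z_words by auto
  then have "emeasure M {\<omega> \<in> space M. Q \<omega>} = (\<integral>\<^sup>+w. emeasure M (?E w) \<partial>count_space (words D))"
    using emeasure_UN_countable[of "words D" ?E M] assms countable_words by (simp add: disjoint_family_on_def) blast
  also have "\<dots> = (\<Sum>\<^sup>+w. emeasure M (?E w))"
  proof -
    have "emeasure M (?E w) = 0" if "w \<notin> words D" for w
    proof -
      have "?E w = {}" using that Z_words by auto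
      then show ?thesis by (simp only: emeasure_empty)
    qed
    then show ?thesis unfolding csum_def by (intro nn_integral_count_space_eq) auto
  qed
  finally show ?thesis .
qed

lemma path_prob_0: "path_prob A 0 y = (if y = [] \<and> [] \<in> A 0 then 1 else 0)"
proof -
  have "{\<omega> \<in> space M. (\<forall>k\<le>0. Z k \<omega> \<in> A k) \<and> Z 0 \<omega> = y} =
    (if y \<in> A 0 then {\<omega> \<in> space M. \<forall>k\<le>0. Z k \<omega> = (\<lambda>_. y) k} else {})" by auto
  then show ?thesis unfolding path_prob_def using cylinder[of 0 "\<lambda>_. y"] by auto
qed

lemma path_prob_Suc: "path_prob A (Suc n) y = (if y \<in> A (Suc n) then (\<Sum>\<^sup>+w. path_prob A n w * P w y) else 0)"
proof (cases "y \<in> A (Suc n)")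
  case True
  have "{\<omega> \<in> space M. (\<forall>k\<le>Suc n. Z k \<omega> \<in> A k) \<and> Z (Suc n) \<omega> = y} =
    {\<omega> \<in> space M. (\<forall>k\<le>n. Z k \<omega> \<in> A k) \<and> Z (Suc n) \<omega> = y}"
    using True by (auto simp: le_Suc_eq)
  then have "path_prob A (Suc n) y = emeasure M {\<omega> \<in> space M. (\<forall>k\<le>n. Z k \<omega> \<in> A k) \<and> Z (Suc n) \<omega> = y}"
    by (simp add: path_prob_def)
  also have "\<dots> = (\<Sum>\<^sup>+w. emeasure M {\<omega> \<in> space M. ((\<forall>k\<le>n. Z k \<omega> \<in> A k) \<and> Z (Suc n) \<omega> = y) \<and> Z n \<omega> = w})"
  proof (rule emeasure_split_Z)
    fix w
    have "{\<omega> \<in> space M. ((\<forall>k\<le>n. Z k \<omega> \<in> A k) \<and> Z (Suc n) \<omega> = y) \<and> Z n \<omega> = w} =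
      {\<omega> \<in> space M. (\<forall>k\<le>n. Z k \<omega> \<in> A k) \<and> Z n \<omega> = w} \<inter> {\<omega> \<in> space M. Z (Suc n) \<omega> = y}" by blast
    then show "{\<omega> \<in> space M. ((\<forall>k\<le>n. Z k \<omega> \<in> A k) \<and> Z (Suc n) \<omega> = y) \<and> Z n \<omega> = w} \<in> sets M"
      using sets_mu[of n A w] sets_Z[of "\<lambda>z. z = y" "Suc n"] by (simp add: sets.Int)
  qed
  also have "\<dots> = (\<Sum>\<^sup>+w. path_prob A n w * P w y)"
  proof (rule csum_cong)
    fix w
    have "{\<omega> \<in> space M. ((\<forall>k\<le>n. Z k \<omega> \<in> A k) \<and> Z (Suc n) \<omega> = y) \<and> Z n \<omega> = w} =
      {\<omega> \<in> space M. (\<forall>k\<le>n. Z k \<omega> \<in> A k) \<and> Z n \<omega> = w \<and> Z (Suc n) \<omega> = y}" by blast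
    then show "emeasure M {\<omega> \<in> space M. ((\<forall>k\<le>n. Z k \<omega> \<in> A k) \<and> Z (Suc n) \<omega> = y) \<and> Z n \<omega> = w} = path_prob A n w * P w y"
      by (simp only: markov)
  qed
  finally show ?thesis using True by simp
next
  case False
  then have "{\<omega> \<in> space M. (\<forall>k\<le>Suc n. Z k \<omega> \<in> A k) \<and> Z (Suc n) \<omega> = y} = {}" by auto
  then show ?thesis using False unfolding path_prob_def by (simp only: emeasure_empty if_False)
qed

lemma path_prob_taboo: "[] \<in> B \<Longrightarrow> path_prob (\<lambda>_. B) n y = taboo P B n [] y"
  by (induction n arbitrary: y) (auto simp: path_prob_0 path_prob_Suc)

lemma path_prob_taboo_last:
  assumes "\<And>k. k < n \<Longrightarrow> A k = words D"
  shows "path_prob A n y = (if y \<in> A n then taboo P (words D) n [] y else 0)"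
  using assms
proof (induction n arbitrary: y)
  case (Suc n)
  have "path_prob A n w = taboo P (words D) n [] w" for w
    using Suc.IH[of w] Suc.prems[of n] Suc.prems taboo_outside[of w "words D" "[]" P n] by (cases "w = []") auto
  moreover have "(\<Sum>\<^sup>+w. taboo P (words D) n [] w * P w y) = 0" if "y \<notin> words D"
    using that P_words[of _ y] by (intro csum_zero) auto
  ultimately show ?case by (auto simp: path_prob_Suc)
qed (auto simp: path_prob_0)

text \<open>The cone of \<open>x\<close> is entered at time \<open>m\<close> and never left again. Up to null sets, \<open>m\<close> is then the exit time
  with respect to the length of \<open>x\<close>.\<close>

definition exit_event :: "'a list \<Rightarrow> nat \<Rightarrow> 'w set" where
  "exit_event x m = {\<omega> \<in> space M. Z m \<omega> = x \<and> Z (m - 1) \<omega> \<notin> Cone x \<and> (\<forall>n\<ge>m. Z n \<omega> \<in> Cone x)}"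

text \<open>After the entrance at time \<open>m\<close> the walk in the cone is a copy of the walk in \<open>Avoid\<close> of the type of
  \<open>x\<close>.\<close>

lemma exit_event_finite:
  assumes x: "x \<in> words D" and m: "m > 0"
  shows "emeasure M {\<omega> \<in> space M. Z m \<omega> = x \<and> Z (m - 1) \<omega> \<notin> Cone x \<and> (\<forall>n\<in>{m..m+N}. Z n \<omega> \<in> Cone x)} =
    ent x m * csum (taboo P (Avoid (ltype x)) N [])"
proof -
  define A where "A k = (if k < m - 1 then words D else if k = m - 1 then - Cone x else if k = m then {x} else Cone x)" for k
  have xc: "x \<in> Cone x" using x by (simp add: Cone_def)
  obtain m' where m': "m = Suc m'" using m by (cases m) auto
  have "path_prob A m' y = (if y \<in> A m' then taboo P (words D) m' [] y else 0)" for y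
    by (rule path_prob_taboo_last) (simp add: A_def m')
  then have "path_prob A m' y = (if y \<in> Cone x then 0 else taboo P (words D) m' [] y)" for y
    by (simp add: A_def m')
  then have mm: "path_prob A m y = (if y = x then ent x m else 0)" for y
    by (auto simp: m' path_prob_Suc ent_Suc A_def intro!: csum_cong)
  have muN: "path_prob A (m + N) y = ent x m * taboo P (Cone x) N x y" for y
  proof (induction N arbitrary: y)
    case (Suc N)
    have "A (Suc (m + N)) = Cone x" by (auto simp: A_def m')
    then show ?case by (simp add: path_prob_Suc Suc.IH csum_cmult[symmetric] mult.assoc)
  qed (auto simp: mm)
  \<comment> \<open>the position at time \<open>m\<close> determines the entrance, the positions after it only have to stay in the cone\<close>
  have eq: "{\<omega> \<in> space M. Z m \<omega> = x \<and> Z (m - 1) \<omega> \<notin> Cone x \<and> (\<forall>n\<in>{m..m+N}. Z n \<omega> \<in> Cone x)} =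
    {\<omega> \<in> space M. \<forall>k\<le>m + N. Z k \<omega> \<in> A k}" (is "?L = ?R")
  proof (intro set_eqI iffI)
    fix \<omega> assume w: "\<omega> \<in> ?L"
    then show "\<omega> \<in> ?R" using Z_words[of \<omega>] by (auto simp: A_def)
  next
    fix \<omega> assume w: "\<omega> \<in> ?R"
    then have *: "\<And>k. k \<le> m + N \<Longrightarrow> Z k \<omega> \<in> A k" "\<omega> \<in> space M" by auto
    have "Z m \<omega> = x" using *(1)[of m] by (auto simp: A_def m' split: if_splits)
    moreover have "Z (m - 1) \<omega> \<notin> Cone x" using *(1)[of "m - 1"] by (simp add: A_def)
    moreover have "Z n \<omega> \<in> Cone x" if "n \<in> {m..m+N}" for n
      using *(1)[of n] that xc m by (auto simp: A_def split: if_splits)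
    ultimately show "\<omega> \<in> ?L" using *(2) by blast
  qed
  have "emeasure M {\<omega> \<in> space M. \<forall>k\<le>m + N. Z k \<omega> \<in> A k} = (\<Sum>\<^sup>+y. path_prob A (m + N) y)"
    unfolding path_prob_def by (rule emeasure_split_Z) (rule sets_mu)
  then show ?thesis unfolding eq muN csum_cmult by (simp add: Cone_shift_mass[OF x])
qed

end


section \<open>Exit events and first returns\<close>

context free_product
begin

definition xir :: "nat \<Rightarrow> real \<Rightarrow> real" where
  "xir i z = enn2real (xif i (ennreal z))"

text \<open>The probability \<open>1 - \<xi>\<^sub>i\<close> that the walk never leaves a cone of type \<open>i\<close>. For \<open>i = 0\<close> it is \<open>1\<close>.\<close>

definition stay :: "nat \<Rightarrow> real" where
  "stay i = 1 - xir i 1"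

lemma xif_1_finite: "xif i 1 < \<top>"
  using xif_le_1[of i] by (metis ennreal_one_less_top order.strict_trans1)

lemma Avoid_mass_limit: "(\<lambda>N. csum (taboo P (Avoid i) N [])) \<longlonglongrightarrow> ennreal (stay i)"
proof -
  define r where "r N = enn2real (wt i * (\<Sum>n<N. gn i n))" for N
  define s where "s N = enn2real (csum (taboo P (Avoid i) N []))" for N
  have le: "csum (taboo P (Avoid i) N []) \<le> 1" "wt i * (\<Sum>n<N. gn i n) \<le> 1" for N
    unfolding Avoid_mass_sum[of i N, symmetric] by simp_all
  have fin: "csum (taboo P (Avoid i) N []) < \<top>" "wt i * (\<Sum>n<N. gn i n) < \<top>" for N
    using le[of N] by (metis ennreal_one_less_top order.strict_trans1)+
  have s: "s N = 1 - r N" for N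
  proof -
    have "s N + r N = enn2real (csum (taboo P (Avoid i) N []) + wt i * (\<Sum>n<N. gn i n))"
      unfolding s_def r_def using fin[of N] by (simp add: enn2real_plus)
    then show ?thesis unfolding Avoid_mass_sum by simp
  qed
  have "(\<lambda>N. wt i * (\<Sum>n<N. gn i n)) \<longlonglongrightarrow> xif i 1"
  proof -
    have "(\<lambda>N. \<Sum>n<N. gn i n) \<longlonglongrightarrow> Gf i 1"
      unfolding Gf_def csum_nat using summable_LIMSEQ[of "gn i"] by (simp add: summableI)
    then show ?thesis unfolding xif_def using wt_finite[of i] by (simp add: ennreal_tendsto_cmult)
  qed
  then have "r \<longlonglongrightarrow> enn2real (xif i 1)"
    unfolding r_def using xif_1_finite[of i] by (intro tendsto_enn2real) auto
  then have "s \<longlonglongrightarrow> stay i"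
    unfolding s[abs_def] stay_def xir_def ennreal_1 by (intro tendsto_intros)
  then have "(\<lambda>N. ennreal (s N)) \<longlonglongrightarrow> ennreal (stay i)" by (rule tendsto_ennrealI)
  then show ?thesis using fin by (simp add: s_def)
qed

lemma P_Nil: "P [] y \<noteq> 0 \<Longrightarrow> \<exists>v k. y = [v] \<and> v \<in> Vx k"
proof (elim P_nonzero)
  fix i z v w assume *: "i \<in> indices D" "w \<in> factor D i" "v \<noteq> w" "[] = z @ emb D i v" "y = z @ emb D i w"
  then have "v = root D i" "y = emb D i w" by (auto simp: emb_def split: if_splits)
  then have "y = [w]" "w \<in> Vx i" using * by (auto simp: emb_def Vx_eq)
  then show "\<exists>v k. y = [v] \<and> v \<in> Vx k" by blast
qed

lemma P_within_factor:
  assumes y: "y \<in> Vx j" and s: "s \<in> factor D j"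
  shows "P (emb D j s) (emb D j y) = wt j * pf j s y"
proof -
  have j: "j \<in> indices D" and ye: "emb D j y = [y]" using in_VxD[OF y] by (auto simp: emb_def)
  show ?thesis
  proof (cases "s = y")
    case True
    have "P [y] [y] = 0"
    proof (rule ccontr)
      assume "P [y] [y] \<noteq> 0"
      then obtain i z v w where "v \<noteq> w" "[y] = z @ emb D i v" "[y] = z @ emb D i w" by (rule P_nonzero)
      then show False using emb_inj[of i v w] by auto
    qed
    then show ?thesis using True j ye by simp
  next
    case False
    then have nc: "emb D j s \<notin> Cone [y]" by (auto simp: Cone_def emb_def)
    have "P (emb D j s) [y] = (\<Sum>\<^sup>+w. if w \<in> Cone [y] then 0 else (if w = emb D j s then 1 else 0) * P w [y])"
      using nc by (subst csum_single[of "emb D j s"]) auto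
    also have "\<dots> = wt j * (\<Sum>\<^sup>+v. (if emb D j v = emb D j s then 1 else 0) * pf j v y)"
      using entry_sum[of "[]" y j "\<lambda>w. if w = emb D j s then 1 else 0"] y
        singleton_words[of y] by (simp only: append_Nil) blast
    also have "\<dots> = wt j * pf j s y"
      using emb_inj[of j _ s] by (subst csum_single[of s]) auto
    finally show ?thesis by (simp add: ye)
  qed
qed

end

context free_product_walk
begin

lemma exit_event_sets: "exit_event x m \<in> sets M"
proof -
  have 1: "{\<omega> \<in> space M. \<forall>n. n \<ge> m \<longrightarrow> Z n \<omega> \<in> Cone x} \<in> sets M"
  proof (rule sets.sets_Collect_countable_All)
    fix n show "{\<omega> \<in> space M. n \<ge> m \<longrightarrow> Z n \<omega> \<in> Cone x} \<in> sets M" by (rule sets_Z[of "\<lambda>z. n \<ge> m \<longrightarrow> z \<in> Cone x" n])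
  qed
  have "exit_event x m = {\<omega> \<in> space M. Z m \<omega> = x} \<inter> {\<omega> \<in> space M. Z (m - 1) \<omega> \<notin> Cone x} \<inter> {\<omega> \<in> space M. \<forall>n. n \<ge> m \<longrightarrow> Z n \<omega> \<in> Cone x}"
    unfolding exit_event_def by blast
  then show ?thesis using 1 sets_Z[of "\<lambda>z. z = x" m] sets_Z[of "\<lambda>z. z \<notin> Cone x" "m - 1"]
    by (simp only: sets.Int)
qed

lemma emeasure_exit_event:
  assumes x: "x \<in> words D" and m: "m > 0"
  shows "emeasure M (exit_event x m) = ent x m * ennreal (stay (ltype x))"
proof -
  define E where "E N = {\<omega> \<in> space M. Z m \<omega> = x \<and> Z (m - 1) \<omega> \<notin> Cone x \<and> (\<forall>n\<in>{m..m+N}. Z n \<omega> \<in> Cone x)}" for N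
  have em: "emeasure M (E N) = ent x m * csum (taboo P (Avoid (ltype x)) N [])" for N
    unfolding E_def by (rule exit_event_finite[OF x m])
  have sE: "E N \<in> sets M" for N
  proof -
    have "E N = {\<omega> \<in> space M. \<forall>k\<le>m + N. (k = m \<longrightarrow> Z k \<omega> = x) \<and> (k = m - 1 \<longrightarrow> Z k \<omega> \<notin> Cone x) \<and> (m \<le> k \<longrightarrow> Z k \<omega> \<in> Cone x)}"
      (is "_ = ?R")
    proof (intro set_eqI iffI)
      fix \<omega> assume "\<omega> \<in> ?R"
      then have *: "\<And>k. k \<le> m + N \<Longrightarrow> (k = m \<longrightarrow> Z k \<omega> = x) \<and> (k = m - 1 \<longrightarrow> Z k \<omega> \<notin> Cone x) \<and> (m \<le> k \<longrightarrow> Z k \<omega> \<in> Cone x)"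
        and sp: "\<omega> \<in> space M" by blast+
      have "Z m \<omega> = x" using *(1)[of m] by simp
      moreover have "Z (m - 1) \<omega> \<notin> Cone x" using *(1)[of "m - 1"] by simp
      moreover have "\<forall>n\<in>{m..m+N}. Z n \<omega> \<in> Cone x" using *(1) by simp
      ultimately show "\<omega> \<in> E N" using sp unfolding E_def by blast
    qed (auto simp: E_def)
    then show ?thesis
      using sets_Z_le[of "m + N" "\<lambda>k z. (k = m \<longrightarrow> z = x) \<and> (k = m - 1 \<longrightarrow> z \<notin> Cone x) \<and> (m \<le> k \<longrightarrow> z \<in> Cone x)"] by simp
  qed
  have dec: "decseq E" unfolding decseq_def E_def by auto
  have "(\<Inter>N. E N) = exit_event x m"
  proof (intro set_eqI iffI)
    fix \<omega> assume w: "\<omega> \<in> (\<Inter>N. E N)"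
    then have *: "\<omega> \<in> E N" for N by blast
    have "Z n \<omega> \<in> Cone x" if "n \<ge> m" for n using *[of "n - m"] that by (auto simp: E_def)
    then show "\<omega> \<in> exit_event x m" using *[of 0] by (auto simp: E_def exit_event_def)
  qed (auto simp: E_def exit_event_def)
  then have lim1: "(\<lambda>N. emeasure M (E N)) \<longlonglongrightarrow> emeasure M (exit_event x m)"
    using Lim_emeasure_decseq[of E M] sE dec by (auto simp: emeasure_eq_measure)
  have "ent x m * 1 = emeasure M (E 0)" unfolding em using Avoid_mass_sum[of "ltype x" 0] by simp
  also have "\<dots> < \<top>" by (simp add: emeasure_eq_measure)
  finally have "ent x m < \<top>" by simp
  then have "(\<lambda>N. emeasure M (E N)) \<longlonglongrightarrow> ent x m * ennreal (stay (ltype x))"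
    unfolding em using Avoid_mass_limit by (intro ennreal_tendsto_cmult) auto
  then show ?thesis using lim1 LIMSEQ_unique by blast
qed

text \<open>Forbidding the single letters of \<open>V\<^sub>i\<^sup>\<times>\<close> is the same as forbidding all words that start with them.\<close>

lemma avoid_prob_eq:
  assumes i: "i \<in> indices D"
  shows "ennreal (avoid_prob D M Z i n y) = taboo P (Avoid i) n [] y"
proof -
  let ?B = "- emb D i ` factor_pos D i"
  have Vi: "factor_pos D i = Vx i" using i by (simp add: Vx_def)
  have "ennreal (avoid_prob D M Z i n y) = path_prob (\<lambda>_. ?B) n y"
    by (simp add: avoid_prob_def path_prob_def emeasure_eq_measure)
  also have "\<dots> = taboo P ?B n [] y"
    by (rule path_prob_taboo) (auto simp: emb_def factor_pos_def split: if_splits)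
  also have "\<dots> = taboo P (Avoid i) n [] y"
  proof (rule taboo_closed)
    show "Avoid i \<subseteq> ?B"
    proof
      fix u assume u: "u \<in> Avoid i"
      show "u \<in> ?B"
      proof
        assume "u \<in> emb D i ` factor_pos D i"
        then obtain v where "v \<in> Vx i" "u = [v]" using in_VxD unfolding Vi by (fastforce simp: emb_def)
        then show False using u by (simp add: Avoid_def)
      qed
    qed
    fix w y assume w: "w \<in> Avoid i" and y: "y \<in> ?B" "y \<notin> Avoid i"
    show "P w y = 0"
    proof (cases "w = []")
      case True
      show ?thesis
      proof (rule ccontr)
        assume "P w y \<noteq> 0"
        then obtain v k where v: "y = [v]" "v \<in> Vx k" using P_Nil True by blast
        then have "v \<in> Vx i" using y(2) by (auto simp: Avoid_def singleton_words)
        then have "y = emb D i v" using v in_VxD by (auto simp: emb_def)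
        then show False using y(1) \<open>v \<in> Vx i\<close> unfolding Vi by blast
      qed
    next
      case False
      then show ?thesis using Avoid_exit[OF w] y by simp
    qed
  qed simp
  finally show ?thesis .
qed

lemma return_time_eq: "return_time Z \<omega> = enat (Suc n) \<longleftrightarrow> Z (Suc n) \<omega> = [] \<and> (\<forall>k\<in>{1..n}. Z k \<omega> \<noteq> [])"
proof -
  let ?S = "{k. k > 0 \<and> Z k \<omega> = []}"
  have S: "{enat k |k. k > 0 \<and> Z k \<omega> = []} = enat ` ?S" by auto
  show ?thesis
  proof (cases "?S = {}")
    case True
    then have "return_time Z \<omega> = \<infinity>" unfolding return_time_def S by (simp add: Inf_enat_def)
    then show ?thesis using True by auto
  next
    case False
    then obtain k0 where k0: "k0 \<in> ?S" by blast
    define L where "L = (LEAST k. k \<in> ?S)"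
    have L: "L \<in> ?S" "\<And>k. k \<in> ?S \<Longrightarrow> L \<le> k" unfolding L_def using LeastI[of "\<lambda>k. k \<in> ?S", OF k0] Least_le[of "\<lambda>k. k \<in> ?S"] by blast+
    have "return_time Z \<omega> = enat L"
      unfolding return_time_def S
    proof (rule antisym)
      show "Inf (enat ` ?S) \<le> enat L" using L(1) by (rule INF_lower)
      show "enat L \<le> Inf (enat ` ?S)" using L(2) by (intro INF_greatest) simp
    qed
    moreover have "L = Suc n \<longleftrightarrow> Z (Suc n) \<omega> = [] \<and> (\<forall>k\<in>{1..n}. Z k \<omega> \<noteq> [])"
    proof
      assume "L = Suc n"
      moreover have "k \<notin> ?S" if "k \<in> {1..n}" for k
        using L(2)[of k] that \<open>L = Suc n\<close> by (meson Suc_n_not_le_n atLeastAtMost_iff order_trans)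
      ultimately show "Z (Suc n) \<omega> = [] \<and> (\<forall>k\<in>{1..n}. Z k \<omega> \<noteq> [])" using L(1) by auto
    next
      assume R: "Z (Suc n) \<omega> = [] \<and> (\<forall>k\<in>{1..n}. Z k \<omega> \<noteq> [])"
      then have "L \<le> Suc n" by (intro L(2)) simp
      moreover have "\<not> L \<le> n" using R L(1) by auto
      ultimately show "L = Suc n" by simp
    qed
    ultimately show ?thesis by simp
  qed
qed

text \<open>Before it returns, the walk stays in the branch that it chose with its first step.\<close>

lemma first_return_prob:
  assumes i: "i \<in> indices D"
  shows "ennreal (measure M {\<omega> \<in> space M. return_time Z \<omega> = enat (n + 2) \<and> Z 1 \<omega> \<notin> emb D i ` factor D i}) =
    (\<Sum>l\<in>indices D - {i}. hn l (Suc n))"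
proof -
  let ?I = "indices D - {i}"
  define A where "A k = (if k = 0 then UNIV else if k = 1 then - (emb D i ` factor D i) else if k \<le> Suc n then - {[]} else UNIV)" for k
  have mu1: "path_prob A (Suc 0) y = (\<Sum>l\<in>?I. taboo P (Branch l) (Suc 0) [] y)" for y
  proof -
    have "(\<Sum>\<^sup>+w. path_prob A 0 w * P w y) = P [] y" by (subst csum_single[of "[]"]) (auto simp: path_prob_0 A_def)
    moreover have "taboo P (Branch l) (Suc 0) [] y = (if y \<in> Branch l then P [] y else 0)" for l
      by (simp add: csum_single[of "[]"])
    moreover have "(if y \<in> A 1 then P [] y else 0) = (\<Sum>l\<in>?I. if y \<in> Branch l then P [] y else 0)"
    proof (cases "P [] y = 0")
      case True
      then show ?thesis by (simp only: if_cancel sum.neutral_const)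
    next
      case False
      then obtain v k where v: "y = [v]" "v \<in> Vx k" using P_Nil by blast
      have Dl: "y \<in> Branch l \<longleftrightarrow> l = k" for l using v singleton_Branch Branch_disjoint by blast
      have ki: "k \<in> indices D" "v \<noteq> root D k" using in_VxD[OF v(2)] by auto
      have A1: "y \<in> A 1 \<longleftrightarrow> k \<noteq> i"
      proof
        assume "y \<in> A 1"
        then show "k \<noteq> i" using v in_VxD[OF v(2)] by (auto simp: A_def emb_def)
      next
        assume "k \<noteq> i"
        then have "v \<notin> factor D i" using Vx_disjoint[OF v(2) i] by blast
        then show "y \<in> A 1" using v by (auto simp: A_def emb_def split: if_splits)
      qed
      show ?thesis unfolding A1 Dl using ki by simp
    qed
    ultimately show ?thesis by (simp only: path_prob_Suc One_nat_def)
  qed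
  have mum: "path_prob A (Suc m) y = (\<Sum>l\<in>?I. taboo P (Branch l) (Suc m) [] y)" if "m \<le> n" for m y
    using that
  proof (induction m arbitrary: y)
    case (Suc m)
    have *: "(\<Sum>\<^sup>+w. path_prob A (Suc m) w * P w y) = (\<Sum>l\<in>?I. \<Sum>\<^sup>+w. taboo P (Branch l) (Suc m) [] w * P w y)"
      using Suc by (simp add: sum_distrib_right csum_sum del: taboo.simps)
    show ?case
    proof (cases "y = []")
      case True
      have "y \<notin> A (Suc (Suc m))" using True Suc.prems by (simp add: A_def)
      then show ?thesis using True by (simp add: path_prob_Suc[of A "Suc m"] taboo_Suc_outside del: taboo.simps(2))
    next
      case False
      have "y \<in> A (Suc (Suc m))" using False by (simp add: A_def)
      moreover have "(\<Sum>\<^sup>+w. taboo P (Branch l) (Suc m) [] w * P w y) = taboo P (Branch l) (Suc (Suc m)) [] y" for l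
      proof (cases "y \<in> Branch l")
        case True
        then show ?thesis by (simp only: taboo.simps(2)[of P "Branch l" "Suc m"] if_True)
      next
        case nD: False
        have "taboo P (Branch l) (Suc m) [] w * P w y = 0" for w
          using Branch_exit[of w l y] nD False taboo_Suc_outside[of w "Branch l" "Suc m" P "[]"]
          by (cases "w \<in> Branch l") (auto simp del: taboo.simps)
        then show ?thesis using nD by (simp only: csum_0 taboo.simps(2)[of P "Branch l" "Suc m"] if_False)
      qed
      ultimately show ?thesis unfolding path_prob_Suc[of A "Suc m"] * by (simp del: taboo.simps)
    qed
  qed (use mu1 in simp)
  have "{\<omega> \<in> space M. return_time Z \<omega> = enat (n + 2) \<and> Z 1 \<omega> \<notin> emb D i ` factor D i} =
    {\<omega> \<in> space M. (\<forall>k\<le>Suc (Suc n). Z k \<omega> \<in> A k) \<and> Z (Suc (Suc n)) \<omega> = []}" (is "?L = ?R")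
  proof (intro set_eqI iffI)
    fix \<omega> assume "\<omega> \<in> ?L"
    then show "\<omega> \<in> ?R" using return_time_eq[of \<omega> "Suc n"] by (auto simp: A_def)
  next
    fix \<omega> assume w: "\<omega> \<in> ?R"
    then have *: "\<And>k. k \<le> Suc (Suc n) \<Longrightarrow> Z k \<omega> \<in> A k" by blast
    have 1: "Z 1 \<omega> \<notin> emb D i ` factor D i" using *[of 1] by (simp add: A_def)
    have "[] \<in> emb D i ` factor D i" using root_in[OF i] by (force simp: emb_def)
    then have "Z 1 \<omega> \<noteq> []" using 1 by metis
    moreover have "Z k \<omega> \<noteq> []" if "k \<in> {2..Suc n}" for k using *[of k] that by (auto simp: A_def)
    moreover have "k = 1 \<or> k \<in> {2..Suc n}" if "k \<in> {1..Suc n}" for k using that by auto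
    ultimately have "\<forall>k\<in>{1..Suc n}. Z k \<omega> \<noteq> []" by blast
    then show "\<omega> \<in> ?L" using w 1 return_time_eq[of \<omega> "Suc n"] by auto
  qed
  then have "ennreal (measure M ?L) = path_prob A (Suc (Suc n)) []"
    by (simp only: path_prob_def emeasure_eq_measure)
  also have "\<dots> = (\<Sum>\<^sup>+w. path_prob A (Suc n) w * P w [])" by (simp add: path_prob_Suc[of A "Suc n"] A_def)
  also have "\<dots> = (\<Sum>l\<in>?I. hn l (Suc n))"
    by (simp add: mum sum_distrib_right csum_sum hn_def del: taboo.simps)
  finally show ?thesis .
qed

end


section \<open>Identification of the functions in the speed formula\<close>

lemma csum_ennreal_sums:
  fixes f :: "nat \<Rightarrow> real"
  assumes nn: "\<And>n. f n \<ge> 0" and fin: "(\<Sum>\<^sup>+n. ennreal (f n)) < \<top>"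
  shows "f sums enn2real (\<Sum>\<^sup>+n. ennreal (f n))"
proof -
  have "summable f" using nn fin unfolding csum_nat by (intro summable_suminf_not_top) auto
  then have "f sums suminf f" by (rule summable_sums)
  moreover have "(\<Sum>\<^sup>+n. ennreal (f n)) = ennreal (suminf f)"
    unfolding csum_nat by (rule suminf_ennreal_eq) (use nn \<open>f sums suminf f\<close> in auto)
  ultimately show ?thesis using suminf_nonneg[OF \<open>summable f\<close> nn] by simp
qed

context free_product
begin

definition Gr :: "nat \<Rightarrow> real \<Rightarrow> real" where
  "Gr i z = enn2real (Gf i (ennreal z))"

definition Tr :: "nat \<Rightarrow> real \<Rightarrow> real" where
  "Tr j z = enn2real (Tf j (ennreal z))"

definition Kr :: "nat \<Rightarrow> nat \<Rightarrow> nat \<Rightarrow> real" where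
  "Kr i j n = enn2real (Kn i j n)"

text \<open>Arguments at which all generating functions in question are finite. A neighbourhood of \<open>1\<close> consists of
  such points, which allows differentiation at \<open>1\<close> and gives moments of the increments.\<close>

definition regular :: "real \<Rightarrow> bool" where
  "regular z \<longleftrightarrow> z > 0 \<and> Gf 0 (ennreal z) < \<top> \<and> (\<forall>j\<in>indices D. xif j (ennreal z) < 1)"

lemma Gf_finite: "Gf 0 z < \<top> \<Longrightarrow> Gf i z < \<top>"
  using Gf_mono by (rule order.strict_trans1)

lemma Gr_ge_1: "Gf 0 (ennreal z) < \<top> \<Longrightarrow> Gr i z \<ge> 1"
  using Gf_ge_1[of i "ennreal z"] enn2real_mono[of 1 "Gf i (ennreal z)"] Gf_finite[of "ennreal z" i] by (simp add: Gr_def)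

lemma xir_eq: "Gf 0 (ennreal z) < \<top> \<Longrightarrow> z \<ge> 0 \<Longrightarrow> i \<in> indices D \<Longrightarrow> xir i z = weight D i * z * Gr i z"
  by (simp add: xir_def xif_def Gr_def wt_def enn2real_mult weight_pos less_imp_le)

lemma regular_Cf: "regular z \<Longrightarrow> j \<in> indices D \<Longrightarrow> Cf j (ennreal z) < \<top> \<and> Tr j z = Gr j z * enn2real (Cf j (ennreal z))"
proof -
  assume z: "regular z" and j: "j \<in> indices D"
  have T: "Tf j (ennreal z) < \<top>" using Tf_finite[OF j, of "ennreal z"] z j by (simp add: regular_def)
  have "Cf j (ennreal z) \<le> Tf j (ennreal z)"
    unfolding Tf_eq using mult_right_mono[OF Gf_ge_1[of j "ennreal z"], of "Cf j (ennreal z)"] by simp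
  then show ?thesis using T unfolding Tr_def Gr_def by (auto simp: Tf_eq enn2real_mult)
qed

lemma regular_Kf:
  assumes z: "regular z" and j: "j \<in> indices D" and ij: "i \<noteq> j"
  shows "Kf i j (ennreal z) < \<top>" "enn2real (Kf i j (ennreal z)) = Gr i z * Tr j z / Gr j z"
proof -
  have G: "Gf 0 (ennreal z) < \<top>" using z by (simp add: regular_def)
  show "Kf i j (ennreal z) < \<top>"
    unfolding Kf_eq[OF ij j] using regular_Cf[OF z j] Gf_finite[OF G, of i] by (simp add: ennreal_mult_less_top)
  show "enn2real (Kf i j (ennreal z)) = Gr i z * Tr j z / Gr j z"
    unfolding Kf_eq[OF ij j] using regular_Cf[OF z j] Gr_ge_1[OF G, of j] by (simp add: enn2real_mult Gr_def)
qed

lemma Kn_finite: "regular 1 \<Longrightarrow> j \<in> indices D \<Longrightarrow> i \<noteq> j \<Longrightarrow> Kn i j n = ennreal (Kr i j n)"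
proof -
  assume "regular 1" "j \<in> indices D" "i \<noteq> j"
  then have "Kf i j 1 < \<top>" using regular_Kf(1)[of 1] by simp
  moreover have "Kn i j n \<le> Kf i j 1" unfolding Kf_def using csum_ge[of "\<lambda>n. Kn i j n * 1 ^ Suc n" n] by simp
  ultimately show ?thesis by (simp add: Kr_def)
qed

lemma Kr_nonneg: "Kr i j n \<ge> 0"
  by (simp add: Kr_def)

lemma Kr_sums:
  assumes "regular 1" "j \<in> indices D" "i \<noteq> j" "regular z"
  shows "(\<lambda>n. Kr i j n * z ^ Suc n) sums enn2real (Kf i j (ennreal z))"
proof -
  have z: "z \<ge> 0" using assms by (simp add: regular_def)
  have "Kf i j (ennreal z) = (\<Sum>\<^sup>+n. ennreal (Kr i j n * z ^ Suc n))"
    unfolding Kf_def using assms z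
    by (intro csum_cong) (simp add: Kn_finite ennreal_mult Kr_nonneg ennreal_power[symmetric] del: power_Suc)
  moreover have "(\<lambda>n. Kr i j n * z ^ Suc n) sums enn2real (\<Sum>\<^sup>+n. ennreal (Kr i j n * z ^ Suc n))"
    by (rule csum_ennreal_sums) (use regular_Kf(1)[OF assms(4,2,3)] calculation z Kr_nonneg in auto)
  ultimately show ?thesis by simp
qed

lemma stay_pos: "regular 1 \<Longrightarrow> j \<in> indices D \<Longrightarrow> stay j > 0"
proof -
  assume "regular 1" "j \<in> indices D"
  then have "xif j 1 < 1" by (simp add: regular_def)
  then have "enn2real (xif j 1) < 1" using xif_1_finite[of j] by (simp add: enn2real_less_iff)
  then show ?thesis by (simp add: stay_def xir_def)
qed

lemma stay_0: "stay 0 = 1"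
  by (simp add: stay_def xir_def xif_def)

text \<open>The increments of the exit times are almost surely finite: \<open>\<Sum>\<^sub>j stay j * Cf j 1\<close> over \<open>j \<noteq> i\<close> is the
  probability \<open>\<Sum>\<^sub>j (\<alpha>\<^sub>j - Hf j 1)\<close> to escape from the empty word into one of these branches with the next
  excursion, and \<open>Gf i 1\<close> sums over the number of excursions that return.\<close>

lemma stochastic:
  assumes g1: "regular 1" and i: "i = 0 \<or> i \<in> indices D"
  shows "(\<Sum>j\<in>indices D - {i}. stay j * enn2real (Kf i j 1)) = stay i"
proof -
  define H where "H l = enn2real (Hf l 1)" for l
  define w where "w l = enn2real (wt l)" for l
  have G: "Gf 0 (ennreal 1) < \<top>" using g1 by (simp add: regular_def)
  have H_fin: "Hf l 1 < \<top>" for l using Hf_le[of l] wt_finite[of l] by (rule order.strict_trans1)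
  have stay: "stay k = 1 - w k * Gr k 1" for k
    by (simp add: stay_def xir_def xif_def w_def Gr_def enn2real_mult)
  have C: "stay j * enn2real (Cf j 1) = w j - H j" if j: "j \<in> indices D" for j
  proof -
    have Cf: "Cf j 1 < \<top>" "Tr j 1 = Gr j 1 * enn2real (Cf j 1)" using regular_Cf[OF g1 j] by simp_all
    have Tf: "Tf j 1 < \<top>" using Tf_finite[OF j, of 1] g1 j by (simp add: regular_def)
    have "enn2real (Cf j 1 + Hf j 1) = enn2real (wt j * 1 * (1 + Tf j 1))" by (simp only: crossing_plus_return[OF j])
    then have "enn2real (Cf j 1) + H j = w j * (1 + Tr j 1)"
      using Cf(1) H_fin[of j] Tf by (simp add: enn2real_plus enn2real_mult H_def w_def Tr_def)
    then show ?thesis unfolding Cf(2) stay by (simp add: algebra_simps)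
  qed
  have ren: "Gr i 1 = 1 + Gr i 1 * (\<Sum>l\<in>indices D - {i}. H l)"
  proof -
    have S: "(\<Sum>l\<in>indices D - {i}. Hf l 1) < \<top>" using H_fin by simp
    have "enn2real (Gf i 1) = enn2real (1 + Gf i 1 * (\<Sum>l\<in>indices D - {i}. Hf l 1))"
      using Gf_renewal[of i 1] by simp
    also have "\<dots> = 1 + enn2real (Gf i 1) * enn2real (\<Sum>l\<in>indices D - {i}. Hf l 1)"
      using S Gf_finite[of 1 i] G by (simp add: enn2real_plus enn2real_mult ennreal_mult_less_top)
    also have "enn2real (\<Sum>l\<in>indices D - {i}. Hf l 1) = (\<Sum>l\<in>indices D - {i}. H l)"
      unfolding H_def using H_fin by (simp add: enn2real_sum)
    finally show ?thesis by (simp add: Gr_def)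
  qed
  have wsum: "(\<Sum>l\<in>indices D - {i}. w l) = 1 - w i"
  proof -
    have wl: "w l = weight D l" if "l \<in> indices D" for l using that by (simp add: w_def wt_def weight_pos less_imp_le)
    have tot: "(\<Sum>l\<in>indices D. w l) = 1" using weight_sum by (simp add: wl)
    show ?thesis
    proof (cases "i = 0")
      case True
      then show ?thesis using tot by (simp add: w_def)
    next
      case False
      then show ?thesis using i tot by (simp add: sum_diff1)
    qed
  qed
  have "(\<Sum>j\<in>indices D - {i}. stay j * enn2real (Kf i j 1)) = (\<Sum>j\<in>indices D - {i}. Gr i 1 * (w j - H j))"
  proof (intro sum.cong refl)
    fix j assume j: "j \<in> indices D - {i}"
    have "enn2real (Kf i j 1) = Gr i 1 * enn2real (Cf j 1)"
      using j by (subst Kf_eq) (auto simp: enn2real_mult Gr_def)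
    then show "stay j * enn2real (Kf i j 1) = Gr i 1 * (w j - H j)" using C[of j] j by (metis DiffD1 mult.left_commute)
  qed
  also have "\<dots> = Gr i 1 * (1 - w i) - Gr i 1 * (\<Sum>l\<in>indices D - {i}. H l)"
    by (simp add: sum_distrib_left[symmetric] sum_subtractf wsum right_diff_distrib)
  also have "\<dots> = stay i" using ren unfolding stay by (simp add: algebra_simps)
  finally show ?thesis .
qed

lemma radius_Gf:
  assumes "conv_radius (\<lambda>n. nstep (words D) (trans_prob D) n [] []) > 1"
  obtains \<rho> where "\<rho> > 1" "Gf 0 (ennreal \<rho>) < \<top>"
proof -
  obtain \<rho> where \<rho>: "1 < ereal \<rho>" "ereal \<rho> < conv_radius (\<lambda>n. nstep (words D) (trans_prob D) n [] [])"
    using ereal_dense2[OF assms] by blast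
  let ?p = "\<lambda>n. nstep (words D) (trans_prob D) n [] []"
  have p: "?p n \<ge> 0" "ennreal (?p n) = gn 0 n" for n
    unfolding gn_def Avoid_0 by (rule nstep_taboo; use trans_prob_nonneg P_row_le in \<open>auto simp: P_def\<close>)+
  have r1: "\<rho> > 1" using \<rho>(1) by (simp add: one_ereal_def)
  have "summable (\<lambda>n. ?p n * \<rho> ^ n)"
    by (rule summable_in_conv_radius) (use \<rho> r1 in simp)
  then have "(\<Sum>n. ennreal (?p n * \<rho> ^ n)) = ennreal (\<Sum>n. ?p n * \<rho> ^ n)"
    using p r1 by (intro suminf_ennreal2) auto
  moreover have "Gf 0 (ennreal \<rho>) = (\<Sum>n. ennreal (?p n * \<rho> ^ n))"
    unfolding Gf_def csum_nat using p r1 by (simp add: ennreal_mult ennreal_power[symmetric])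
  ultimately have "Gf 0 (ennreal \<rho>) < \<top>" by simp
  then show ?thesis using that r1 by blast
qed

text \<open>All returns avoiding \<open>V\<^sub>i\<^sup>\<times>\<close> are returns, so the hypothesis on the Green function of the walk controls
  every \<open>Gf i\<close>. The remaining condition \<open>\<xi>\<^sub>j(z) < 1\<close> holds at \<open>1\<close> and extends by continuity.\<close>

lemma eventually_regular:
  assumes \<rho>: "\<rho> > 1" "Gf 0 (ennreal \<rho>) < \<top>"
  shows "eventually regular (nhds 1)"
proof -
  have mono: "Gf 0 (ennreal z) < \<top>" if "z \<in> {0..\<rho>}" for z
  proof -
    have "Gf 0 (ennreal z) \<le> Gf 0 (ennreal \<rho>)"
      unfolding Gf_def using that by (intro csum_mono mult_left_mono power_mono ennreal_leI) auto
    then show ?thesis using \<rho>(2) by (rule order.strict_trans1)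
  qed
  have G1: "Gf 0 1 < \<top>" using mono[of 1] \<rho> by simp
  have g_fin: "gn i n = ennreal (enn2real (gn i n))" for i n
  proof -
    have "gn i n \<le> Gf i 1" unfolding Gf_def using csum_ge[of "\<lambda>n. gn i n * 1 ^ n" n] by simp
    then have "gn i n < \<top>" using Gf_finite[OF G1, of i] by (rule order.strict_trans1)
    then show ?thesis by simp
  qed
  have ps: "(\<lambda>n. enn2real (gn i n) * z ^ n) sums Gr i z" if "z \<in> {0..\<rho>}" for i z
  proof -
    have e: "Gf i (ennreal z) = (\<Sum>\<^sup>+n. ennreal (enn2real (gn i n) * z ^ n))"
      unfolding Gf_def using that by (intro csum_cong, subst g_fin) (simp add: ennreal_mult ennreal_power[symmetric])
    show ?thesis unfolding Gr_def e
      by (rule csum_ennreal_sums) (use that e Gf_finite[OF mono[OF that], of i] in auto)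
  qed
  have ev: "\<forall>\<^sub>F z in nhds 1. z \<in> {0<..<\<rho>}" using \<rho> by (intro eventually_nhds_in_open) auto
  have "\<forall>\<^sub>F z in nhds 1. xif j (ennreal z) < 1" if j: "j \<in> indices D" for j
  proof -
    let ?F = "\<lambda>z. \<Sum>n. enn2real (gn j n) * z ^ n"
    let ?X = "\<lambda>z. weight D j * z * ?F z"
    have "isCont ?F 1"
      by (rule isCont_powser[of _ \<rho>]) (use sums_summable[OF ps[of \<rho>]] \<rho> in auto)
    then have "(?F \<longlongrightarrow> ?F 1) (nhds 1)"
      using tendsto_at_iff_tendsto_nhds[of ?F 1] by (simp only: isCont_def)
    then have cont: "(?X \<longlongrightarrow> ?X 1) (nhds 1)"
      by (intro tendsto_mult[OF tendsto_mult[OF tendsto_const filterlim_ident]])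
    have X: "?X z = xir j z" if "z \<in> {0..\<rho>}" for z
      using xir_eq[OF mono[OF that] _ j] sums_unique[OF ps[OF that]] that by simp
    have fin: "xif j (ennreal z) < \<top>" if "z \<in> {0..\<rho>}" for z
      unfolding xif_def using Gf_finite[OF mono[OF that], of j] wt_finite[of j] by (simp add: ennreal_mult_less_top)
    have "xir j 1 < 1" using xif_less_1[OF G1 j] xif_1_finite[of j] by (simp add: xir_def enn2real_less_iff)
    then have "?X 1 < 1" using X[of 1] \<rho> by simp
    then have "\<forall>\<^sub>F z in nhds 1. ?X z < 1" using cont by (simp add: order_tendstoD(2))
    then show ?thesis using ev
    proof eventually_elim
      case (elim z)
      then have "xir j z < 1" using X[of z] by simp
      then show ?case using fin[of z] elim(2) unfolding xir_def by (auto simp: enn2real_less_iff)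
    qed
  qed
  then have "\<forall>\<^sub>F z in nhds 1. \<forall>j\<in>indices D. xif j (ennreal z) < 1"
    by (simp add: eventually_ball_finite)
  then show ?thesis using ev
    by eventually_elim (use mono in \<open>auto simp: regular_def\<close>)
qed

lemma eventually_regular_above:
  assumes "eventually regular (nhds 1)"
  obtains z where "z > 1" "regular z"
proof -
  obtain S where S: "open S" "1 \<in> S" "\<And>z. z \<in> S \<Longrightarrow> regular z" using assms unfolding eventually_nhds by blast
  then obtain e where e: "e > 0" "ball 1 e \<subseteq> S" using open_contains_ball by blast
  then have "1 + e / 2 \<in> S" by (intro subsetD[OF e(2)]) (simp add: dist_real_def)
  then show ?thesis using that[of "1 + e / 2"] e S(3) by simp
qed

end

context free_product_walk
begin

lemma xi_eq:
  assumes i: "i \<in> indices D" and z: "z \<ge> 0" and G: "Gf 0 (ennreal z) < \<top>"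
  shows "xi D M Z i z = xir i z"
proof -
  define r where "r n = measure M {\<omega> \<in> space M. return_time Z \<omega> = enat (n + 2) \<and> Z 1 \<omega> \<notin> emb D i ` factor D i}" for n
  let ?S = "\<Sum>l\<in>indices D - {i}. Hf l (ennreal z)"
  have ren: "Gf i (ennreal z) = 1 + Gf i (ennreal z) * ?S" by (rule Gf_renewal)
  have "?S \<le> Gf i (ennreal z) * ?S" using mult_right_mono[OF Gf_ge_1[of i "ennreal z"], of ?S] by simp
  also have "\<dots> \<le> Gf i (ennreal z)" by (subst (2) ren) simp
  finally have S_fin: "?S < \<top>" using Gf_finite[OF G, of i] by (rule order.strict_trans1)
  have "(\<Sum>\<^sup>+n. ennreal (r n * z ^ (n + 2))) = (\<Sum>\<^sup>+n. (\<Sum>l\<in>indices D - {i}. hn l (Suc n)) * ennreal z ^ (n + 2))"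
    using z by (intro csum_cong)
      (simp add: ennreal_mult r_def first_return_prob[OF i, symmetric] ennreal_power[symmetric] del: add_2_eq_Suc')
  also have "\<dots> = (\<Sum>l\<in>indices D - {i}. \<Sum>\<^sup>+n. hn l (Suc n) * ennreal z ^ Suc (Suc n))"
    by (simp add: sum_distrib_right csum_sum)
  also have "\<dots> = ?S"
    unfolding Hf_def by (intro sum.cong refl, subst (2) csum_nat_Suc) simp
  finally have e: "(\<Sum>\<^sup>+n. ennreal (r n * z ^ (n + 2))) = ?S" .
  have "(\<lambda>n. r n * z ^ (n + 2)) sums enn2real ?S"
    unfolding e[symmetric] by (rule csum_ennreal_sums) (use z S_fin e in \<open>auto simp: r_def\<close>)
  then have Hb: "Hbar D M Z i z = enn2real ?S"
    unfolding Hbar_def r_def[symmetric] by (simp add: sums_iff)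
  have "Gr i z = enn2real (1 + Gf i (ennreal z) * ?S)" unfolding Gr_def using ren by simp
  also have "\<dots> = 1 + Gr i z * enn2real ?S"
    using S_fin Gf_finite[OF G, of i] by (simp add: enn2real_plus enn2real_mult ennreal_mult_less_top Gr_def del: ennreal_sum_less_top)
  finally have "Gr i z * (1 - Hbar D M Z i z) = 1" unfolding Hb by (simp add: algebra_simps)
  then have "1 / (1 - Hbar D M Z i z) = Gr i z"
    using Gr_ge_1[OF G, of i] by (metis divide_self_if mult_eq_0_iff nonzero_mult_div_cancel_right zero_neq_one)
  then show ?thesis unfolding xi_def xir_eq[OF G z i] by (metis times_divide_eq_right mult.right_neutral)
qed

lemma gamma_eq:
  assumes i: "i \<in> indices D" and j: "j \<in> indices D" and ij: "i \<noteq> j" and z: "regular z"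
  shows "gamma D M Z i j z = enn2real (Kf i j (ennreal z)) / weight D j"
proof -
  have zz: "z > 0" and G: "Gf 0 (ennreal z) < \<top>" and x: "xif j (ennreal z) < 1" using z j by (auto simp: regular_def)
  have z0: "z \<ge> 0" using zz by simp
  have "(1 + Tr j z) * ((1 - xir j z) * factor_green D j (xir j z)) = 1"
    using green_identity[OF j _ x] by (simp add: Tr_def xir_def mult.assoc)
  then have "1 / ((1 - xir j z) * factor_green D j (xir j z)) = 1 + Tr j z"
    by (metis mult_eq_0_iff nonzero_eq_divide_eq zero_neq_one)
  then have "gamma D M Z i j z = 1 / weight D i * (xir i z / xir j z) * Tr j z"
    unfolding gamma_def xi_eq[OF i z0 G] xi_eq[OF j z0 G] by simp
  also have "\<dots> = Gr i z * Tr j z / Gr j z / weight D j"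
    unfolding xir_eq[OF G z0 i] xir_eq[OF G z0 j]
    using zz weight_pos[OF i] weight_pos[OF j] Gr_ge_1[OF G, of j] by (simp add: field_simps)
  finally show ?thesis using regular_Kf(2)[OF z j ij] by simp
qed

text \<open>Near \<open>1\<close> the function \<open>\<alpha>\<^sub>j \<gamma>\<^sub>i\<^sub>j\<close> coincides with the power series of the increments, whose derivative at
  \<open>1\<close> is a first moment.\<close>

lemma deriv_gamma:
  assumes i: "i \<in> indices D" and j: "j \<in> indices D" and ij: "i \<noteq> j" and ev: "eventually regular (nhds 1)"
  shows "weight D j * deriv (gamma D M Z i j) 1 = (\<Sum>n. Kr i j n * real (Suc n))"
proof -
  have g1: "regular 1" using eventually_nhds_x_imp_x[OF ev] .
  obtain z1 where z1: "z1 > 1" "regular z1" using eventually_regular_above[OF ev] by blast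
  \<comment> \<open>the coefficient of \<open>z ^ Suc n\<close> belongs to an increment of \<open>n + 1\<close>\<close>
  define d where "d n = (case n of 0 \<Rightarrow> 0 | Suc m \<Rightarrow> Kr i j m)" for n
  have ds: "(\<lambda>n. d n * z ^ n) sums enn2real (Kf i j (ennreal z))" if "regular z" for z
    using Kr_sums[OF g1 j ij that] sums_Suc[of "\<lambda>n. d n * z ^ n"] by (simp add: d_def)
  have "DERIV (\<lambda>z. \<Sum>n. d n * z ^ n) 1 :> (\<Sum>n. diffs d n * 1 ^ n)"
    by (rule termdiffs_strong[of _ z1]) (use sums_summable[OF ds[OF z1(2)]] z1 in auto)
  moreover have "(\<Sum>n. diffs d n * 1 ^ n) = (\<Sum>n. Kr i j n * real (Suc n))"
    by (simp add: diffs_def d_def mult.commute)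
  ultimately have "DERIV (\<lambda>z. (\<Sum>n. d n * z ^ n) / weight D j) 1 :> (\<Sum>n. Kr i j n * real (Suc n)) / weight D j"
    by (simp add: DERIV_cdivide)
  moreover have "\<forall>\<^sub>F z in nhds 1. gamma D M Z i j z = (\<Sum>n. d n * z ^ n) / weight D j"
    using ev
  proof eventually_elim
    case (elim z)
    show ?case using gamma_eq[OF i j ij elim] sums_unique[OF ds[OF elim]] by simp
  qed
  ultimately have "DERIV (gamma D M Z i j) 1 :> (\<Sum>n. Kr i j n * real (Suc n)) / weight D j"
    by (subst DERIV_cong_ev[OF refl _ refl]) auto
  then show ?thesis using weight_pos[OF j] by (simp add: DERIV_imp_deriv)
qed

lemma qhat_eq:
  assumes i: "i \<in> indices D" and j: "j \<in> indices D" and ij: "i \<noteq> j" and g1: "regular 1"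
  shows "qhat D M Z i j = stay j / stay i * enn2real (Kf i j 1)"
proof -
  define F where "F y n s = avoid_prob D M Z i n (emb D j s) * trans_prob D (emb D j s) (emb D j y)" for y n s
  note tp = trans_prob_nonneg
  have F_nn: "F y n s \<ge> 0" for y n s by (simp add: F_def avoid_prob_def tp)
  define X where "X y n = wt j * (\<Sum>\<^sup>+v. taboo P (Avoid i) n [] (emb D j v) * pf j v y)" for y n
  have Vj: "factor_pos D j = Vx j" using j by (simp add: Vx_def)
  have inner: "(\<Sum>\<^sup>+s. if s \<in> predecessors D j y then ennreal (F y n s) else 0) = X y n" if y: "y \<in> Vx j" for y n
  proof -
    have "(\<Sum>\<^sup>+s. if s \<in> predecessors D j y then ennreal (F y n s) else 0) =
      (\<Sum>\<^sup>+s. wt j * (taboo P (Avoid i) n [] (emb D j s) * pf j s y))"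
    proof (rule csum_cong)
      fix s
      show "(if s \<in> predecessors D j y then ennreal (F y n s) else 0) = wt j * (taboo P (Avoid i) n [] (emb D j s) * pf j s y)"
      proof (cases "s \<in> predecessors D j y")
        case True
        then have s: "s \<in> factor D j" by (simp add: predecessors_def)
        have "ennreal (F y n s) = taboo P (Avoid i) n [] (emb D j s) * P (emb D j s) (emb D j y)"
          unfolding F_def P_def avoid_prob_eq[OF i, symmetric] by (rule ennreal_mult) (auto simp: avoid_prob_def tp)
        then show ?thesis using True P_within_factor[OF y s] by (simp add: ac_simps)
      next
        case False
        have "pf j s y = 0"
        proof (cases "s \<in> factor D j")
          case True
          then have "\<not> step D j s y > 0" using False by (simp add: predecessors_def)
          then show ?thesis using step_nonneg[OF j True, of y] in_VxD[OF y] by (simp add: pf_def ennreal_neg)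
        qed (simp add: pf_outside)
        then show ?thesis using False by simp
      qed
    qed
    then show ?thesis by (simp add: csum_cmult X_def)
  qed
  have tot: "(\<Sum>\<^sup>+y. if y \<in> Vx j then (\<Sum>\<^sup>+n. X y n) else 0) = Kf i j 1"
  proof -
    have "(\<Sum>\<^sup>+y. if y \<in> Vx j then (\<Sum>\<^sup>+n. X y n) else 0) = (\<Sum>\<^sup>+y. \<Sum>\<^sup>+n. if y \<in> Vx j then X y n else 0)"
      by (intro csum_cong) simp
    also have "\<dots> = (\<Sum>\<^sup>+n. \<Sum>\<^sup>+y. if y \<in> Vx j then X y n else 0)" by (rule csum_swap)
    finally show ?thesis by (simp add: Kf_def Kn_def X_def cong: if_cong)
  qed
  have Kn_finite: "Kf i j 1 < \<top>" using regular_Kf(1)[OF g1 j ij] by simp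
  have Y_fin: "(\<Sum>\<^sup>+n. X y n) < \<top>" if "y \<in> Vx j" for y
    using csum_ge[of "\<lambda>y. if y \<in> Vx j then (\<Sum>\<^sup>+n. X y n) else 0" y] that Kn_finite unfolding tot by simp
  have X_fin: "X y n < \<top>" if "y \<in> Vx j" for y n
    using csum_ge[of "X y" n] Y_fin[OF that] by (rule order.strict_trans1)
  have in1: "ennreal (infsum (F y n) (predecessors D j y)) = X y n" if y: "y \<in> Vx j" for y n
    using csum_eq_infsum(2)[of "predecessors D j y" "F y n"] inner[OF y] X_fin[OF y] F_nn by simp
  define I1 where "I1 y n = infsum (F y (n - 1)) (predecessors D j y)" for y n
  have I1_nn: "I1 y n \<ge> 0" for y n unfolding I1_def by (rule infsum_nonneg) (rule F_nn)
  have c2: "(\<Sum>\<^sup>+n. if n \<in> {1..} then ennreal (I1 y n) else 0) = (\<Sum>\<^sup>+n. X y n)" if y: "y \<in> Vx j" for y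
    by (subst csum_nat_Suc) (simp add: I1_def in1[OF y])
  have in2: "ennreal (infsum (I1 y) {1..}) = (\<Sum>\<^sup>+n. X y n)" if y: "y \<in> Vx j" for y
    using csum_eq_infsum(2)[of "{1..}" "I1 y"] c2[OF y] Y_fin[OF y] I1_nn by simp
  define I2 where "I2 y = infsum (I1 y) {1..}" for y
  have I2_nn: "I2 y \<ge> 0" for y unfolding I2_def by (rule infsum_nonneg) (rule I1_nn)
  have c3: "(\<Sum>\<^sup>+y. if y \<in> Vx j then ennreal (I2 y) else 0) = Kf i j 1"
    unfolding tot[symmetric] by (intro csum_cong) (simp only: I2_def in2 cong: if_cong)
  have "ennreal (infsum I2 (Vx j)) = Kf i j 1"
    using csum_eq_infsum(2)[of "Vx j" I2] c3 Kn_finite I2_nn by simp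
  then have "infsum I2 (Vx j) = enn2real (Kf i j 1)"
    using infsum_nonneg[of "Vx j" I2] I2_nn by (metis enn2real_ennreal)
  then have "(\<Sum>\<^sub>\<infinity>y\<in>factor_pos D j. \<Sum>\<^sub>\<infinity>n\<in>{1..}. \<Sum>\<^sub>\<infinity>s\<in>predecessors D j y.
        avoid_prob D M Z i (n - 1) (emb D j s) * trans_prob D (emb D j s) (emb D j y)) = enn2real (Kf i j 1)"
    unfolding Vj I2_def[abs_def] I1_def[abs_def] F_def[abs_def] .
  moreover have "xi D M Z k 1 = xir k 1" if "k \<in> indices D" for k
    using g1 that by (intro xi_eq) (auto simp: regular_def)
  ultimately show ?thesis unfolding qhat_def using ij i j by (simp add: stay_def)
qed

end


section \<open>Two tools for the law of large numbers\<close>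

text \<open>Solvability of \<open>(1 - q) h = f\<close> for \<open>f\<close> orthogonal to the invariant measure. With the value of \<open>h\<close> at one
  state \<open>b\<close> set to \<open>0\<close>, the equations at the other states form a contraction, since \<open>q\<close> loses mass to \<open>b\<close>
  from each of them. The equation at \<open>b\<close> then holds automatically: it is the only one left after
  integrating against \<open>\<nu>\<close>. This argument is insensitive to periodicity, which does occur for two
  factors.\<close>

lemma poisson_equation:
  fixes q :: "'i \<Rightarrow> 'i \<Rightarrow> real" and \<nu> f :: "'i \<Rightarrow> real"
  assumes fin: "finite I"
    and pos: "\<And>i j. i \<in> I \<Longrightarrow> j \<in> I \<Longrightarrow> i \<noteq> j \<Longrightarrow> q i j > 0"
    and nonneg: "\<And>i. i \<in> I \<Longrightarrow> q i i \<ge> 0"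
    and row: "\<And>i. i \<in> I \<Longrightarrow> (\<Sum>j\<in>I. q i j) = 1"
    and \<nu>_nonneg: "\<And>i. i \<in> I \<Longrightarrow> \<nu> i \<ge> 0" and \<nu>_sum: "sum \<nu> I = 1"
    and inv: "\<And>j. j \<in> I \<Longrightarrow> (\<Sum>i\<in>I. \<nu> i * q i j) = \<nu> j"
    and orth: "(\<Sum>i\<in>I. \<nu> i * f i) = 0"
  obtains h where "\<And>i. i \<in> I \<Longrightarrow> h i = f i + (\<Sum>j\<in>I. q i j * h j)"
proof -
  have q0: "q i j \<ge> 0" if "i \<in> I" "j \<in> I" for i j using pos[OF that] nonneg[OF that(1)] by (cases "i = j") auto
  obtain b where b: "b \<in> I" using \<nu>_sum by fastforce
  let ?I = "I - {b}"
  define r where "r = Max (insert 0 ((\<lambda>i. 1 - q i b) ` ?I))"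
  have r: "0 \<le> r" "r < 1" and r_le: "\<And>i. i \<in> ?I \<Longrightarrow> 1 - q i b \<le> r"
    using fin pos b by (auto simp: r_def)
  have rsum: "(\<Sum>j\<in>?I. q i j) \<le> r" if "i \<in> ?I" for i
    using r_le[OF that] row[of i] that b fin by (simp add: sum_diff1)
  \<comment> \<open>fixed-point iteration for the system without the state \<open>b\<close>\<close>
  define u where "u n = ((\<lambda>v i. f i + (\<Sum>j\<in>?I. q i j * v j)) ^^ n) (\<lambda>_. 0)" for n
  have u_Suc: "u (Suc n) i = f i + (\<Sum>j\<in>?I. q i j * u n j)" for n i by (simp add: u_def)
  define B where "B = (\<Sum>i\<in>I. \<bar>f i\<bar>)"
  have diff: "\<bar>u (Suc n) i - u n i\<bar> \<le> B * r ^ n" if "i \<in> ?I" for n i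
    using that
  proof (induction n arbitrary: i)
    case 0
    then have "\<bar>f i\<bar> \<le> B" unfolding B_def using fin by (intro member_le_sum) auto
    then show ?case by (simp add: u_def)
  next
    case (Suc n)
    have "\<bar>u (Suc (Suc n)) i - u (Suc n) i\<bar> = \<bar>\<Sum>j\<in>?I. q i j * (u (Suc n) j - u n j)\<bar>"
      unfolding u_Suc[of "Suc n" i] u_Suc[of n i] by (simp add: sum_subtractf right_diff_distrib)
    also have "\<dots> \<le> (\<Sum>j\<in>?I. \<bar>q i j * (u (Suc n) j - u n j)\<bar>)" by (rule sum_abs)
    also have "\<dots> \<le> (\<Sum>j\<in>?I. q i j * (B * r ^ n))"
    proof (intro sum_mono)
      fix j assume j: "j \<in> ?I"
      then have "q i j \<ge> 0" using q0 Suc.prems by simp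
      then show "\<bar>q i j * (u (Suc n) j - u n j)\<bar> \<le> q i j * (B * r ^ n)"
        using mult_left_mono[OF Suc.IH[OF j], of "q i j"] by (simp add: abs_mult)
    qed
    also have "\<dots> = (\<Sum>j\<in>?I. q i j) * (B * r ^ n)" by (rule sum_distrib_right[symmetric])
    also have "\<dots> \<le> r * (B * r ^ n)"
      using rsum[OF Suc.prems] r by (intro mult_right_mono) (auto simp: B_def sum_nonneg)
    finally show ?case by (simp add: ac_simps)
  qed
  have conv: "convergent (\<lambda>n. u n i)" if i: "i \<in> ?I" for i
  proof -
    have "summable (\<lambda>n. u (Suc n) i - u n i)"
    proof (rule summable_comparison_test')
      show "summable (\<lambda>n. B * r ^ n)" using r by (intro summable_mult summable_geometric) auto
      show "norm (u (Suc n) i - u n i) \<le> B * r ^ n" for n using diff[OF i] by simp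
    qed
    then have "convergent (\<lambda>n. \<Sum>k<n. u (Suc k) i - u k i)" by (simp add: summable_iff_convergent)
    moreover have "u 0 i = 0" by (simp add: u_def)
    ultimately show ?thesis using sum_lessThan_telescope[of "\<lambda>n. u n i"] by simp
  qed
  define h where "h i = (if i = b then 0 else lim (\<lambda>n. u n i))" for i
  have lim: "(\<lambda>n. u n i) \<longlonglongrightarrow> h i" if "i \<in> ?I" for i
    using conv[OF that] that by (auto simp: h_def convergent_LIMSEQ_iff)
  have sum_h: "(\<Sum>j\<in>I. q i j * h j) = (\<Sum>j\<in>?I. q i j * h j)" for i
  proof -
    have "h b = 0" by (simp add: h_def)
    then show ?thesis by (simp add: sum.remove[OF fin b])
  qed
  have h_eq: "h i = f i + (\<Sum>j\<in>I. q i j * h j)" if i: "i \<in> ?I" for i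
  proof -
    have "(\<lambda>n. u (Suc n) i) \<longlonglongrightarrow> f i + (\<Sum>j\<in>?I. q i j * h j)"
      unfolding u_Suc by (intro tendsto_intros lim) auto
    moreover have "(\<lambda>n. u (Suc n) i) \<longlonglongrightarrow> h i" using lim[OF i] by (rule LIMSEQ_Suc)
    ultimately show ?thesis unfolding sum_h using LIMSEQ_unique by blast
  qed
  \<comment> \<open>otherwise invariance at \<open>b\<close> would make \<open>\<nu>\<close> vanish at all states, each of which leads to \<open>b\<close>\<close>
  have \<nu>b: "\<nu> b > 0"
  proof (rule ccontr)
    assume "\<not> \<nu> b > 0"
    then have "(\<Sum>i\<in>I. \<nu> i * q i b) = 0" using inv[OF b] \<nu>_nonneg[OF b] by simp
    then have z: "\<nu> i * q i b = 0" if "i \<in> I" for i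
      using that fin b \<nu>_nonneg q0 by (subst (asm) sum_nonneg_eq_0_iff) auto
    have "\<nu> i = 0" if "i \<in> I" for i
      using z[OF that] pos[OF that b] \<open>\<not> \<nu> b > 0\<close> \<nu>_nonneg[OF b] by (cases "i = b") auto
    then show False using \<nu>_sum by simp
  qed
  define e where "e i = h i - f i - (\<Sum>j\<in>I. q i j * h j)" for i
  have "(\<Sum>i\<in>I. \<nu> i * e i) = (\<Sum>i\<in>I. \<nu> i * h i) - (\<Sum>i\<in>I. \<nu> i * f i) - (\<Sum>i\<in>I. \<Sum>j\<in>I. \<nu> i * q i j * h j)"
    by (simp add: e_def right_diff_distrib sum_subtractf sum_distrib_left mult.assoc)
  also have "(\<Sum>i\<in>I. \<Sum>j\<in>I. \<nu> i * q i j * h j) = (\<Sum>j\<in>I. \<nu> j * h j)"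
    by (subst sum.swap) (simp add: sum_distrib_right[symmetric] inv)
  finally have "(\<Sum>i\<in>I. \<nu> i * e i) = 0" using orth by simp
  moreover have "(\<Sum>i\<in>I. \<nu> i * e i) = \<nu> b * e b"
    using b fin h_eq by (subst sum.remove[OF fin b]) (simp add: e_def)
  ultimately have "e b = 0" using \<nu>b by simp
  then have "h i = f i + (\<Sum>j\<in>I. q i j * h j)" if "i \<in> I" for i
    using h_eq[of i] that by (cases "i = b") (auto simp: e_def)
  then show ?thesis by (rule that)
qed

text \<open>For a monotone sequence the averages between consecutive squares are squeezed by those at the squares,
  because the ratio of consecutive squares tends to \<open>1\<close>.\<close>

lemma mono_squares_imp_limit:
  fixes e :: "nat \<Rightarrow> real"
  assumes mono: "\<And>k. k \<ge> 1 \<Longrightarrow> e k \<le> e (Suc k)" and e_nonneg: "\<And>k. e k \<ge> 0"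
    and lim: "(\<lambda>n. e (n ^ 2) / real (n ^ 2)) \<longlonglongrightarrow> L"
  shows "(\<lambda>k. e k / real k) \<longlonglongrightarrow> L"
proof -
  have le: "e k \<le> e m" if "1 \<le> k" "k \<le> m" for k m
    using that(2,1) by (induction m rule: dec_induct) (auto intro: order_trans[OF _ mono])
  have sq: "filterlim floor_sqrt sequentially sequentially"
    unfolding filterlim_at_top
  proof
    fix N :: nat
    show "\<forall>\<^sub>F k in sequentially. N \<le> floor_sqrt k"
      using eventually_ge_at_top[of "N\<^sup>2"]
    proof eventually_elim
      case (elim k)
      then show ?case using monoD[OF mono_floor_sqrt, of "N\<^sup>2" k] by simp
    qed
  qed
  have ratio: "(\<lambda>n. real (n ^ 2) / real (Suc n ^ 2)) \<longlonglongrightarrow> 1" "(\<lambda>n. real (Suc n ^ 2) / real (n ^ 2)) \<longlonglongrightarrow> 1"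
    by real_asymp+
  have "(\<lambda>n. e (n ^ 2) / real (n ^ 2) * (real (n ^ 2) / real (Suc n ^ 2))) \<longlonglongrightarrow> L * 1"
    by (intro tendsto_mult lim ratio)
  then have low: "(\<lambda>k. e (floor_sqrt k ^ 2) / real (floor_sqrt k ^ 2) * (real (floor_sqrt k ^ 2) / real (Suc (floor_sqrt k) ^ 2))) \<longlonglongrightarrow> L"
    using filterlim_compose[OF _ sq] by simp
  have "(\<lambda>n. e (Suc n ^ 2) / real (Suc n ^ 2) * (real (Suc n ^ 2) / real (n ^ 2))) \<longlonglongrightarrow> L * 1"
    by (intro tendsto_mult ratio) (rule LIMSEQ_Suc[OF lim])
  then have up: "(\<lambda>k. e (Suc (floor_sqrt k) ^ 2) / real (Suc (floor_sqrt k) ^ 2) * (real (Suc (floor_sqrt k) ^ 2) / real (floor_sqrt k ^ 2))) \<longlonglongrightarrow> L"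
    using filterlim_compose[OF _ sq] by simp
  show ?thesis
  proof (rule tendsto_sandwich[OF _ _ low up])
    show "\<forall>\<^sub>F k in sequentially. e (floor_sqrt k ^ 2) / real (floor_sqrt k ^ 2) * (real (floor_sqrt k ^ 2) / real (Suc (floor_sqrt k) ^ 2)) \<le> e k / real k"
      using eventually_ge_at_top[of 1]
    proof eventually_elim
      case (elim k)
      have n: "floor_sqrt k \<ge> 1" using elim monoD[OF mono_floor_sqrt, of 1 k] by simp
      have "e (floor_sqrt k ^ 2) \<le> e k" using n by (intro le) (auto simp: floor_sqrt_power2_le)
      moreover have "real k \<le> real (Suc (floor_sqrt k) ^ 2)"
        using Suc_floor_sqrt_power2_gt[of k] by (simp only: of_nat_le_iff less_imp_le)
      ultimately have "e (floor_sqrt k ^ 2) / real (Suc (floor_sqrt k) ^ 2) \<le> e k / real k"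
        using elim e_nonneg by (intro frac_le) auto
      then show ?case using n by simp
    qed
    show "\<forall>\<^sub>F k in sequentially. e k / real k \<le> e (Suc (floor_sqrt k) ^ 2) / real (Suc (floor_sqrt k) ^ 2) * (real (Suc (floor_sqrt k) ^ 2) / real (floor_sqrt k ^ 2))"
      using eventually_ge_at_top[of 1]
    proof eventually_elim
      case (elim k)
      have n: "floor_sqrt k \<ge> 1" using elim monoD[OF mono_floor_sqrt, of 1 k] by simp
      have "e k \<le> e (Suc (floor_sqrt k) ^ 2)"
        using elim Suc_floor_sqrt_power2_gt[of k] by (intro le) auto
      moreover have "real (floor_sqrt k ^ 2) \<le> real k"
        using floor_sqrt_power2_le[of k] by (simp only: of_nat_le_iff)
      ultimately have "e k / real k \<le> e (Suc (floor_sqrt k) ^ 2) / real (floor_sqrt k ^ 2)"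
        using n e_nonneg by (intro frac_le) auto
      then show ?case by simp
    qed
  qed
qed

section \<open>The exit times as a Markov renewal process\<close>

context free_product
begin

text \<open>The expectation of \<open>f \<tau> e\<close>, where \<open>e\<close> is the \<open>k\<close>-th exit time and \<open>\<tau>\<close> the type of the word reached there.
  For \<open>k = 0\<close> both are \<open>0\<close>.\<close>

definition Phi :: "nat \<Rightarrow> (nat \<Rightarrow> nat \<Rightarrow> ennreal) \<Rightarrow> ennreal" where
  "Phi k f = (\<Sum>\<^sup>+x. if x \<in> words D \<and> length x = k then \<Sum>\<^sup>+t. ent x t * (ennreal (stay (ltype x)) * f (ltype x) t) else 0)"

lemma Phi_0: "Phi 0 f = f 0 0"
proof -
  have "Phi 0 f = (\<Sum>\<^sup>+t. ent [] t * (ennreal (stay 0) * f 0 t))"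
    unfolding Phi_def by (subst csum_single[of "[]"]) auto
  also have "\<dots> = f 0 0"
    by (subst csum_single[of 0]) (auto simp: ent_Nil stay_0)
  finally show ?thesis .
qed

text \<open>A word of length \<open>k + 1\<close> is a word of length \<open>k\<close> with a letter of another type appended; the entrances
  are related by \<open>ent_renewal\<close>.\<close>

lemma Phi_Suc:
  "Phi (Suc k) f = (\<Sum>\<^sup>+x. if x \<in> words D \<and> length x = k then \<Sum>\<^sup>+t. ent x t *
     (\<Sum>j\<in>indices D - {ltype x}. \<Sum>\<^sup>+n. Kn (ltype x) j n * (ennreal (stay j) * f j (Suc (t + n)))) else 0)"
proof -
  define F where "F y = (if y \<in> words D \<and> length y = Suc k then \<Sum>\<^sup>+t. ent y t * (ennreal (stay (ltype y)) * f (ltype y) t) else 0)" for y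
  have "Phi (Suc k) f = csum F" unfolding Phi_def F_def ..
  also have "\<dots> = (\<Sum>\<^sup>+p. if p \<in> UNIV then F ((\<lambda>(x, s). x @ [s]) p) else 0)"
  proof (rule csum_reindex)
    fix y assume "y \<notin> range (\<lambda>(x, s). x @ [s :: 'a])"
    then have "y = []" by (metis (mono_tags, lifting) case_prod_conv rangeI rev_exhaust)
    then show "F y = 0" by (simp add: F_def)
  qed (auto simp: inj_on_def)
  also have "\<dots> = (\<Sum>\<^sup>+x. \<Sum>\<^sup>+s. F (x @ [s]))" by (simp add: csum_pair case_prod_unfold)
  also have "\<dots> = (\<Sum>\<^sup>+x. if x \<in> words D \<and> length x = k then \<Sum>\<^sup>+t. ent x t *
     (\<Sum>j\<in>indices D - {ltype x}. \<Sum>\<^sup>+n. Kn (ltype x) j n * (ennreal (stay j) * f j (Suc (t + n)))) else 0)"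
  proof (rule csum_cong)
    fix x
    let ?i = "ltype x" and ?\<phi> = "\<lambda>j t. ennreal (stay j) * f j t"
    show "(\<Sum>\<^sup>+s. F (x @ [s])) = (if x \<in> words D \<and> length x = k then \<Sum>\<^sup>+t. ent x t *
     (\<Sum>j\<in>indices D - {?i}. \<Sum>\<^sup>+n. Kn ?i j n * ?\<phi> j (Suc (t + n))) else 0)"
    proof (cases "x \<in> words D \<and> length x = k")
      case True
      then have x: "x \<in> words D" "length x = k" by auto
      have Fs: "F (x @ [s]) = (\<Sum>j\<in>indices D - {?i}. if s \<in> Vx j then \<Sum>\<^sup>+n. ent (x @ [s]) (Suc n) * ?\<phi> j (Suc n) else 0)" for s
      proof (cases "\<exists>j\<in>indices D - {?i}. s \<in> Vx j")
        case True
        then obtain j where j: "j \<in> indices D - {?i}" "s \<in> Vx j" by blast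
        have eq: "s \<in> Vx l \<longleftrightarrow> l = j" for l using Vx_unique j by blast
        have w: "x @ [s] \<in> words D"
          using j eq by (auto simp: append_word_iff[OF x(1)] Avoid_def singleton_words)
        have "F (x @ [s]) = (\<Sum>\<^sup>+n. ent (x @ [s]) (Suc n) * ?\<phi> j (Suc n))"
          unfolding F_def using w x ltype_snoc[OF j(2), of x] by (simp add: csum_nat_Suc[of "\<lambda>t. ent (x @ [s]) t * _ t"] ent_0)
        then show ?thesis unfolding eq using j by simp
      next
        case False
        have "x @ [s] \<notin> words D"
        proof
          assume "x @ [s] \<in> words D"
          then have "[s] \<in> Avoid ?i" using append_word_iff[OF x(1)] by simp
          then obtain j where "s \<in> Vx j" "s \<notin> Vx ?i" by (auto simp: Avoid_def singleton_words)
          then show False using False in_VxD by blast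
        qed
        then show ?thesis using False by (simp add: F_def)
      qed
      have "(\<Sum>\<^sup>+s. F (x @ [s])) = (\<Sum>j\<in>indices D - {?i}. \<Sum>\<^sup>+s. if s \<in> Vx j then \<Sum>\<^sup>+n. ent (x @ [s]) (Suc n) * ?\<phi> j (Suc n) else 0)"
        unfolding Fs by (rule csum_sum)
      also have "\<dots> = (\<Sum>j\<in>indices D - {?i}. \<Sum>\<^sup>+t. ent x t * (\<Sum>\<^sup>+n. Kn ?i j n * ?\<phi> j (Suc (t + n))))"
      proof (intro sum.cong refl)
        fix j assume j: "j \<in> indices D - {?i}"
        have "(\<Sum>\<^sup>+s. if s \<in> Vx j then \<Sum>\<^sup>+n. ent (x @ [s]) (Suc n) * ?\<phi> j (Suc n) else 0) =
          (\<Sum>\<^sup>+s. \<Sum>\<^sup>+n. (if s \<in> Vx j then ent (x @ [s]) (Suc n) else 0) * ?\<phi> j (Suc n))"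
          by (intro csum_cong) simp
        also have "\<dots> = (\<Sum>\<^sup>+n. (\<Sum>\<^sup>+s. if s \<in> Vx j then ent (x @ [s]) (Suc n) else 0) * ?\<phi> j (Suc n))"
          by (subst csum_swap) (simp add: csum_multc)
        also have "\<dots> = (\<Sum>\<^sup>+n. \<Sum>t\<le>n. ent x t * (Kn ?i j (n - t) * ?\<phi> j (Suc (t + (n - t)))))"
          unfolding ent_renewal[OF x(1) j] sum_distrib_right
          by (intro csum_cong sum.cong refl) (simp add: mult.assoc)
        also have "\<dots> = (\<Sum>\<^sup>+t. \<Sum>\<^sup>+n. ent x t * (Kn ?i j n * ?\<phi> j (Suc (t + n))))"
          by (rule csum_conv)
        finally show "(\<Sum>\<^sup>+s. if s \<in> Vx j then \<Sum>\<^sup>+n. ent (x @ [s]) (Suc n) * ?\<phi> j (Suc n) else 0) =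
          (\<Sum>\<^sup>+t. ent x t * (\<Sum>\<^sup>+n. Kn ?i j n * ?\<phi> j (Suc (t + n))))"
          by (simp add: csum_cmult)
      qed
      also have "\<dots> = (\<Sum>\<^sup>+t. ent x t * (\<Sum>j\<in>indices D - {?i}. \<Sum>\<^sup>+n. Kn ?i j n * ?\<phi> j (Suc (t + n))))"
        by (simp add: csum_sum sum_distrib_left)
      finally show ?thesis using True by simp
    next
      case False
      have "F (x @ [s]) = 0" for s using False by (auto simp: F_def words_append_iff)
      then have "(\<Sum>\<^sup>+s. F (x @ [s])) = 0" by (rule csum_zero)
      then show ?thesis by (simp only: False if_False)
    qed
  qed
  finally show ?thesis .
qed

lemma Phi_mono: "(\<And>i t. i = 0 \<or> i \<in> indices D \<Longrightarrow> f i t \<le> f' i t) \<Longrightarrow> Phi k f \<le> Phi k f'"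
  unfolding Phi_def
proof (rule csum_mono)
  fix x assume f: "\<And>i t. i = 0 \<or> i \<in> indices D \<Longrightarrow> f i t \<le> f' i t"
  have "ltype x = 0 \<or> ltype x \<in> indices D" if "x \<in> words D" using ltype_in[OF that] by (cases "x = []") auto
  then show "(if x \<in> words D \<and> length x = k then \<Sum>\<^sup>+t. ent x t * (ennreal (stay (ltype x)) * f (ltype x) t) else 0)
    \<le> (if x \<in> words D \<and> length x = k then \<Sum>\<^sup>+t. ent x t * (ennreal (stay (ltype x)) * f' (ltype x) t) else 0)"
    by (auto intro!: csum_mono mult_left_mono f)
qed

lemma Phi_add: "Phi k (\<lambda>i t. f i t + f' i t) = Phi k f + Phi k f'"
  unfolding Phi_def by (subst csum_add[symmetric], intro csum_cong) (simp add: distrib_left csum_add)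

lemma Phi_cmult: "Phi k (\<lambda>i t. r * f i t) = r * Phi k f"
  unfolding Phi_def by (subst csum_cmult[symmetric], intro csum_cong) (simp add: csum_cmult[symmetric] ac_simps)

text \<open>A one-step computation with the increments, conditionally on the current type, suffices to compute
  \<open>Phi (Suc k)\<close> from \<open>Phi k\<close>.\<close>

lemma Phi_step:
  assumes "\<And>i t. i = 0 \<or> i \<in> indices D \<Longrightarrow>
    (\<Sum>j\<in>indices D - {i}. \<Sum>\<^sup>+n. Kn i j n * (ennreal (stay j) * f j (Suc (t + n)))) = ennreal (stay i) * f' i t"
  shows "Phi (Suc k) f = Phi k f'"
  unfolding Phi_Suc unfolding Phi_def
proof (rule csum_cong)
  fix x
  have "ltype x = 0 \<or> ltype x \<in> indices D" if "x \<in> words D" using ltype_in[OF that] by (cases "x = []") auto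
  then show "(if x \<in> words D \<and> length x = k then \<Sum>\<^sup>+t. ent x t *
     (\<Sum>j\<in>indices D - {ltype x}. \<Sum>\<^sup>+n. Kn (ltype x) j n * (ennreal (stay j) * f j (Suc (t + n)))) else 0) =
     (if x \<in> words D \<and> length x = k then \<Sum>\<^sup>+t. ent x t * (ennreal (stay (ltype x)) * f' (ltype x) t) else 0)"
    by (simp add: assms)
qed

text \<open>Almost surely the walk exits at every level, hence it is transient.\<close>

lemma Phi_total_mass:
  assumes g1: "regular 1"
  shows "Phi k (\<lambda>_ _. 1) = 1"
proof (induction k)
  case (Suc k)
  have "Phi (Suc k) (\<lambda>_ _. 1) = Phi k (\<lambda>_ _. 1)"
  proof (rule Phi_step)
    fix i :: nat assume i: "i = 0 \<or> i \<in> indices D"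
    have "(\<Sum>j\<in>indices D - {i}. \<Sum>\<^sup>+n. Kn i j n * (ennreal (stay j) * 1)) = (\<Sum>j\<in>indices D - {i}. ennreal (stay j * enn2real (Kf i j 1)))"
    proof (intro sum.cong refl)
      fix j assume j: "j \<in> indices D - {i}"
      have "(\<Sum>\<^sup>+n. Kn i j n * (ennreal (stay j) * 1)) = Kf i j 1 * ennreal (stay j)"
        by (simp add: Kf_def csum_multc)
      also have "\<dots> = ennreal (stay j * enn2real (Kf i j 1))"
        using regular_Kf(1)[OF g1, of j i] stay_pos[OF g1, of j] j by (simp add: ennreal_mult mult.commute)
      finally show "(\<Sum>\<^sup>+n. Kn i j n * (ennreal (stay j) * 1)) = ennreal (stay j * enn2real (Kf i j 1))" .
    qed
    also have "\<dots> = ennreal (\<Sum>j\<in>indices D - {i}. stay j * enn2real (Kf i j 1))"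
      using stay_pos[OF g1] by (intro sum_ennreal) (simp add: less_imp_le)
    finally show "(\<Sum>j\<in>indices D - {i}. \<Sum>\<^sup>+n. Kn i j n * (ennreal (stay j) * 1)) = ennreal (stay i) * 1"
      by (simp add: stochastic[OF g1 i])
  qed
  then show ?case using Suc by simp
qed (simp add: Phi_0)

end


context free_product
begin

text \<open>The increments have exponential moments, because the series still converges to the right of \<open>1\<close>.\<close>

lemma Kr_summable_sq:
  assumes ev: "eventually regular (nhds 1)" and j: "j \<in> indices D" and ij: "i \<noteq> j"
  shows "summable (\<lambda>n. Kr i j n * (real (Suc n))\<^sup>2)"
proof -
  have g1: "regular 1" using eventually_nhds_x_imp_x[OF ev] .
  obtain z1 where z1: "z1 > 1" "regular z1" using eventually_regular_above[OF ev] by blast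
  have s: "summable (\<lambda>n. Kr i j n * z1 ^ Suc n)" using sums_summable[OF Kr_sums[OF g1 j ij z1(2)]] .
  have "(\<lambda>n. (real (Suc n))\<^sup>2 * (1 / z1) ^ Suc n) \<longlonglongrightarrow> 0" using z1(1) by real_asymp
  then have "Bseq (\<lambda>n. (real (Suc n))\<^sup>2 * (1 / z1) ^ Suc n)" by (intro convergent_imp_Bseq convergentI)
  then obtain B where B: "B > 0" "\<And>n. norm ((real (Suc n))\<^sup>2 * (1 / z1) ^ Suc n) \<le> B" by (rule BseqE) blast
  show ?thesis
  proof (rule summable_comparison_test')
    show "summable (\<lambda>n. B * (Kr i j n * z1 ^ Suc n))" using s by (rule summable_mult)
    fix n
    have "(real (Suc n))\<^sup>2 = (real (Suc n))\<^sup>2 * (1 / z1) ^ Suc n * z1 ^ Suc n"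
      using z1(1) by (simp add: power_divide)
    also have "\<dots> \<le> B * z1 ^ Suc n" using B(2)[of n] z1(1) by (intro mult_right_mono) auto
    finally have "Kr i j n * (real (Suc n))\<^sup>2 \<le> Kr i j n * (B * z1 ^ Suc n)"
      by (rule mult_left_mono) (rule Kr_nonneg)
    then show "norm (Kr i j n * (real (Suc n))\<^sup>2) \<le> B * (Kr i j n * z1 ^ Suc n)"
      by (simp add: Kr_nonneg ac_simps)
  qed
qed

lemma Kr_summable:
  assumes "eventually regular (nhds 1)" "j \<in> indices D" "i \<noteq> j"
  shows "summable (\<lambda>n. Kr i j n)" "summable (\<lambda>n. Kr i j n * real (Suc n))"
proof -
  note s2 = Kr_summable_sq[OF assms]
  show "summable (\<lambda>n. Kr i j n)"
  proof (rule summable_comparison_test'[OF s2])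
    fix n
    have "Kr i j n * 1 \<le> Kr i j n * (real (Suc n))\<^sup>2" by (intro mult_left_mono Kr_nonneg) simp
    then show "norm (Kr i j n) \<le> Kr i j n * (real (Suc n))\<^sup>2" using Kr_nonneg by simp
  qed
  show "summable (\<lambda>n. Kr i j n * real (Suc n))"
  proof (rule summable_comparison_test'[OF s2])
    fix n
    have "Kr i j n * real (Suc n) \<le> Kr i j n * (real (Suc n))\<^sup>2"
      by (intro mult_left_mono Kr_nonneg) (simp add: power2_eq_square)
    then show "norm (Kr i j n * real (Suc n)) \<le> Kr i j n * (real (Suc n))\<^sup>2" using Kr_nonneg by simp
  qed
qed

text \<open>By the Poisson equation \<open>Y k = e k - k * L + h (\<tau> k)\<close> is a martingale. Its increments have bounded second
  moments, so the second moment of \<open>Y k\<close> grows at most linearly.\<close>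

lemma Phi_second_moment:
  fixes h :: "nat \<Rightarrow> real" and L :: real
  assumes ev: "eventually regular (nhds 1)"
    and pois: "\<And>i. i = 0 \<or> i \<in> indices D \<Longrightarrow>
      stay i * h i = (\<Sum>j\<in>indices D - {i}. stay j * (\<Sum>n. Kr i j n * (real (Suc n) - L + h j)))"
  obtains C where "C \<ge> 0" "\<And>k. Phi k (\<lambda>i t. ennreal ((real t - real k * L + h i)\<^sup>2)) \<le> ennreal (C * real (Suc k))"
proof -
  have g1: "regular 1" using eventually_nhds_x_imp_x[OF ev] .
  define d where "d i j n = real (Suc n) - L + h j - h i" for i j n
  define S0 where "S0 i j = (\<Sum>n. Kr i j n)" for i j
  define S1 where "S1 i j = (\<Sum>n. Kr i j n * d i j n)" for i j
  define S2 where "S2 i j = (\<Sum>n. Kr i j n * (d i j n)\<^sup>2)" for i j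
  have sums: "summable (\<lambda>n. Kr i j n)" "summable (\<lambda>n. Kr i j n * real (Suc n))"
    "summable (\<lambda>n. Kr i j n * (real (Suc n))\<^sup>2)" if "j \<in> indices D" "i \<noteq> j" for i j
    by (rule Kr_summable[OF ev that] Kr_summable_sq[OF ev that])+
  have d_sums: "(\<lambda>n. Kr i j n * (real (Suc n) + b)) sums ((\<Sum>n. Kr i j n * real (Suc n)) + S0 i j * b)"
    "(\<lambda>n. Kr i j n * (real (Suc n) + b)\<^sup>2) sums
      ((\<Sum>n. Kr i j n * (real (Suc n))\<^sup>2) + 2 * b * (\<Sum>n. Kr i j n * real (Suc n)) + b\<^sup>2 * S0 i j)"
    if "j \<in> indices D" "i \<noteq> j" for i j b
  proof -
    note s = sums[OF that, THEN summable_sums]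
    show "(\<lambda>n. Kr i j n * (real (Suc n) + b)) sums ((\<Sum>n. Kr i j n * real (Suc n)) + S0 i j * b)"
      using sums_add[OF s(2) sums_mult2[OF s(1), of b]] by (simp add: S0_def distrib_left)
    show "(\<lambda>n. Kr i j n * (real (Suc n) + b)\<^sup>2) sums
      ((\<Sum>n. Kr i j n * (real (Suc n))\<^sup>2) + 2 * b * (\<Sum>n. Kr i j n * real (Suc n)) + b\<^sup>2 * S0 i j)"
      using sums_add[OF sums_add[OF s(3) sums_mult[OF s(2), of "2 * b"]] sums_mult[OF s(1), of "b\<^sup>2"]]
      by (simp only: S0_def) (rule sums_cong[THEN iffD1, rotated], assumption, simp add: power2_eq_square algebra_simps)
  qed
  have S: "(\<lambda>n. Kr i j n * d i j n) sums S1 i j" "(\<lambda>n. Kr i j n * (d i j n)\<^sup>2) sums S2 i j"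
    if "j \<in> indices D" "i \<noteq> j" for i j
    using sums_summable[OF d_sums(1)[OF that, of "h j - h i - L"]] sums_summable[OF d_sums(2)[OF that, of "h j - h i - L"]]
    by (simp_all add: S1_def S2_def d_def algebra_simps summable_sums)
  have S0_tot: "(\<Sum>j\<in>indices D - {i}. stay j * S0 i j) = stay i" if i: "i = 0 \<or> i \<in> indices D" for i
  proof -
    have "S0 i j = enn2real (Kf i j 1)" if "j \<in> indices D - {i}" for j
      using Kr_sums[OF g1 _ _ g1, of j i] that by (simp add: S0_def sums_iff)
    then show ?thesis using stochastic[OF g1 i] by simp
  qed
  \<comment> \<open>the martingale property: the increment of \<open>Y\<close> has mean zero given the type\<close>
  have S1_tot: "(\<Sum>j\<in>indices D - {i}. stay j * S1 i j) = 0" if i: "i = 0 \<or> i \<in> indices D" for i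
  proof -
    have "S1 i j = (\<Sum>n. Kr i j n * (real (Suc n) - L + h j)) - h i * S0 i j" if j: "j \<in> indices D - {i}" for j
    proof -
      have "(\<lambda>n. Kr i j n * (real (Suc n) - L + h j)) sums (\<Sum>n. Kr i j n * (real (Suc n) - L + h j))"
        using sums_summable[OF d_sums(1)[of j i "h j - L"]] j by (simp add: algebra_simps summable_sums)
      from sums_diff[OF this sums_mult[OF summable_sums[OF sums(1)[of j i]], of "h i"]]
      have "(\<lambda>n. Kr i j n * d i j n) sums ((\<Sum>n. Kr i j n * (real (Suc n) - L + h j)) - h i * S0 i j)"
        using j by (simp add: S0_def d_def algebra_simps)
      then show ?thesis using S(1)[of j i] j sums_unique2 by blast
    qed
    then have "(\<Sum>j\<in>indices D - {i}. stay j * S1 i j) =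
      (\<Sum>j\<in>indices D - {i}. stay j * (\<Sum>n. Kr i j n * (real (Suc n) - L + h j))) - h i * (\<Sum>j\<in>indices D - {i}. stay j * S0 i j)"
      by (simp add: sum_subtractf[symmetric] sum_distrib_left right_diff_distrib ac_simps)
    then show ?thesis using pois[OF i] S0_tot[OF i] by (metis diff_self mult.commute)
  qed
  have sgp: "stay i > 0" if "i = 0 \<or> i \<in> indices D" for i using that stay_pos[OF g1] stay_0 by auto
  define vr where "vr i = (\<Sum>j\<in>indices D - {i}. stay j * S2 i j) / stay i" for i
  have S2_nonneg: "S2 i j \<ge> 0" if "j \<in> indices D" "i \<noteq> j" for i j
    unfolding S2_def by (intro suminf_nonneg sums_summable[OF S(2)[OF that]] mult_nonneg_nonneg Kr_nonneg) auto
  have vr_nonneg: "vr i \<ge> 0" if "i = 0 \<or> i \<in> indices D" for i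
    unfolding vr_def using sgp[OF that] sgp S2_nonneg
    by (intro divide_nonneg_pos sum_nonneg mult_nonneg_nonneg) (auto simp: less_imp_le)
  define C where "C = (h 0)\<^sup>2 + (\<Sum>i\<in>insert 0 (indices D). vr i)"
  have vr_le: "vr i \<le> C" if i: "i = 0 \<or> i \<in> indices D" for i
  proof -
    have "vr i \<le> (\<Sum>i\<in>insert 0 (indices D). vr i)"
      using i vr_nonneg by (intro member_le_sum) (auto simp del: sum.insert)
    then show ?thesis unfolding C_def by (simp add: add_increasing del: sum.insert)
  qed
  have C0: "C \<ge> 0" using vr_le[of 0] vr_nonneg[of 0] by linarith
  have step: "Phi (Suc k) (\<lambda>i t. ennreal ((real t - real (Suc k) * L + h i)\<^sup>2)) =
      Phi k (\<lambda>i t. ennreal ((real t - real k * L + h i)\<^sup>2) + ennreal (vr i))" for k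
  proof (rule Phi_step)
    fix i t :: nat assume i: "i = 0 \<or> i \<in> indices D"
    \<comment> \<open>\<open>y\<close> is the current value of \<open>Y\<close>, and \<open>d i j n\<close> its increment\<close>
    define y where "y = real t - real k * L + h i"
    have inner: "(\<Sum>\<^sup>+n. Kn i j n * (ennreal (stay j) * ennreal ((real (Suc (t + n)) - real (Suc k) * L + h j)\<^sup>2))) =
        ennreal (stay j * (y\<^sup>2 * S0 i j + 2 * y * S1 i j + S2 i j))"
      and inner_nonneg: "0 \<le> stay j * (y\<^sup>2 * S0 i j + 2 * y * S1 i j + S2 i j)"
      if j: "j \<in> indices D - {i}" for j
    proof -
      have j': "j \<in> indices D" "i \<noteq> j" using j by auto
      have sj: "stay j \<ge> 0" using sgp[of j] j' by simp
      have yd: "real (Suc (t + n)) - real (Suc k) * L + h j = y + d i j n" for n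
        by (simp add: y_def d_def algebra_simps)
      have "(\<lambda>n. stay j * (y\<^sup>2 * Kr i j n + 2 * y * (Kr i j n * d i j n) + Kr i j n * (d i j n)\<^sup>2)) sums
          (stay j * (y\<^sup>2 * S0 i j + 2 * y * S1 i j + S2 i j))"
        unfolding S0_def by (intro sums_mult sums_add S j' summable_sums[OF sums(1)[OF j']])
      then have su: "(\<lambda>n. Kr i j n * (stay j * (y + d i j n)\<^sup>2)) sums (stay j * (y\<^sup>2 * S0 i j + 2 * y * S1 i j + S2 i j))"
        by (rule sums_cong[THEN iffD1, rotated]) (simp add: power2_eq_square algebra_simps)
      have "(\<Sum>\<^sup>+n. Kn i j n * (ennreal (stay j) * ennreal ((real (Suc (t + n)) - real (Suc k) * L + h j)\<^sup>2))) =
        (\<Sum>\<^sup>+n. ennreal (Kr i j n * (stay j * (y + d i j n)\<^sup>2)))"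
        unfolding yd using Kn_finite[OF g1 j'] sj by (intro csum_cong) (simp add: ennreal_mult Kr_nonneg)
      also have "\<dots> = ennreal (stay j * (y\<^sup>2 * S0 i j + 2 * y * S1 i j + S2 i j))"
        unfolding csum_nat by (rule suminf_ennreal_eq[OF _ su]) (simp add: Kr_nonneg sj)
      finally show "(\<Sum>\<^sup>+n. Kn i j n * (ennreal (stay j) * ennreal ((real (Suc (t + n)) - real (Suc k) * L + h j)\<^sup>2))) =
        ennreal (stay j * (y\<^sup>2 * S0 i j + 2 * y * S1 i j + S2 i j))" .
      show "0 \<le> stay j * (y\<^sup>2 * S0 i j + 2 * y * S1 i j + S2 i j)"
        by (rule sums_le[OF _ sums_zero su]) (simp add: Kr_nonneg sj)
    qed
    have "(\<Sum>j\<in>indices D - {i}. \<Sum>\<^sup>+n. Kn i j n * (ennreal (stay j) * ennreal ((real (Suc (t + n)) - real (Suc k) * L + h j)\<^sup>2))) =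
        (\<Sum>j\<in>indices D - {i}. ennreal (stay j * (y\<^sup>2 * S0 i j + 2 * y * S1 i j + S2 i j)))"
      by (intro sum.cong refl inner)
    also have "\<dots> = ennreal (\<Sum>j\<in>indices D - {i}. stay j * (y\<^sup>2 * S0 i j + 2 * y * S1 i j + S2 i j))"
      by (intro sum_ennreal inner_nonneg)
    also have "(\<Sum>j\<in>indices D - {i}. stay j * (y\<^sup>2 * S0 i j + 2 * y * S1 i j + S2 i j)) =
        y\<^sup>2 * (\<Sum>j\<in>indices D - {i}. stay j * S0 i j) + 2 * y * (\<Sum>j\<in>indices D - {i}. stay j * S1 i j) + (\<Sum>j\<in>indices D - {i}. stay j * S2 i j)"
      by (simp add: sum.distrib sum_distrib_left algebra_simps)
    also have "\<dots> = stay i * (y\<^sup>2 + vr i)"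
      unfolding S0_tot[OF i] S1_tot[OF i] vr_def using sgp[OF i] by (simp add: field_simps)
    also have "ennreal \<dots> = ennreal (stay i) * (ennreal (y\<^sup>2) + ennreal (vr i))"
      using sgp[OF i] vr_nonneg[OF i] by (simp add: ennreal_mult ennreal_plus)
    finally show "(\<Sum>j\<in>indices D - {i}. \<Sum>\<^sup>+n. Kn i j n * (ennreal (stay j) * ennreal ((real (Suc (t + n)) - real (Suc k) * L + h j)\<^sup>2))) =
      ennreal (stay i) * (ennreal ((real t - real k * L + h i)\<^sup>2) + ennreal (vr i))"
      by (simp add: y_def)
  qed
  have "Phi k (\<lambda>i t. ennreal ((real t - real k * L + h i)\<^sup>2)) \<le> ennreal (C * real (Suc k))" for k
  proof (induction k)
    case 0
    have "(h 0)\<^sup>2 \<le> C" unfolding C_def using vr_nonneg by (intro add_increasing2 sum_nonneg) auto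
    then show ?case by (simp add: Phi_0 ennreal_leI)
  next
    case (Suc k)
    have "Phi (Suc k) (\<lambda>i t. ennreal ((real t - real (Suc k) * L + h i)\<^sup>2)) \<le>
      Phi k (\<lambda>i t. ennreal ((real t - real k * L + h i)\<^sup>2) + ennreal C * 1)"
      unfolding step by (intro Phi_mono add_left_mono) (simp add: ennreal_leI vr_le)
    also have "\<dots> = Phi k (\<lambda>i t. ennreal ((real t - real k * L + h i)\<^sup>2)) + ennreal C"
      unfolding Phi_add Phi_cmult by (simp add: Phi_total_mass[OF g1])
    also have "\<dots> \<le> ennreal (C * real (Suc k)) + ennreal C" by (intro add_right_mono Suc.IH)
    also have "\<dots> = ennreal (C * real (Suc (Suc k)))"
      using C0 by (simp add: ennreal_plus[symmetric] algebra_simps del: ennreal_plus)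
    finally show ?case .
  qed
  then show ?thesis using that C0 by blast
qed

end

section \<open>The law of large numbers for the exit times\<close>

context free_product_walk
begin

text \<open>The first \<open>length x\<close> letters are constant from time \<open>m\<close> on, but they are different at time \<open>m - 1\<close>, which
  lies outside the cone.\<close>

lemma exit_time_eq:
  assumes w: "\<omega> \<in> exit_event x m" and m: "m > 0"
  shows "exit_time Z (length x) \<omega> = m" "Z m \<omega> = x"
    "\<And>n. n \<ge> m \<Longrightarrow> take (length x) (Z n \<omega>) = x"
proof -
  show Zm: "Z m \<omega> = x" using w by (simp add: exit_event_def)
  show tk: "take (length x) (Z n \<omega>) = x" if "n \<ge> m" for n
    using w that by (auto simp: exit_event_def Cone_def)
  show "exit_time Z (length x) \<omega> = m"
    unfolding exit_time_def
  proof (rule Least_equality)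
    show "m \<ge> 1 \<and> (\<forall>n\<ge>m. take (length x) (Z n \<omega>) = take (length x) (Z m \<omega>))"
      using m tk by simp
  next
    fix m' assume m': "m' \<ge> 1 \<and> (\<forall>n\<ge>m'. take (length x) (Z n \<omega>) = take (length x) (Z m' \<omega>))"
    show "m \<le> m'"
    proof (rule ccontr)
      assume "\<not> m \<le> m'"
      then have "take (length x) (Z (m - 1) \<omega>) = take (length x) (Z m \<omega>)" using m' by (metis Suc_diff_1 less_Suc_eq_le m not_le nat_less_le)
      then have "Z (m - 1) \<omega> = x @ drop (length x) (Z (m - 1) \<omega>)" using tk[of m] by (metis append_take_drop_id order_refl)
      moreover have "Z (m - 1) \<omega> \<in> words D" using w Z_words by (simp add: exit_event_def)
      ultimately have "Z (m - 1) \<omega> \<in> Cone x" by (auto simp: Cone_def)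
      then show False using w by (simp add: exit_event_def)
    qed
  qed
qed

definition exit_idx :: "nat \<Rightarrow> (nat \<Rightarrow> nat \<Rightarrow> bool) \<Rightarrow> ('a list \<times> nat) set" where
  "exit_idx k Q = {(x, t). x \<in> words D \<and> length x = k \<and> t > 0 \<and> Q (ltype x) t}"

definition exit_set :: "nat \<Rightarrow> (nat \<Rightarrow> nat \<Rightarrow> bool) \<Rightarrow> 'w set" where
  "exit_set k Q = (\<Union>p\<in>exit_idx k Q. exit_event (fst p) (snd p))"

lemma exit_set_sets: "exit_set k Q \<in> sets M" and
  emeasure_exit_set: "k > 0 \<Longrightarrow> emeasure M (exit_set k Q) = Phi k (\<lambda>i t. if Q i t then 1 else 0)"
proof -
  have cnt: "countable (exit_idx k Q)"
    by (rule countable_subset[of _ "words D \<times> UNIV"]) (auto simp: exit_idx_def countable_words)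
  show "exit_set k Q \<in> sets M"
    unfolding exit_set_def using exit_event_sets by (intro sets.countable_UN' cnt) auto
  assume k: "k > 0"
  have disj: "disjoint_family_on (\<lambda>p. exit_event (fst p) (snd p)) (exit_idx k Q)"
    unfolding disjoint_family_on_def
  proof (intro ballI impI)
    fix p p' assume p: "p \<in> exit_idx k Q" "p' \<in> exit_idx k Q" "p \<noteq> p'"
    show "exit_event (fst p) (snd p) \<inter> exit_event (fst p') (snd p') = {}"
    proof (rule ccontr)
      assume "exit_event (fst p) (snd p) \<inter> exit_event (fst p') (snd p') \<noteq> {}"
      then obtain \<omega> where w: "\<omega> \<in> exit_event (fst p) (snd p)" "\<omega> \<in> exit_event (fst p') (snd p')" by blast
      have "snd p > 0" "snd p' > 0" "length (fst p) = length (fst p')" using p by (auto simp: exit_idx_def)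
      then have "snd p = snd p'" "fst p = fst p'"
        using exit_time_eq[OF w(1)] exit_time_eq[OF w(2)] by metis+
      then show False using p(3) by (simp add: prod_eq_iff)
    qed
  qed
  have "emeasure M (exit_set k Q) = (\<integral>\<^sup>+p. emeasure M (exit_event (fst p) (snd p)) \<partial>count_space (exit_idx k Q))"
    unfolding exit_set_def by (rule emeasure_UN_countable[OF exit_event_sets cnt disj])
  also have "\<dots> = (\<Sum>\<^sup>+p. if p \<in> exit_idx k Q then ent (fst p) (snd p) * ennreal (stay (ltype (fst p))) else 0)"
    unfolding csum_def
    by (subst nn_integral_count_space_indicator)
       (auto simp: exit_idx_def emeasure_exit_event intro!: nn_integral_cong split: split_indicator)
  also have "\<dots> = (\<Sum>\<^sup>+x. \<Sum>\<^sup>+t. if (x, t) \<in> exit_idx k Q then ent x t * ennreal (stay (ltype x)) else 0)"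
    by (simp add: csum_pair)
  also have "\<dots> = Phi k (\<lambda>i t. if Q i t then 1 else 0)"
    unfolding Phi_def
  proof (rule csum_cong)
    fix x
    show "(\<Sum>\<^sup>+t. if (x, t) \<in> exit_idx k Q then ent x t * ennreal (stay (ltype x)) else 0) =
      (if x \<in> words D \<and> length x = k then \<Sum>\<^sup>+t. ent x t * (ennreal (stay (ltype x)) * (if Q (ltype x) t then 1 else 0)) else 0)"
    proof (cases "x \<in> words D \<and> length x = k")
      case True
      have "ent x t = 0" if "\<not> t > 0" for t using that True k by (auto simp: ent_0)
      then have "(if (x, t) \<in> exit_idx k Q then ent x t * ennreal (stay (ltype x)) else 0) =
        ent x t * (ennreal (stay (ltype x)) * (if Q (ltype x) t then 1 else 0))" for t
        using True by (auto simp: exit_idx_def)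
      then show ?thesis using True by simp
    next
      case False
      then show ?thesis by (auto simp: exit_idx_def intro: csum_zero)
    qed
  qed
  finally show "emeasure M (exit_set k Q) = Phi k (\<lambda>i t. if Q i t then 1 else 0)" .
qed

text \<open>Chebyshev's inequality bounds the probability of a deviation of order \<open>k\<close> by a multiple of \<open>1 / k\<close>.
  Along the squares this is summable, and Borel-Cantelli applies; monotonicity of the exit times fills
  the gaps.\<close>

lemma exit_time_limit:
  fixes h :: "nat \<Rightarrow> real" and L :: real
  assumes ev: "eventually regular (nhds 1)"
    and pois: "\<And>i. i = 0 \<or> i \<in> indices D \<Longrightarrow>
      stay i * h i = (\<Sum>j\<in>indices D - {i}. stay j * (\<Sum>n. Kr i j n * (real (Suc n) - L + h j)))"
  shows "AE \<omega> in M. (\<lambda>k. real (exit_time Z k \<omega>) / real k) \<longlonglongrightarrow> L"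
proof -
  have g1: "regular 1" using eventually_nhds_x_imp_x[OF ev] .
  obtain C where C: "C \<ge> 0" "\<And>k. Phi k (\<lambda>i t. ennreal ((real t - real k * L + h i)\<^sup>2)) \<le> ennreal (C * real (Suc k))"
    using Phi_second_moment[OF ev pois] by blast
  \<comment> \<open>the level is \<open>Suc n ^ 2\<close>, the allowed relative deviation \<open>1 / Suc m\<close>\<close>
  define Bad where "Bad m n = exit_set (Suc n ^ 2) (\<lambda>i t. \<bar>real t - real (Suc n ^ 2) * L + h i\<bar> > real (Suc n ^ 2) / real (Suc m))" for m n
  have bad_bound: "measure M (Bad m n) \<le> 2 * C * (real (Suc m))\<^sup>2 * inverse (real (Suc n) ^ 2)" for m n
  proof -
    let ?k = "Suc n ^ 2" and ?r = "(real (Suc m))\<^sup>2 / (real (Suc n ^ 2))\<^sup>2"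
    let ?y = "\<lambda>i t. real t - real (Suc n ^ 2) * L + h i"
    have kp: "real ?k > 0" by simp
    have "emeasure M (Bad m n) = Phi ?k (\<lambda>i t. if \<bar>?y i t\<bar> > real ?k / real (Suc m) then 1 else 0)"
      unfolding Bad_def by (rule emeasure_exit_set) simp
    also have "\<dots> \<le> Phi ?k (\<lambda>i t. ennreal ?r * ennreal ((?y i t)\<^sup>2))"
    proof (rule Phi_mono)
      fix i t
      show "(if \<bar>?y i t\<bar> > real ?k / real (Suc m) then 1 else 0) \<le> ennreal ?r * ennreal ((?y i t)\<^sup>2)"
      proof (cases "\<bar>?y i t\<bar> > real ?k / real (Suc m)")
        case True
        then have "(real ?k / real (Suc m))\<^sup>2 \<le> (?y i t)\<^sup>2"
          by (metis abs_ge_zero divide_nonneg_nonneg less_imp_le of_nat_0_le_iff power2_abs power_mono)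
        then have "?r * (real ?k / real (Suc m))\<^sup>2 \<le> ?r * (?y i t)\<^sup>2" by (rule mult_left_mono) simp
        moreover have "?r * (real ?k / real (Suc m))\<^sup>2 = 1" using kp by (simp only: power_divide) (simp add: field_simps)
        ultimately have "ennreal 1 \<le> ennreal (?r * (?y i t)\<^sup>2)" by (intro ennreal_leI) simp
        moreover have "ennreal (?r * (?y i t)\<^sup>2) = ennreal ?r * ennreal ((?y i t)\<^sup>2)" by (rule ennreal_mult) simp_all
        ultimately show ?thesis using True by (simp only: if_True ennreal_1)
      qed simp
    qed
    also have "\<dots> \<le> ennreal ?r * ennreal (C * real (Suc ?k))"
      unfolding Phi_cmult by (intro mult_left_mono C(2)) simp
    also have "\<dots> = ennreal (?r * (C * real (Suc ?k)))" using C(1) by (intro ennreal_mult[symmetric]) auto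
    finally have "measure M (Bad m n) \<le> ?r * (C * real (Suc ?k))"
      unfolding emeasure_eq_measure using C(1) by (subst (asm) ennreal_le_iff) auto
    also have "\<dots> \<le> ?r * (C * (2 * real ?k))"
      using C(1) by (intro mult_left_mono) auto
    also have "\<dots> = 2 * C * (real (Suc m))\<^sup>2 * inverse (real (Suc n) ^ 2)"
      by (simp only: of_nat_power) (simp add: field_simps power2_eq_square del: of_nat_Suc)
    finally show ?thesis .
  qed
  have AE_bad: "AE \<omega> in M. \<forall>m. \<forall>\<^sub>F n in sequentially. \<omega> \<notin> Bad m n"
    unfolding AE_all_countable
  proof
    fix m
    have "AE \<omega> in M. \<forall>\<^sub>F n in sequentially. \<omega> \<in> space M - Bad m n"
    proof (rule borel_cantelli_AE1)
      show "Bad m n \<in> sets M" for n unfolding Bad_def by (rule exit_set_sets)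
      show "emeasure M (Bad m n) < \<infinity>" for n by (simp add: emeasure_eq_measure)
      show "summable (\<lambda>n. measure M (Bad m n))"
      proof (rule summable_comparison_test')
        have "summable (\<lambda>n. inverse (real n ^ 2))" by (rule inverse_power_summable) simp
        from iffD2[OF summable_Suc_iff this]
        show "summable (\<lambda>n. 2 * C * (real (Suc m))\<^sup>2 * inverse (real (Suc n) ^ 2))"
          by (rule summable_mult)
      qed (use bad_bound in simp)
    qed
    then show "AE \<omega> in M. \<forall>\<^sub>F n in sequentially. \<omega> \<notin> Bad m n"
      by (rule AE_mp) (auto intro!: AE_I2 elim: eventually_mono)
  qed
  have AE_exit: "AE \<omega> in M. \<forall>k. k > 0 \<longrightarrow> \<omega> \<in> exit_set k (\<lambda>_ _. True)"
    unfolding AE_all_countable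
  proof
    fix k :: nat
    show "AE \<omega> in M. k > 0 \<longrightarrow> \<omega> \<in> exit_set k (\<lambda>_ _. True)"
    proof (cases "k > 0")
      case True
      have "emeasure M (exit_set k (\<lambda>_ _. True)) = 1"
        unfolding emeasure_exit_set[OF True] using Phi_total_mass[OF g1, of k] by simp
      then have "AE \<omega> in M. \<omega> \<in> exit_set k (\<lambda>_ _. True)"
        using exit_set_sets by (intro AE_prob_1) (simp add: measure_def)
      then show ?thesis by simp
    qed simp
  qed
  have limit: "(\<lambda>k. real (exit_time Z k \<omega>) / real k) \<longlonglongrightarrow> L"
    if bad: "\<forall>m. \<forall>\<^sub>F n in sequentially. \<omega> \<notin> Bad m n"
      and ex: "\<forall>k. k > 0 \<longrightarrow> \<omega> \<in> exit_set k (\<lambda>_ _. True)" for \<omega>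
  proof -
    let ?e = "\<lambda>k. real (exit_time Z k \<omega>)"
    have ex': "\<exists>x. x \<in> words D \<and> length x = k \<and> exit_time Z k \<omega> > 0 \<and> \<omega> \<in> exit_event x (exit_time Z k \<omega>)" if k: "k > 0" for k
    proof -
      have "\<omega> \<in> exit_set k (\<lambda>_ _. True)" using ex k by blast
      then obtain p where p: "p \<in> exit_idx k (\<lambda>_ _. True)" "\<omega> \<in> exit_event (fst p) (snd p)"
        unfolding exit_set_def by blast
      obtain x t where "p = (x, t)" by (cases p)
      then have xt: "x \<in> words D" "length x = k" "t > 0" "\<omega> \<in> exit_event x t"
        using p by (simp_all add: exit_idx_def)
      then show ?thesis using exit_time_eq(1)[OF xt(4,3)] by auto
    qed
    have mono: "?e k \<le> ?e (Suc k)" if k: "k \<ge> 1" for k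
    proof -
      obtain x where x: "length x = Suc k" "exit_time Z (Suc k) \<omega> > 0" "\<omega> \<in> exit_event x (exit_time Z (Suc k) \<omega>)"
        using ex'[of "Suc k"] by blast
      let ?m = "exit_time Z (Suc k) \<omega>"
      have tk: "take k (Z n \<omega>) = take k x" if "n \<ge> ?m" for n
        using exit_time_eq(3)[OF x(3,2) that] x(1) by (metis lessI less_imp_le min.absorb1 take_take)
      have "exit_time Z k \<omega> \<le> ?m"
        unfolding exit_time_def[of Z k] using x(2) tk by (intro Least_le) auto
      then show ?thesis by simp
    qed
    define B where "B = (\<Sum>i\<in>insert 0 (indices D). \<bar>h i\<bar>)"
    have hB: "\<bar>h (ltype x)\<bar> \<le> B" if "x \<in> words D" for x
    proof -
      have "ltype x \<in> insert 0 (indices D)" using ltype_in[OF that] by (cases "x = []") auto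
      then show ?thesis unfolding B_def by (intro member_le_sum) (auto simp del: sum.insert)
    qed
    have "(\<lambda>n. ?e (Suc n ^ 2) / real (Suc n ^ 2)) \<longlonglongrightarrow> L"
    proof (rule LIMSEQ_I)
      fix r :: real assume r: "r > 0"
      obtain m where m: "inverse (real (Suc m)) < r / 2" using reals_Archimedean[of "r / 2"] r by auto
      have "(\<lambda>n. B / real (Suc n ^ 2)) \<longlonglongrightarrow> 0" by real_asymp
      then have "\<forall>\<^sub>F n in sequentially. B / real (Suc n ^ 2) < r / 2" using r by (intro order_tendstoD(2)) auto
      then have "\<forall>\<^sub>F n in sequentially. norm (?e (Suc n ^ 2) / real (Suc n ^ 2) - L) < r"
        using spec[OF bad, of m]
      proof eventually_elim
        case (elim n)
        let ?k = "Suc n ^ 2"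
        have kp: "real ?k > 0" by simp
        obtain x where x: "x \<in> words D" "length x = ?k" "exit_time Z ?k \<omega> > 0" "\<omega> \<in> exit_event x (exit_time Z ?k \<omega>)"
          using ex'[of ?k] by auto
        have "\<not> \<bar>?e ?k - real ?k * L + h (ltype x)\<bar> > real ?k / real (Suc m)"
        proof
          assume "\<bar>?e ?k - real ?k * L + h (ltype x)\<bar> > real ?k / real (Suc m)"
          then have "(x, exit_time Z ?k \<omega>) \<in> exit_idx ?k (\<lambda>i t. \<bar>real t - real ?k * L + h i\<bar> > real ?k / real (Suc m))"
            using x by (simp add: exit_idx_def)
          then have "\<omega> \<in> Bad m n" unfolding Bad_def exit_set_def using x(4) by force
          then show False using elim by simp
        qed
        then have "\<bar>?e ?k - real ?k * L\<bar> \<le> real ?k / real (Suc m) + B" using hB[OF x(1)] by linarith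
        then have "\<bar>?e ?k - real ?k * L\<bar> / real ?k \<le> (real ?k / real (Suc m) + B) / real ?k"
          using kp by (intro divide_right_mono) auto
        also have "\<dots> = inverse (real (Suc m)) + B / real ?k" using kp by (simp add: field_simps del: of_nat_Suc of_nat_power)
        also have "\<dots> < r" using m elim by linarith
        finally have "\<bar>?e ?k - real ?k * L\<bar> / real ?k < r" .
        moreover have "?e ?k / real ?k - L = (?e ?k - real ?k * L) / real ?k" using kp by (simp only: diff_divide_distrib) simp
        ultimately show ?case using kp by (simp only: real_norm_def abs_divide abs_of_pos)
      qed
      then show "\<exists>no. \<forall>n\<ge>no. norm (?e (Suc n ^ 2) / real (Suc n ^ 2) - L) < r"
        by (simp only: eventually_sequentially)
    qed
    then have "(\<lambda>n. ?e (n ^ 2) / real (n ^ 2)) \<longlonglongrightarrow> L" by (rule LIMSEQ_imp_Suc)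
    then show "(\<lambda>k. ?e k / real k) \<longlonglongrightarrow> L"
      by (intro mono_squares_imp_limit mono) auto
  qed
  have "AE \<omega> in M. (\<forall>m. \<forall>\<^sub>F n in sequentially. \<omega> \<notin> Bad m n) \<and>
      (\<forall>k. k > 0 \<longrightarrow> \<omega> \<in> exit_set k (\<lambda>_ _. True))"
    using AE_bad AE_exit by (rule AE_conjI)
  then show ?thesis
  proof (rule AE_mp, intro AE_I2 impI)
    fix \<omega> assume "(\<forall>m. \<forall>\<^sub>F n in sequentially. \<omega> \<notin> Bad m n) \<and>
      (\<forall>k. k > 0 \<longrightarrow> \<omega> \<in> exit_set k (\<lambda>_ _. True))"
    then show "(\<lambda>k. real (exit_time Z k \<omega>) / real k) \<longlonglongrightarrow> L" using limit by blast
  qed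
qed

end

theorem mainTheorem2:
  fixes D :: "'a free_product_data" and M :: "'w measure"
    and Z :: "nat \<Rightarrow> 'w \<Rightarrow> 'a list" and \<nu> :: "nat \<Rightarrow> real"
  assumes walk: "free_product_walk D M Z"
    and radius: "conv_radius (\<lambda>n. nstep (words D) (trans_prob D) n [] []) > 1"
    and \<nu>_nonneg: "\<And>i. i \<in> indices D \<Longrightarrow> \<nu> i \<ge> 0"
    and \<nu>_sum: "(\<Sum>i\<in>indices D. \<nu> i) = 1"
    and \<nu>_invariant: "\<And>j. j \<in> indices D \<Longrightarrow> (\<Sum>i\<in>indices D. \<nu> i * qhat D M Z i j) = \<nu> j"
  shows "AE \<omega> in M. (\<lambda>k. real (exit_time Z k \<omega>) / real k) \<longlonglongrightarrow>
    (\<Sum>i\<in>indices D. \<Sum>j\<in>indices D - {i}.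
      \<nu> i * weight D j * ((1 - xi D M Z j 1) / (1 - xi D M Z i 1)) * deriv (gamma D M Z i j) 1)"
    (is "AE \<omega> in M. _ \<longlonglongrightarrow> ?L")
proof -
  interpret free_product_walk D M Z by (rule walk)
  let ?I = "indices D"
  obtain \<rho> where \<rho>: "\<rho> > 1" "Gf 0 (ennreal \<rho>) < \<top>" using radius_Gf[OF radius] by blast
  have ev: "eventually regular (nhds 1)" by (rule eventually_regular[OF \<rho>])
  have g1: "regular 1" using eventually_nhds_x_imp_x[OF ev] .
  define q where "q i j = (if i = j then 0 else stay j / stay i * (\<Sum>n. Kr i j n))" for i j
  define m where "m i = (\<Sum>j\<in>?I - {i}. stay j / stay i * (\<Sum>n. Kr i j n * real (Suc n)))" for i
  have krK: "(\<Sum>n. Kr i j n) = enn2real (Kf i j 1)" if "j \<in> ?I" "i \<noteq> j" for i j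
    using Kr_sums[OF g1 that g1] by (simp add: sums_iff)
  have qhat: "qhat D M Z i j = q i j" if "i \<in> ?I" "j \<in> ?I" for i j
  proof (cases "i = j")
    case False
    then show ?thesis using qhat_eq[OF that False g1] krK[OF that(2) False] by (simp add: q_def)
  qed (simp add: q_def qhat_def)
  have sgp: "stay i > 0" if "i = 0 \<or> i \<in> ?I" for i using that stay_pos[OF g1] stay_0 by auto
  have xi1: "1 - xi D M Z i 1 = stay i" if "i \<in> ?I" for i
    using xi_eq[OF that, of 1] g1 by (simp add: stay_def regular_def)
  have L: "?L = (\<Sum>i\<in>?I. \<nu> i * m i)"
  proof (intro sum.cong refl)
    fix i assume i: "i \<in> ?I"
    have "(\<Sum>j\<in>?I - {i}. \<nu> i * weight D j * ((1 - xi D M Z j 1) / (1 - xi D M Z i 1)) * deriv (gamma D M Z i j) 1) =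
      (\<Sum>j\<in>?I - {i}. \<nu> i * (stay j / stay i * (\<Sum>n. Kr i j n * real (Suc n))))"
    proof (intro sum.cong refl)
      fix j assume j: "j \<in> ?I - {i}"
      have "\<nu> i * weight D j * ((1 - xi D M Z j 1) / (1 - xi D M Z i 1)) * deriv (gamma D M Z i j) 1 =
        \<nu> i * (stay j / stay i * (weight D j * deriv (gamma D M Z i j) 1))"
        using i j by (simp add: xi1)
      also have "weight D j * deriv (gamma D M Z i j) 1 = (\<Sum>n. Kr i j n * real (Suc n))"
        using i j by (intro deriv_gamma ev) auto
      finally show "\<nu> i * weight D j * ((1 - xi D M Z j 1) / (1 - xi D M Z i 1)) * deriv (gamma D M Z i j) 1 =
        \<nu> i * (stay j / stay i * (\<Sum>n. Kr i j n * real (Suc n)))" .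
    qed
    then show "(\<Sum>j\<in>?I - {i}. \<nu> i * weight D j * ((1 - xi D M Z j 1) / (1 - xi D M Z i 1)) * deriv (gamma D M Z i j) 1) = \<nu> i * m i"
      by (simp add: m_def sum_distrib_left)
  qed
  have q_pos: "q i j > 0" if "i \<in> ?I" "j \<in> ?I" "i \<noteq> j" for i j
  proof -
    have "ennreal (weight D j) \<le> Kf i j 1"
    proof -
      have "Cf j 1 \<ge> wt j" unfolding Cf_def using csum_ge[of "\<lambda>n. cn j n * 1 ^ Suc n" 0] cn_0[OF that(2)] by simp
      also have "Cf j 1 \<le> Gf i 1 * Cf j 1" using mult_right_mono[OF Gf_ge_1[of i 1], of "Cf j 1"] by simp
      finally show ?thesis using that by (simp add: Kf_eq wt_def)
    qed
    then have "weight D j \<le> enn2real (Kf i j 1)"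
      using regular_Kf(1)[OF g1 that(2,3)] enn2real_mono[of "ennreal (weight D j)" "Kf i j 1"] weight_pos[OF that(2)] by simp
    then show ?thesis using that sgp krK[OF that(2,3)] weight_pos[OF that(2)] by (simp add: q_def)
  qed
  have q_row: "(\<Sum>j\<in>?I. q i j) = 1" if i: "i \<in> ?I" for i
  proof -
    have "(\<Sum>j\<in>?I. q i j) = (\<Sum>j\<in>?I - {i}. stay j * enn2real (Kf i j 1)) / stay i"
      using i by (subst sum.remove[OF finite_indices i]) (auto simp: q_def krK sum_divide_distrib intro!: sum.cong)
    then show ?thesis using stochastic[OF g1, of i] i sgp[of i] by simp
  qed
  have q_inv: "(\<Sum>i\<in>?I. \<nu> i * q i j) = \<nu> j" if "j \<in> ?I" for j
    using \<nu>_invariant[OF that] that by (simp add: qhat cong: sum.cong)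
  have orth: "(\<Sum>i\<in>?I. \<nu> i * (m i - ?L)) = 0"
    unfolding L by (simp add: right_diff_distrib sum_subtractf sum_distrib_right[symmetric] \<nu>_sum)
  obtain h where h: "\<And>i. i \<in> ?I \<Longrightarrow> h i = (m i - ?L) + (\<Sum>j\<in>?I. q i j * h j)"
  proof (rule poisson_equation[of ?I q \<nu> "\<lambda>i. m i - ?L"])
    show "0 \<le> q i i" for i by (simp add: q_def)
  qed (use q_pos q_row \<nu>_nonneg \<nu>_sum q_inv orth that in auto)
  \<comment> \<open>the initial type \<open>0\<close> is never revisited, so its value can be read off from the equation\<close>
  define h' where "h' i = (if i = 0 then (m 0 - ?L) + (\<Sum>j\<in>?I. q 0 j * h j) else h i)" for i
  have h'_eq: "h' i = (m i - ?L) + (\<Sum>j\<in>?I. q i j * h j)" if "i = 0 \<or> i \<in> ?I" for i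
    using that h by (auto simp: h'_def)
  show ?thesis
  proof (rule exit_time_limit[OF ev, of h'])
    fix i :: nat assume i: "i = 0 \<or> i \<in> ?I"
    have "(\<Sum>j\<in>?I - {i}. stay j * (\<Sum>n. Kr i j n * (real (Suc n) - ?L + h' j))) =
      (\<Sum>j\<in>?I - {i}. stay j * (\<Sum>n. Kr i j n * real (Suc n)) + stay j * enn2real (Kf i j 1) * (h j - ?L))"
    proof (intro sum.cong refl)
      fix j assume j: "j \<in> ?I - {i}"
      have hj: "h' j = h j" using j zero_notin_indices by (auto simp: h'_def)
      have s1: "summable (\<lambda>n. Kr i j n * real (Suc n))" using j by (intro Kr_summable ev) auto
      have s0: "(\<lambda>n. Kr i j n * (h j - ?L)) sums (enn2real (Kf i j 1) * (h j - ?L))"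
        using sums_mult2[OF Kr_sums[OF g1 _ _ g1, of j i], of "h j - ?L"] j by simp
      have "(\<lambda>n. Kr i j n * (real (Suc n) - ?L + h' j)) sums
        ((\<Sum>n. Kr i j n * real (Suc n)) + enn2real (Kf i j 1) * (h j - ?L))"
        unfolding hj
        by (rule sums_cong[THEN iffD1, OF _ sums_add[OF summable_sums[OF s1] s0]]) (simp only: distrib_left[symmetric], simp add: algebra_simps)
      then show "stay j * (\<Sum>n. Kr i j n * (real (Suc n) - ?L + h' j)) =
        stay j * (\<Sum>n. Kr i j n * real (Suc n)) + stay j * enn2real (Kf i j 1) * (h j - ?L)"
        by (simp only: sums_iff distrib_left mult.assoc)
    qed
    also have "\<dots> = stay i * m i + ((\<Sum>j\<in>?I - {i}. stay j * enn2real (Kf i j 1) * h j) - (\<Sum>j\<in>?I - {i}. stay j * enn2real (Kf i j 1)) * ?L)"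
    proof -
      have "stay i * m i = (\<Sum>j\<in>?I - {i}. stay j * (\<Sum>n. Kr i j n * real (Suc n)))"
        unfolding m_def sum_distrib_left using sgp[OF i] by (intro sum.cong refl) simp
      then show ?thesis by (simp only: sum.distrib right_diff_distrib sum_subtractf sum_distrib_right)
    qed
    also have "(\<Sum>j\<in>?I - {i}. stay j * enn2real (Kf i j 1) * h j) = stay i * (\<Sum>j\<in>?I. q i j * h j)"
    proof -
      have "(\<Sum>j\<in>?I. q i j * h j) = (\<Sum>j\<in>?I - {i}. q i j * h j)"
        by (rule sum.mono_neutral_right) (auto simp: q_def)
      then have "stay i * (\<Sum>j\<in>?I. q i j * h j) = (\<Sum>j\<in>?I - {i}. stay i * (q i j * h j))"
        by (simp only: sum_distrib_left)
      also have "\<dots> = (\<Sum>j\<in>?I - {i}. stay j * enn2real (Kf i j 1) * h j)"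
        using sgp[OF i] by (intro sum.cong refl) (auto simp: q_def krK)
      finally show ?thesis by (rule sym)
    qed
    also have "(\<Sum>j\<in>?I - {i}. stay j * enn2real (Kf i j 1)) = stay i" by (rule stochastic[OF g1 i])
    also have "stay i * m i + (stay i * (\<Sum>j\<in>?I. q i j * h j) - stay i * ?L) = stay i * h' i"
      unfolding h'_eq[OF i] by (simp only: distrib_left right_diff_distrib)
    finally show "stay i * h' i = (\<Sum>j\<in>?I - {i}. stay j * (\<Sum>n. Kr i j n * (real (Suc n) - ?L + h' j)))" by (rule sym)
  qed
qed

end
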